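(* Let $H$ be a semi-parabolic germ of transformation of $(\mathbb{C}^{2},0)$, with eigenvalues $\lambda$ and $\mu$, with $\lambda=e^{2\pi i p/q}$ and $|\mu|<1$. There exist local coordinates $(x,y)$ in which, for some integer $\nu\geq 1$, $H$ has the form $H(x,y)=(x_{1},y_{1})$, with $$\begin{cases} x_{1}=\lambda\left(x+x^{\nu q+1}+Cx^{2\nu q+1}+a_{2\nu q+2}(y)x^{2\nu q+2}+\dots\right)\\ y_{1}=\mu y+xh(x,y)\end{cases}$$ and $C$ a constant. Moreover the multiplicity of the fixed point is $\nu q+1$.
   Context: A semi-parabolic germ of transformation of $(\mathbb{C}^{2},0)$ is a germ of holomorphic map $H:(\mathbb{C}^{2},0)\to(\mathbb{C}^{2},0)$ such that $DH(0)$ has eigenvalues $\lambda=e^{2\pi i p/q}$ ($p/q$ in lowest terms, $q\ge1$) and $\mu$ with $|\mu|<1$. Local coordinates are holomorphic and centered at $0$. The $a_{j}(\cdot)$, $j\ge 2\nu q+2$, are germs of holomorphic functions of $y$ at $0\in\mathbb{C}$ and $h(\cdot,\cdot)$ is a germ of holomorphic function at $0\in\mathbb{C}^{2}$. The multiplicity of the fixed point is the multiplicity of $0$ as a solution of the equation $H^{\circ q}(x,y)=(x,y)$. The constant $\nu$ is called the (semi-)parabolic multiplicity of the fixed point.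
   Formalization: It is additionally assumed that μ ≠ 0 and that 0 is an isolated solution of H^{∘q}(x,y) = (x,y); without these the claim fails, e.g. for (x,y) ↦ (x+x², y²) and for (x,y) ↦ (λx, μy). *)

theory Defs
  imports "HOL-Analysis.Analysis" "HOL-Library.Extended_Nat"
begin

text \<open>
  Points of the complex plane $C^2$ are pairs of complex numbers.  A germ at the origin is
  represented by a total function of which only the behaviour near the origin matters.
\<close>

definition cscale :: "complex \<Rightarrow> complex \<times> complex \<Rightarrow> complex \<times> complex" where
  "cscale c p = (c * fst p, c * snd p)"

text \<open>
  Holomorphy in two variables: the (real) Frechet derivative exists and is complex linear.
\<close>

definition holomorphic2_on ::
    "(complex \<times> complex \<Rightarrow> complex) \<Rightarrow> (complex \<times> complex) set \<Rightarrow> bool" where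
  "holomorphic2_on f S \<longleftrightarrow>
     (\<forall>p\<in>S. \<exists>a b. (f has_derivative (\<lambda>(u, v). a * u + b * v)) (at p within S))"

definition holomorphic_germ :: "(complex \<times> complex \<Rightarrow> complex) \<Rightarrow> bool" where
  "holomorphic_germ f \<longleftrightarrow> (\<exists>U. open U \<and> 0 \<in> U \<and> holomorphic2_on f U)"

definition holomorphic_map_germ :: "(complex \<times> complex \<Rightarrow> complex \<times> complex) \<Rightarrow> bool" where
  "holomorphic_map_germ H \<longleftrightarrow>
     holomorphic_germ (\<lambda>p. fst (H p)) \<and> holomorphic_germ (\<lambda>p. snd (H p)) \<and> H 0 = 0"

definition has_eigenvalue ::
    "(complex \<times> complex \<Rightarrow> complex \<times> complex) \<Rightarrow> complex \<Rightarrow> bool" where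
  "has_eigenvalue D c \<longleftrightarrow> (\<exists>v. v \<noteq> 0 \<and> D v = cscale c v)"

text \<open>
  Since one eigenvalue has modulus 1 and the other has modulus less than 1, they are distinct,
  so they are all the eigenvalues and no algebraic multiplicities need be recorded.
\<close>

definition semi_parabolic_germ ::
    "(complex \<times> complex \<Rightarrow> complex \<times> complex) \<Rightarrow> int \<Rightarrow> nat \<Rightarrow> complex \<Rightarrow> complex \<Rightarrow> bool" where
  "semi_parabolic_germ H p q lam \<mu> \<longleftrightarrow>
     holomorphic_map_germ H \<and>
     q \<ge> 1 \<and> coprime p (int q) \<and>
     lam = exp (2 * of_real pi * \<i> * of_int p / of_nat q) \<and>
     cmod \<mu> < 1 \<and>
     has_eigenvalue (frechet_derivative H (at 0)) lam \<and>
     has_eigenvalue (frechet_derivative H (at 0)) \<mu>"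

text \<open>
  A local coordinate system \<open>\<phi>\<close> centered at the origin, together with its inverse germ \<open>\<psi>\<close>.
  In these coordinates a map germ \<open>H\<close> is expressed as \<open>\<phi> \<circ> H \<circ> \<psi>\<close>.
\<close>

definition local_coordinates ::
    "(complex \<times> complex \<Rightarrow> complex \<times> complex) \<Rightarrow>
     (complex \<times> complex \<Rightarrow> complex \<times> complex) \<Rightarrow> bool" where
  "local_coordinates \<phi> \<psi> \<longleftrightarrow>
     holomorphic_map_germ \<phi> \<and> holomorphic_map_germ \<psi> \<and>
     (\<forall>\<^sub>F p in nhds 0. \<psi> (\<phi> p) = p) \<and> (\<forall>\<^sub>F p in nhds 0. \<phi> (\<psi> p) = p)"

definition in_germ_ideal ::
    "(complex \<times> complex \<Rightarrow> complex) \<Rightarrow> (complex \<times> complex \<Rightarrow> complex) \<Rightarrow>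
     (complex \<times> complex \<Rightarrow> complex) \<Rightarrow> bool" where
  "in_germ_ideal f g u \<longleftrightarrow>
     (\<exists>a b. holomorphic_germ a \<and> holomorphic_germ b \<and>
        (\<forall>\<^sub>F p in nhds 0. u p = a p * f p + b p * g p))"

text \<open>
  The multiplicity of the origin as a solution of \<open>f = g = 0\<close>: the complex dimension of the local
  ring of holomorphic germs modulo the ideal generated by \<open>f\<close> and \<open>g\<close>.  The dimension is taken as
  the least size of a spanning family of the quotient; it is \<open>\<infinity>\<close> if no finite family spans,
  because the infimum of the empty set is \<open>\<infinity>\<close>.
\<close>

definition solution_multiplicity ::
    "(complex \<times> complex \<Rightarrow> complex) \<Rightarrow> (complex \<times> complex \<Rightarrow> complex) \<Rightarrow> enat" where
  "solution_multiplicity f g =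
     Inf {enat d | d. \<exists>e :: nat \<Rightarrow> complex \<times> complex \<Rightarrow> complex.
            (\<forall>i<d. holomorphic_germ (e i)) \<and>
            (\<forall>u. holomorphic_germ u \<longrightarrow>
               (\<exists>c :: nat \<Rightarrow> complex. in_germ_ideal f g (\<lambda>p. u p - (\<Sum>i<d. c i * e i p))))}"

definition fixed_point_multiplicity ::
    "(complex \<times> complex \<Rightarrow> complex \<times> complex) \<Rightarrow> nat \<Rightarrow> enat" where
  "fixed_point_multiplicity H q =
     solution_multiplicity (\<lambda>p. fst ((H ^^ q) p) - fst p) (\<lambda>p. snd ((H ^^ q) p) - snd p)"

text \<open>
  The normal form theorem is stated for germs with \<open>\<mu> \<noteq> 0\<close> (a germ of transformation is locally
  invertible) for which the origin is an isolated solution of $H^q(x,y) = (x,y)$ (so that its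
  multiplicity is finite).  Neither condition can be dropped.  For \<open>\<mu> = 0\<close> the normal form
  maps the curve $x = 0$ to the origin, whereas $(x,y) \mapsto (x + x^2, y^2)$ vanishes only at the
  origin in a neighbourhood of it.  The $q$-th iterate of $(x,y) \mapsto (e^{2 \pi i p/q} x, \mu y)$
  fixes every point of the curve $y = 0$, so that the multiplicity is infinite.
\<close>

end

theory Submission
  imports Defs "HOL-Complex_Analysis.Complex_Analysis"
begin

text \<open>
  The strong stable curve is parametrized by the limit of $H^{-n}(\mu^n t\, v)$, where $v$ is an eigenvector
  for $\mu$; this straightens it to $x = 0$ and linearizes the dynamics on it.  Coordinate changes
  $X = x\,w(x, y)$ then normalize the coefficients $a_j(y)$ of $x_1 = \sum_j a_j(y) x^j$ one after another.
  Each step is a cohomological equation $u(y) - c\,u(\mu y) = b(y)$ with $|c| = 1$ and $b(0) = 0$, solved by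
  $\sum_n c^n b(\mu^n y)$; only the constant part of a resonant coefficient survives.

  The equation $y_q = y$ defines a smooth curve, so the multiplicity of the fixed point is the order of
  $x_q - x$ along it.  As the fixed point is isolated this order is finite, hence some
  resonant coefficient is nonzero, and the first one has degree equal to the multiplicity.
  The resonant coefficients between the degrees $\nu q + 1$ and $2 \nu q + 1$ are removed by changes
  $X = x + b x^m$.
\<close>

section \<open>Holomorphic functions of two variables\<close>

text \<open>Coefficients in y are not extracted before the end: a normalization is a congruence
  modulo x^n (\<open>xcong\<close>), stable under products and compositions. Composition rests on
  Hadamard's lemma. That lemma and the inverse function theorem need continuous partial derivatives,
  whereas holomorphy only postulates a complex linear derivative at each point; hence the Cauchy
  integrals with parameters at the start. No small divisors occur: as \<mu> contracts the y-axis, a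
  division by 1 - \<open>lam\<close>^(n-1) happens only at y = 0, in the nonresonant case. Nothing
  visible in the coefficients bounds the number of steps before a nonzero resonant one appears. The
  bound comes from the multiplicity: if it is at most m, the germ cannot be made linear in x modulo
  x^(m+3), which would force multiplicity at least m+3. The change X = x + b x^(d+1) acts on the
  coefficient of x^(N+d), N = \<nu>q+1, through the factor d+1-N. It vanishes exactly for d = N-1,
  so the coefficient of x^(2\<nu>q+1) is made constant but is not removed in this way: it is
  C.\<close>

definition dx :: "(complex \<times> complex \<Rightarrow> complex) \<Rightarrow> complex \<times> complex \<Rightarrow> complex" where
  "dx f p = deriv (\<lambda>x. f (x, snd p)) (fst p)"

definition dy :: "(complex \<times> complex \<Rightarrow> complex) \<Rightarrow> complex \<times> complex \<Rightarrow> complex" where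
  "dy f p = deriv (\<lambda>y. f (fst p, y)) (snd p)"

lemma holomorphic2_on_open:
  assumes "open U"
  shows "holomorphic2_on f U \<longleftrightarrow> (\<forall>p\<in>U. \<exists>a b. (f has_derivative (\<lambda>(u, v). a * u + b * v)) (at p))"
  unfolding holomorphic2_on_def by (intro ball_cong refl) (simp add: at_within_open[OF _ assms])

lemma has_derivative_imp_field_derivative_fst:
  fixes f :: "complex \<times> complex \<Rightarrow> complex"
  assumes "(f has_derivative (\<lambda>(u, v). a * u + b * v)) (at (x, y))"
  shows "((\<lambda>x. f (x, y)) has_field_derivative a) (at x)"
proof -
  have "((\<lambda>x. f (x, y)) has_derivative (\<lambda>u. (\<lambda>(u, v). a * u + b * v) (u, 0::complex))) (at x)"
    by (rule has_derivative_compose[of "\<lambda>x. (x, y)", OF _ assms]) (auto intro!: derivative_eq_intros)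
  then show ?thesis
    by (simp add: has_field_derivative_def)
qed

lemma has_derivative_imp_field_derivative_snd:
  fixes f :: "complex \<times> complex \<Rightarrow> complex"
  assumes "(f has_derivative (\<lambda>(u, v). a * u + b * v)) (at (x, y))"
  shows "((\<lambda>y. f (x, y)) has_field_derivative b) (at y)"
proof -
  have "((\<lambda>y. f (x, y)) has_derivative (\<lambda>v. (\<lambda>(u, v). a * u + b * v) (0::complex, v))) (at y)"
    by (rule has_derivative_compose[of "\<lambda>y. (x, y)", OF _ assms]) (auto intro!: derivative_eq_intros)
  then show ?thesis
    by (simp add: has_field_derivative_def)
qed

lemma dx_dy_eq:
  assumes "(f has_derivative (\<lambda>(u, v). a * u + b * v)) (at p)"
  shows "dx f p = a" "dy f p = b"
  using has_derivative_imp_field_derivative_fst[of f a b "fst p" "snd p"]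
    has_derivative_imp_field_derivative_snd[of f a b "fst p" "snd p"] assms
  by (auto simp: dx_def dy_def intro!: DERIV_imp_deriv)

lemma holomorphic2_on_has_derivative:
  assumes "open U" "holomorphic2_on f U" "p \<in> U"
  shows "(f has_derivative (\<lambda>(u, v). dx f p * u + dy f p * v)) (at p)"
  using assms dx_dy_eq[of f _ _ p] by (auto simp: holomorphic2_on_open)

lemma holomorphic2_on_field_derivative_fst:
  assumes "open U" "holomorphic2_on f U" "(x, y) \<in> U"
  shows "((\<lambda>x. f (x, y)) has_field_derivative dx f (x, y)) (at x)"
  using has_derivative_imp_field_derivative_fst holomorphic2_on_has_derivative assms by blast

lemma holomorphic2_on_imp_continuous_on:
  assumes "open U" "holomorphic2_on f U"
  shows "continuous_on U f"
  using assms holomorphic2_on_has_derivative has_derivative_continuous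
  by (metis continuous_at_imp_continuous_on)

lemma holomorphic2_on_subset:
  "holomorphic2_on f U \<Longrightarrow> V \<subseteq> U \<Longrightarrow> holomorphic2_on f V"
  unfolding holomorphic2_on_def by (meson has_derivative_subset subsetD)

lemma holomorphic2_on_transform:
  assumes "holomorphic2_on f U" "\<And>p. p \<in> U \<Longrightarrow> f p = g p"
  shows "holomorphic2_on g U"
  unfolding holomorphic2_on_def
proof
  fix p assume p: "p \<in> U"
  then obtain a b where "(f has_derivative (\<lambda>(u, v). a * u + b * v)) (at p within U)"
    using assms(1) unfolding holomorphic2_on_def by blast
  then have "(g has_derivative (\<lambda>(u, v). a * u + b * v)) (at p within U)"
    by (rule has_derivative_transform[OF p, rotated]) (simp add: assms(2))
  then show "\<exists>a b. (g has_derivative (\<lambda>(u, v). a * u + b * v)) (at p within U)" by blast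
qed

lemma holomorphic2_on_const [simp]: "holomorphic2_on (\<lambda>p. c) S"
  unfolding holomorphic2_on_def by (intro ballI exI[of _ 0]) (auto simp: case_prod_unfold)

lemma holomorphic2_on_fst [simp]: "holomorphic2_on fst S"
  unfolding holomorphic2_on_def
  by (intro ballI exI[of _ 1] exI[of _ 0]) (auto simp: case_prod_unfold intro!: derivative_eq_intros)

lemma holomorphic2_on_snd [simp]: "holomorphic2_on snd S"
  unfolding holomorphic2_on_def
  by (rule ballI, rule exI[of _ 0], rule exI[of _ 1])
    (auto simp: case_prod_unfold intro!: derivative_eq_intros)

lemma holomorphic2_on_add:
  assumes "holomorphic2_on f S" "holomorphic2_on g S"
  shows "holomorphic2_on (\<lambda>p. f p + g p) S"
  unfolding holomorphic2_on_def
proof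
  fix p assume "p \<in> S"
  then obtain a b c d where "(f has_derivative (\<lambda>(u, v). a * u + b * v)) (at p within S)"
    "(g has_derivative (\<lambda>(u, v). c * u + d * v)) (at p within S)"
    using assms unfolding holomorphic2_on_def by meson
  then have "((\<lambda>p. f p + g p) has_derivative
      (\<lambda>q. (\<lambda>(u, v). a * u + b * v) q + (\<lambda>(u, v). c * u + d * v) q)) (at p within S)"
    by (rule has_derivative_add)
  moreover have "(\<lambda>q. (\<lambda>(u, v). a * u + b * v) q + (\<lambda>(u, v). c * u + d * v) q)
     = (\<lambda>(u, v). (a + c) * u + (b + d) * v)"
    by (auto simp: fun_eq_iff algebra_simps)
  ultimately show "\<exists>a b. ((\<lambda>p. f p + g p) has_derivative (\<lambda>(u, v). a * u + b * v)) (at p within S)"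
    by metis
qed

lemma holomorphic2_on_mult:
  assumes "holomorphic2_on f S" "holomorphic2_on g S"
  shows "holomorphic2_on (\<lambda>p. f p * g p) S"
  unfolding holomorphic2_on_def
proof
  fix p assume "p \<in> S"
  then obtain a b c d where "(f has_derivative (\<lambda>(u, v). a * u + b * v)) (at p within S)"
    "(g has_derivative (\<lambda>(u, v). c * u + d * v)) (at p within S)"
    using assms unfolding holomorphic2_on_def by meson
  then have "((\<lambda>p. f p * g p) has_derivative
      (\<lambda>q. f p * (\<lambda>(u, v). c * u + d * v) q + (\<lambda>(u, v). a * u + b * v) q * g p)) (at p within S)"
    by (rule has_derivative_mult)
  moreover have "(\<lambda>q. f p * (\<lambda>(u, v). c * u + d * v) q + (\<lambda>(u, v). a * u + b * v) q * g p)
     = (\<lambda>(u, v). (f p * c + a * g p) * u + (f p * d + b * g p) * v)"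
    by (auto simp: fun_eq_iff algebra_simps)
  ultimately show "\<exists>a b. ((\<lambda>p. f p * g p) has_derivative (\<lambda>(u, v). a * u + b * v)) (at p within S)"
    by metis
qed

lemma holomorphic2_on_compose:
  assumes "open S" "open T" "holomorphic2_on f T" "holomorphic2_on A S" "holomorphic2_on B S"
    and "\<And>p. p \<in> S \<Longrightarrow> (A p, B p) \<in> T"
  shows "holomorphic2_on (\<lambda>p. f (A p, B p)) S"
  unfolding holomorphic2_on_open[OF assms(1)]
proof
  fix p assume p: "p \<in> S"
  let ?P = "(A p, B p)"
  have "((\<lambda>p. (A p, B p)) has_derivative
      (\<lambda>q. ((\<lambda>(u, v). dx A p * u + dy A p * v) q, (\<lambda>(u, v). dx B p * u + dy B p * v) q))) (at p)"
    using p assms by (intro has_derivative_Pair holomorphic2_on_has_derivative) auto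
  from has_derivative_compose[OF this holomorphic2_on_has_derivative[OF assms(2,3,6)[OF ]]] p
  have "((\<lambda>p. f (A p, B p)) has_derivative
      (\<lambda>q. (\<lambda>(u, v). dx f ?P * u + dy f ?P * v)
         ((\<lambda>(u, v). dx A p * u + dy A p * v) q, (\<lambda>(u, v). dx B p * u + dy B p * v) q))) (at p)"
    by simp
  moreover have "(\<lambda>q. (\<lambda>(u, v). dx f ?P * u + dy f ?P * v)
         ((\<lambda>(u, v). dx A p * u + dy A p * v) q, (\<lambda>(u, v). dx B p * u + dy B p * v) q))
     = (\<lambda>(u, v). (dx f ?P * dx A p + dy f ?P * dx B p) * u + (dx f ?P * dy A p + dy f ?P * dy B p) * v)"
    by (auto simp: fun_eq_iff algebra_simps)
  ultimately show "\<exists>a b. ((\<lambda>p. f (A p, B p)) has_derivative (\<lambda>(u, v). a * u + b * v)) (at p)"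
    by metis
qed

lemma holomorphic2_on_compose_holomorphic:
  assumes "open S" "open T" "g holomorphic_on T" "holomorphic2_on f S"
    and "\<And>p. p \<in> S \<Longrightarrow> f p \<in> T"
  shows "holomorphic2_on (\<lambda>p. g (f p)) S"
  unfolding holomorphic2_on_open[OF assms(1)]
proof
  fix p assume p: "p \<in> S"
  have "(g has_derivative ((*) (deriv g (f p)))) (at (f p))"
    using holomorphic_derivI[OF assms(3,2,5)[OF ]] p by (simp add: has_field_derivative_def)
  from has_derivative_compose[OF holomorphic2_on_has_derivative[OF assms(1,4) p] this]
  have "((\<lambda>p. g (f p)) has_derivative (\<lambda>q. deriv g (f p) * (\<lambda>(u, v). dx f p * u + dy f p * v) q)) (at p)"
    by simp
  moreover have "(\<lambda>q. deriv g (f p) * (\<lambda>(u, v). dx f p * u + dy f p * v) q)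
     = (\<lambda>(u, v). (deriv g (f p) * dx f p) * u + (deriv g (f p) * dy f p) * v)"
    by (auto simp: fun_eq_iff algebra_simps)
  ultimately show "\<exists>a b. ((\<lambda>p. g (f p)) has_derivative (\<lambda>(u, v). a * u + b * v)) (at p)"
    by metis
qed

lemma holomorphic2_on_compose_curve:
  assumes "open T" "open S" "holomorphic2_on f T" "A holomorphic_on S" "B holomorphic_on S"
    and "\<And>t. t \<in> S \<Longrightarrow> (A t, B t) \<in> T"
  shows "(\<lambda>t. f (A t, B t)) holomorphic_on S"
  unfolding holomorphic_on_open[OF assms(2)]
proof
  fix t assume t: "t \<in> S"
  let ?P = "(A t, B t)"
  have "((\<lambda>t. (A t, B t)) has_derivative (\<lambda>q. (deriv A t * q, deriv B t * q))) (at t)"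
    using holomorphic_derivI[OF assms(4,2) t] holomorphic_derivI[OF assms(5,2) t]
    by (intro has_derivative_Pair) (auto simp: has_field_derivative_def)
  from has_derivative_compose[OF this holomorphic2_on_has_derivative[OF assms(1,3,6)[OF ]]] t
  have "((\<lambda>t. f (A t, B t)) has_derivative
      (\<lambda>q. dx f ?P * (deriv A t * q) + dy f ?P * (deriv B t * q))) (at t)"
    by simp
  moreover have "(\<lambda>q. dx f ?P * (deriv A t * q) + dy f ?P * (deriv B t * q))
      = (*) (dx f ?P * deriv A t + dy f ?P * deriv B t)"
    by (auto simp: fun_eq_iff algebra_simps)
  ultimately have "((\<lambda>t. f (A t, B t)) has_field_derivative (dx f ?P * deriv A t + dy f ?P * deriv B t)) (at t)"
    unfolding has_field_derivative_def by metis
  then show "\<exists>f'. ((\<lambda>t. f (A t, B t)) has_field_derivative f') (at t)" by blast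
qed

text \<open>The circle does not move with (x, y), so both variables enter only through an integrand
  over a fixed interval, to which continuity and differentiation under the integral sign apply. The
  factor \<open>r * exp ...\<close> is the velocity of the circle divided by 2 pi i.\<close>

lemma dx_circle_formula:
  assumes U: "open U" and f: "holomorphic2_on f U" and r: "r > 0" and sub: "cball x0 r \<times> V \<subseteq> U"
    and x: "x \<in> ball x0 r" and y: "y \<in> V"
  shows "dx f (x, y) = integral {0..1} (\<lambda>s. r * exp (2 * of_real pi * \<i> * of_real s) *
           f (circlepath x0 r s, y) / (circlepath x0 r s - x)\<^sup>2)"
proof -
  have D: "((\<lambda>x. f (x, y)) has_field_derivative dx f (x, y)) (at x)" if "x \<in> cball x0 r" for x
    using holomorphic2_on_field_derivative_fst[OF U f, of x y] sub y that by blast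
  have "(\<lambda>x. f (x, y)) holomorphic_on ball x0 r"
    unfolding holomorphic_on_def
  proof
    fix z assume "z \<in> ball x0 r"
    then have "z \<in> cball x0 r" by simp
    from has_field_derivative_at_within[OF D[OF this]]
    show "(\<lambda>x. f (x, y)) field_differentiable (at z within ball x0 r)"
      unfolding field_differentiable_def by blast
  qed
  moreover have "continuous_on (cball x0 r) (\<lambda>x. f (x, y))"
    by (intro continuous_at_imp_continuous_on ballI) (rule DERIV_isCont[OF D])
  ultimately have "((\<lambda>x. f (x, y)) has_field_derivative
      1 / (2 * of_real pi * \<i>) * contour_integral (circlepath x0 r) (\<lambda>u. f (u, y) / (u - x)\<^sup>2)) (at x)"
    using x by (intro Cauchy_derivative_integral_circlepath)
  then have "dx f (x, y) = 1 / (2 * of_real pi * \<i>) * contour_integral (circlepath x0 r) (\<lambda>u. f (u, y) / (u - x)\<^sup>2)"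
    using x by (intro DERIV_unique[OF D]) auto
  also have "\<dots> = integral {0..1} (\<lambda>s. 1 / (2 * of_real pi * \<i>) * (f (circlepath x0 r s, y) / (circlepath x0 r s - x)\<^sup>2 *
                       vector_derivative (circlepath x0 r) (at s)))"
    unfolding contour_integral_integral by (rule integral_mult_right[symmetric])
  also have "\<dots> = integral {0..1} (\<lambda>s. r * exp (2 * of_real pi * \<i> * of_real s) *
           f (circlepath x0 r s, y) / (circlepath x0 r s - x)\<^sup>2)"
    unfolding vector_derivative_circlepath by (rule integral_cong) (simp add: field_simps)
  finally show ?thesis .
qed

text \<open>The norm of a pair is Euclidean, hence at most the sum of the norms of its components.
  Products of discs are what Cauchy's formula in one variable needs.\<close>

lemma polydisc_subset_ball:
  fixes x0 y0 :: complex
  assumes "r + s \<le> R" "s > 0"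
  shows "cball x0 r \<times> ball y0 s \<subseteq> ball (x0, y0) R"
proof
  fix p assume "p \<in> cball x0 r \<times> ball y0 s"
  moreover have "dist (x0, y0) p \<le> dist x0 (fst p) + dist y0 (snd p)"
    using sqrt_sum_squares_le_sum[of "dist x0 (fst p)" "dist y0 (snd p)"]
    by (cases p) (simp add: dist_prod_def)
  ultimately show "p \<in> ball (x0, y0) R" using assms by (cases p) auto
qed

text \<open>Holomorphy in the parameter upgrades joint continuity of $f$ to joint continuity of
  its first partial derivative, by Cauchy's integral formula on a fixed circle.\<close>

lemma continuous_on_dx_param:
  fixes f :: "complex \<times> complex \<Rightarrow> real \<Rightarrow> complex"
  assumes U: "open U" and cont: "continuous_on (U \<times> T) (\<lambda>(p, t). f p t)"
    and f: "\<And>t. t \<in> T \<Longrightarrow> holomorphic2_on (\<lambda>p. f p t) U"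
  shows "continuous_on (U \<times> T) (\<lambda>(p, t). dx (\<lambda>p. f p t) p)"
  unfolding continuous_on_eq_continuous_within
proof clarify
  fix x0 y0 t0 assume p0: "(x0, y0) \<in> U" and t0: "t0 \<in> T"
  obtain R where R: "R > 0" "ball (x0, y0) R \<subseteq> U"
    using U p0 open_contains_ball by blast
  define r where "r = R / 2"
  have r: "r > 0" and sub: "cball x0 r \<times> ball y0 r \<subseteq> U"
    using R polydisc_subset_ball[of r r R x0 y0] by (auto simp: r_def)
  let ?W = "ball x0 r \<times> ball y0 r"
  let ?g = "\<lambda>z::(complex \<times> complex) \<times> real. \<lambda>s::real. r * exp (2 * of_real pi * \<i> * of_real s) *
           f (circlepath x0 r s, snd (fst z)) (snd z) / (circlepath x0 r s - fst (fst z))\<^sup>2"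
  have cp: "continuous_on UNIV (circlepath x0 r)"
    by (auto simp: circlepath intro!: continuous_intros)
  have "continuous_on ((?W \<times> T) \<times> cbox 0 1) (\<lambda>(z, s). ?g z s)"
  proof -
    have "continuous_on ((?W \<times> T) \<times> cbox 0 1)
       (\<lambda>w. (\<lambda>(p, t). f p t) ((circlepath x0 r (snd w), snd (fst (fst w))), snd (fst w)))"
      by (intro continuous_on_compose2[OF cont] continuous_on_Pair continuous_on_compose2[OF cp]
          continuous_intros) (use sub r in \<open>auto simp: circlepath dist_norm norm_mult intro!: subsetD[OF sub]\<close>)
    moreover have "circlepath x0 r s - a \<noteq> 0" if "a \<in> ball x0 r" for a s
      using that r by (auto simp: circlepath dist_norm norm_mult algebra_simps)
    ultimately show ?thesis
      by (auto simp: case_prod_unfold intro!: continuous_intros continuous_on_compose2[OF cp])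
  qed
  from integral_continuous_on_param[OF this]
  have "continuous_on (?W \<times> T) (\<lambda>z. integral {0..1} (?g z))" by simp
  then have "continuous_on (?W \<times> T) (\<lambda>(p, t). dx (\<lambda>p. f p t) p)"
    apply (rule continuous_on_eq)
    apply clarify
    subgoal for a b t
      by (subst dx_circle_formula[OF U f r sub]) (auto)
    done
  then have "continuous (at ((x0, y0), t0) within ?W \<times> T) (\<lambda>(p, t). dx (\<lambda>p. f p t) p)"
    using r t0 by (auto simp: continuous_on_eq_continuous_within)
  moreover have "at ((x0, y0), t0) within ?W \<times> T = at ((x0, y0), t0) within U \<times> T"
  proof (rule at_within_nhd[of _ "?W \<times> UNIV"])
    have "?W \<subseteq> U" using sub by (meson Sigma_mono ball_subset_cball order_trans order_refl)
    then show "(?W \<times> T) \<inter> (?W \<times> UNIV) - {((x0, y0), t0)} = (U \<times> T) \<inter> (?W \<times> UNIV) - {((x0, y0), t0)}"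
      by blast
  qed (use r in \<open>auto intro!: open_Times\<close>)
  ultimately show "continuous (at ((x0, y0), t0) within U \<times> T) (\<lambda>(p, t). dx (\<lambda>p. f p t) p)"
    by simp
qed

lemma holomorphic2_on_swap:
  assumes "open U" "holomorphic2_on f U"
  shows "holomorphic2_on (\<lambda>p. f (snd p, fst p)) ((\<lambda>p. (snd p, fst p)) -` U)"
  by (rule holomorphic2_on_compose[OF _ assms])
    (auto intro!: open_vimage continuous_intros assms(1))


text \<open>Exchanging the coordinates turns \<open>dy\<close> into \<open>dx\<close>.\<close>

lemma continuous_on_dy_param:
  fixes f :: "complex \<times> complex \<Rightarrow> real \<Rightarrow> complex"
  assumes U: "open U" and cont: "continuous_on (U \<times> T) (\<lambda>(p, t). f p t)"
    and f: "\<And>t. t \<in> T \<Longrightarrow> holomorphic2_on (\<lambda>p. f p t) U"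
  shows "continuous_on (U \<times> T) (\<lambda>(p, t). dy (\<lambda>p. f p t) p)"
proof -
  let ?U = "(\<lambda>p. (snd p, fst p)) -` U"
  have "open ?U"
    by (intro open_vimage U continuous_intros)
  moreover have "continuous_on (?U \<times> T) (\<lambda>z. (\<lambda>(p, t). f p t) ((snd (fst z), fst (fst z)), snd z))"
    by (intro continuous_on_compose2[OF cont] continuous_intros) auto
  then have "continuous_on (?U \<times> T) (\<lambda>(p, t). f (snd p, fst p) t)"
    by (simp add: case_prod_unfold)
  moreover have "holomorphic2_on (\<lambda>p. f (snd p, fst p) t) ?U" if "t \<in> T" for t
    by (rule holomorphic2_on_swap[OF U f[OF that]])
  ultimately have *: "continuous_on (?U \<times> T) (\<lambda>(p, t). dx (\<lambda>p. f (snd p, fst p) t) p)"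
    by (rule continuous_on_dx_param)
  have "continuous_on (U \<times> T)
     (\<lambda>z. (\<lambda>(p, t). dx (\<lambda>p. f (snd p, fst p) t) p) ((snd (fst z), fst (fst z)), snd z))"
    by (intro continuous_on_compose2[OF *] continuous_intros) auto
  then show ?thesis
    by (simp add: case_prod_unfold dx_def dy_def)
qed

text \<open>Leibniz's rule for the real Frechet derivative asks for a derivative that is jointly
  continuous in the point and the parameter; this is why the continuity of \<open>dx\<close> and
  \<open>dy\<close> with a parameter was shown first. The integrated derivative is still complex
  linear because its two coefficients can be integrated separately.\<close>

lemma holomorphic2_on_integral:
  fixes f :: "complex \<times> complex \<Rightarrow> real \<Rightarrow> complex"
  assumes U: "open U" and cont: "continuous_on (U \<times> {0..1}) (\<lambda>(p, t). f p t)"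
    and f: "\<And>t. t \<in> {0..1} \<Longrightarrow> holomorphic2_on (\<lambda>p. f p t) U"
  shows "holomorphic2_on (\<lambda>p. integral {0..1} (f p)) U"
  unfolding holomorphic2_on_open[OF U]
proof
  fix p assume p: "p \<in> U"
  obtain R where R: "R > 0" "ball p R \<subseteq> U"
    using U p open_contains_ball by blast
  define A where "A = (\<lambda>p t. dx (\<lambda>p. f p t) p)"
  define B where "B = (\<lambda>p t. dy (\<lambda>p. f p t) p)"
  \<comment> \<open>Leibniz's rule is stated for bounded linear functions as objects.
    \<open>L1\<close> and \<open>L2\<close> turn coefficients into the forms a*u and b*v; being
    linear themselves, they commute with the integral.\<close>
  define L1 where "L1 = (\<lambda>a::complex. blinfun_mult_right a o\<^sub>L (fst_blinfun :: (complex \<times> complex) \<Rightarrow>\<^sub>L complex))"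
  define L2 where "L2 = (\<lambda>b::complex. blinfun_mult_right b o\<^sub>L (snd_blinfun :: (complex \<times> complex) \<Rightarrow>\<^sub>L complex))"
  have L: "bounded_linear L1" "bounded_linear L2"
    unfolding L1_def L2_def
    by (auto intro!: bounded_linear_intros)
  have apply_L: "blinfun_apply (L1 a + L2 b) = (\<lambda>(u, v). a * u + b * v)" for a b
    by (auto simp: L1_def L2_def blinfun.add_left fun_eq_iff)
  have cont_A: "continuous_on (U \<times> {0..1}) (\<lambda>(p, t). A p t)"
    unfolding A_def by (rule continuous_on_dx_param[OF U cont f])
  have cont_B: "continuous_on (U \<times> {0..1}) (\<lambda>(p, t). B p t)"
    unfolding B_def by (rule continuous_on_dy_param[OF U cont f])
  have slice: "continuous_on {0..1} (g q)" if "q \<in> U" "continuous_on (U \<times> {0..1}) (\<lambda>(p, t). g p t)"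
    for g :: "complex \<times> complex \<Rightarrow> real \<Rightarrow> complex" and q
  proof -
    have "continuous_on {0..1} (\<lambda>t. (\<lambda>(p, t). g p t) (q, t))"
      by (rule continuous_on_compose2[OF that(2)]) (use that(1) in \<open>auto intro!: continuous_intros\<close>)
    then show ?thesis by simp
  qed
  have "((\<lambda>p. integral (cbox 0 1) (f p)) has_derivative
      integral (cbox 0 1) (\<lambda>t. L1 (A p t) + L2 (B p t))) (at p within ball p R)"
  proof (rule leibniz_rule[where f = f and fx = "\<lambda>p t. L1 (A p t) + L2 (B p t)" and U = "ball p R"])
    fix q and t :: real assume "q \<in> ball p R" "t \<in> cbox 0 1"
    then have "q \<in> U" "t \<in> {0..1}" using R by auto
    from holomorphic2_on_has_derivative[OF U f[OF this(2)] this(1)]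
    show "((\<lambda>p. f p t) has_derivative blinfun_apply (L1 (A q t) + L2 (B q t))) (at q within ball p R)"
      unfolding apply_L A_def B_def by (rule has_derivative_at_withinI)
  next
    fix q assume "q \<in> ball p R"
    then show "f q integrable_on cbox 0 1"
      using R slice[OF _ cont, of q] by (intro integrable_continuous) auto
  next
    have "continuous_on (ball p R \<times> cbox 0 1) (\<lambda>z. L1 ((\<lambda>(p, t). A p t) z) + L2 ((\<lambda>(p, t). B p t) z))"
      using R
      by (intro continuous_intros bounded_linear.continuous_on[OF L(1)] bounded_linear.continuous_on[OF L(2)]
          continuous_on_subset[OF cont_A] continuous_on_subset[OF cont_B]) auto
    then show "continuous_on (ball p R \<times> cbox 0 1) (\<lambda>(p, t). L1 (A p t) + L2 (B p t))"
      by (simp add: case_prod_unfold)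
  qed (use R in auto)
  moreover have "integral {0..1} (\<lambda>t. L1 (A p t) + L2 (B p t))
      = L1 (integral {0..1} (A p)) + L2 (integral {0..1} (B p))"
  proof (intro integral_unique has_integral_add)
    have "(A p has_integral integral {0..1} (A p)) {0..1}" "(B p has_integral integral {0..1} (B p)) {0..1}"
      using slice[OF p cont_A] slice[OF p cont_B] by (auto intro!: integrable_integral integrable_continuous_interval)
    from has_integral_linear[OF this(1) L(1)] has_integral_linear[OF this(2) L(2)]
    show "((\<lambda>t. L1 (A p t)) has_integral L1 (integral {0..1} (A p))) {0..1}"
      "((\<lambda>t. L2 (B p t)) has_integral L2 (integral {0..1} (B p))) {0..1}"
      by (simp_all add: o_def)
  qed
  ultimately have "((\<lambda>p. integral {0..1} (f p)) has_derivative
      (\<lambda>(u, v). integral {0..1} (A p) * u + integral {0..1} (B p) * v)) (at p)"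
    using R by (simp add: apply_L at_within_open[of p "ball p R"])
  then show "\<exists>a b. ((\<lambda>p. integral {0..1} (f p)) has_derivative (\<lambda>(u, v). a * u + b * v)) (at p)"
    by blast
qed

lemma holomorphic2_on_cmult: "holomorphic2_on f S \<Longrightarrow> holomorphic2_on (\<lambda>p. c * f p) S"
  by (intro holomorphic2_on_mult) auto

lemma holomorphic2_on_diff:
  "holomorphic2_on f S \<Longrightarrow> holomorphic2_on g S \<Longrightarrow> holomorphic2_on (\<lambda>p. f p - g p) S"
  using holomorphic2_on_add[OF _ holomorphic2_on_cmult[of g S "-1"], of f] by simp

lemma holomorphic2_on_power: "holomorphic2_on f S \<Longrightarrow> holomorphic2_on (\<lambda>p. f p ^ n) S"
  by (induction n) (auto intro!: holomorphic2_on_mult)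

lemma holomorphic2_on_inverse:
  assumes "open S" "holomorphic2_on f S" "\<And>p. p \<in> S \<Longrightarrow> f p \<noteq> 0"
  shows "holomorphic2_on (\<lambda>p. inverse (f p)) S"
  by (rule holomorphic2_on_compose_holomorphic[OF assms(1) _ _ assms(2), of "-{0}"])
    (auto intro!: holomorphic_intros assms(3) open_delete)

lemma holomorphic2_on_local:
  assumes "open U" "\<And>p. p \<in> U \<Longrightarrow> \<exists>W. open W \<and> p \<in> W \<and> holomorphic2_on f W"
  shows "holomorphic2_on f U"
  unfolding holomorphic2_on_open[OF assms(1)] using assms(2) holomorphic2_on_open by blast

text \<open>For a fixed point of the circle the Cauchy integrand is holomorphic in (x, y), and
  integration over the circle preserves this.\<close>

lemma holomorphic2_on_dx:
  assumes U: "open U" and f: "holomorphic2_on f U"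
  shows "holomorphic2_on (dx f) U"
proof (rule holomorphic2_on_local[OF U])
  fix p0 assume "p0 \<in> U"
  then obtain x0 y0 R where R: "p0 = (x0, y0)" "R > 0" "ball (x0, y0) R \<subseteq> U"
    using U open_contains_ball by (metis surj_pair)
  define r where "r = R / 2"
  have r: "r > 0" and sub: "cball x0 r \<times> ball y0 r \<subseteq> U"
    using R polydisc_subset_ball[of r r R x0 y0] by (auto simp: r_def)
  let ?W = "ball x0 r \<times> ball y0 r"
  let ?g = "\<lambda>p s. r * exp (2 * of_real pi * \<i> * of_real s) *
           f (circlepath x0 r s, snd p) * inverse ((circlepath x0 r s - fst p)\<^sup>2)"
  have cp: "continuous_on UNIV (circlepath x0 r)"
    by (auto simp: circlepath intro!: continuous_intros)
  have ne: "circlepath x0 r s - a \<noteq> 0" if "a \<in> ball x0 r" for a s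
    using that r by (auto simp: circlepath dist_norm norm_mult algebra_simps)
  have W: "open ?W" by (auto intro!: open_Times)
  have "continuous_on (?W \<times> {0..1}) (\<lambda>(p, s). ?g p s)"
  proof -
    have "continuous_on (?W \<times> {0..1}) (\<lambda>w. f (circlepath x0 r (snd w), snd (fst w)))"
      by (intro continuous_on_compose2[OF holomorphic2_on_imp_continuous_on[OF U f]] continuous_on_Pair
          continuous_on_compose2[OF cp] continuous_intros)
        (use sub r in \<open>auto simp: circlepath dist_norm norm_mult intro!: subsetD[OF sub]\<close>)
    with ne show ?thesis
      by (auto simp: case_prod_unfold intro!: continuous_intros continuous_on_compose2[OF cp])
  qed
  moreover have "holomorphic2_on (\<lambda>p. ?g p s) ?W" for s
    using ne
    by (intro holomorphic2_on_mult holomorphic2_on_const holomorphic2_on_inverse[OF W] holomorphic2_on_power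
        holomorphic2_on_diff holomorphic2_on_compose[OF W U f] holomorphic2_on_fst holomorphic2_on_snd)
      (use r in \<open>auto simp: circlepath dist_norm norm_mult intro!: subsetD[OF sub]\<close>)
  ultimately have "holomorphic2_on (\<lambda>p. integral {0..1} (?g p)) ?W"
    by (rule holomorphic2_on_integral[OF W])
  then have "holomorphic2_on (dx f) ?W"
  proof (rule holomorphic2_on_transform)
    fix p assume "p \<in> ?W"
    then show "integral {0..1} (?g p) = dx f p"
      using dx_circle_formula[OF U f r sub, of "fst p" "snd p"] by (auto simp: divide_inverse)
  qed
  then show "\<exists>W. open W \<and> p0 \<in> W \<and> holomorphic2_on (dx f) W"
    using W r R(1) by (metis centre_in_ball mem_Times_iff fst_conv snd_conv)
qed

lemma holomorphic2_on_dy: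
  assumes U: "open U" and f: "holomorphic2_on f U"
  shows "holomorphic2_on (dy f) U"
proof -
  let ?U = "(\<lambda>p. (snd p, fst p)) -` U"
  have "open ?U"
    by (intro open_vimage U continuous_intros)
  then have "holomorphic2_on (dx (\<lambda>p. f (snd p, fst p))) ?U"
    using holomorphic2_on_dx holomorphic2_on_swap[OF U f] by blast
  from holomorphic2_on_swap[OF \<open>open ?U\<close> this] show ?thesis
    by (simp add: dx_def dy_def[abs_def] vimage_def)
qed

section \<open>Germs at the origin\<close>

lemma holomorphic_germ_ball:
  assumes "holomorphic_germ f"
  obtains r where "r > 0" "holomorphic2_on f (ball 0 r)"
  using assms holomorphic2_on_subset unfolding holomorphic_germ_def
  by (metis open_contains_ball)

lemma holomorphic_germ_op2:
  assumes "holomorphic_germ f" "holomorphic_germ g"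
    and "\<And>U. holomorphic2_on f U \<Longrightarrow> holomorphic2_on g U \<Longrightarrow> holomorphic2_on h U"
  shows "holomorphic_germ h"
proof -
  obtain U V where "open U" "0 \<in> U" "holomorphic2_on f U" "open V" "0 \<in> V" "holomorphic2_on g V"
    using assms(1,2) unfolding holomorphic_germ_def by blast
  then have "holomorphic2_on h (U \<inter> V)"
    by (intro assms(3)) (auto intro: holomorphic2_on_subset)
  then show ?thesis
    unfolding holomorphic_germ_def using \<open>open U\<close> \<open>open V\<close> \<open>0 \<in> U\<close> \<open>0 \<in> V\<close> by blast
qed

named_theorems germ_intros

lemma holomorphic_germ_const [germ_intros]: "holomorphic_germ (\<lambda>p. c)"
  and holomorphic_germ_fst [germ_intros]: "holomorphic_germ fst"
  and holomorphic_germ_snd [germ_intros]: "holomorphic_germ snd"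
  unfolding holomorphic_germ_def by (rule exI[of _ UNIV], simp)+

lemma holomorphic_germ_add [germ_intros]:
  "holomorphic_germ f \<Longrightarrow> holomorphic_germ g \<Longrightarrow> holomorphic_germ (\<lambda>p. f p + g p)"
  by (erule (1) holomorphic_germ_op2) (rule holomorphic2_on_add)

lemma holomorphic_germ_mult [germ_intros]:
  "holomorphic_germ f \<Longrightarrow> holomorphic_germ g \<Longrightarrow> holomorphic_germ (\<lambda>p. f p * g p)"
  by (erule (1) holomorphic_germ_op2) (rule holomorphic2_on_mult)

lemma holomorphic_germ_diff [germ_intros]:
  "holomorphic_germ f \<Longrightarrow> holomorphic_germ g \<Longrightarrow> holomorphic_germ (\<lambda>p. f p - g p)"
  by (erule (1) holomorphic_germ_op2) (rule holomorphic2_on_diff)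

lemma holomorphic_germ_uminus [germ_intros]:
  "holomorphic_germ f \<Longrightarrow> holomorphic_germ (\<lambda>p. - f p)"
  using holomorphic_germ_diff[OF holomorphic_germ_const, of f 0] by simp

lemma holomorphic_germ_power [germ_intros]:
  "holomorphic_germ f \<Longrightarrow> holomorphic_germ (\<lambda>p. f p ^ n)"
  by (erule holomorphic_germ_op2[OF _ holomorphic_germ_const]) (rule holomorphic2_on_power)

lemma holomorphic_germ_isCont:
  assumes "holomorphic_germ f"
  shows "isCont f 0"
  using assms holomorphic2_on_imp_continuous_on
  by (auto simp: holomorphic_germ_def continuous_on_eq_continuous_at)

lemma holomorphic_germ_compose_holomorphic:
  assumes "holomorphic_germ f" "g holomorphic_on S" "open S" "f 0 \<in> S"
  shows "holomorphic_germ (\<lambda>p. g (f p))"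
proof -
  obtain U where U: "open U" "0 \<in> U" "holomorphic2_on f U"
    using assms(1) unfolding holomorphic_germ_def by blast
  let ?V = "U \<inter> f -` S"
  have V: "open ?V"
    using continuous_open_preimage[OF holomorphic2_on_imp_continuous_on[OF U(1,3)] U(1) assms(3)] .
  have "holomorphic2_on (\<lambda>p. g (f p)) ?V"
    by (rule holomorphic2_on_compose_holomorphic[OF V assms(3,2)])
      (auto intro: holomorphic2_on_subset[OF U(3)])
  then show ?thesis
    unfolding holomorphic_germ_def using V U assms(4) by blast
qed

lemma holomorphic_germ_inverse [germ_intros]:
  assumes "holomorphic_germ f" "f 0 \<noteq> 0"
  shows "holomorphic_germ (\<lambda>p. inverse (f p))"
  by (rule holomorphic_germ_compose_holomorphic[OF assms(1), of _ "-{0}"])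
    (use assms(2) in \<open>auto intro!: holomorphic_intros\<close>)

lemma holomorphic_germ_dx: "holomorphic_germ f \<Longrightarrow> holomorphic_germ (dx f)"
  and holomorphic_germ_dy: "holomorphic_germ f \<Longrightarrow> holomorphic_germ (dy f)"
  using holomorphic2_on_dx holomorphic2_on_dy unfolding holomorphic_germ_def by blast+

lemma holomorphic_germ_has_derivative:
  "holomorphic_germ f \<Longrightarrow> (f has_derivative (\<lambda>(u, v). dx f 0 * u + dy f 0 * v)) (at 0)"
  using holomorphic2_on_has_derivative unfolding holomorphic_germ_def by blast

lemma holomorphic_map_germ_has_derivative:
  assumes "holomorphic_map_germ \<Phi>"
  shows "(\<Phi> has_derivative (\<lambda>(u, v).
    (dx (\<lambda>p. fst (\<Phi> p)) 0 * u + dy (\<lambda>p. fst (\<Phi> p)) 0 * v,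
     dx (\<lambda>p. snd (\<Phi> p)) 0 * u + dy (\<lambda>p. snd (\<Phi> p)) 0 * v))) (at 0)"
proof -
  have "((\<lambda>p. (fst (\<Phi> p), snd (\<Phi> p))) has_derivative (\<lambda>q.
    ((\<lambda>(u, v). dx (\<lambda>p. fst (\<Phi> p)) 0 * u + dy (\<lambda>p. fst (\<Phi> p)) 0 * v) q,
     (\<lambda>(u, v). dx (\<lambda>p. snd (\<Phi> p)) 0 * u + dy (\<lambda>p. snd (\<Phi> p)) 0 * v) q))) (at 0)"
    using assms unfolding holomorphic_map_germ_def
    by (intro has_derivative_Pair holomorphic_germ_has_derivative) auto
  then show ?thesis by (simp add: case_prod_unfold)
qed

lemma holomorphic_map_germ_isCont:
  "holomorphic_map_germ \<Phi> \<Longrightarrow> isCont \<Phi> 0"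
  by (rule has_derivative_continuous[OF holomorphic_map_germ_has_derivative])

text \<open>Map germs fix the origin and are continuous there, so an identity of germs survives
  substitution. Inverse coordinates cancel only near the origin, and this lemma lets them cancel
  behind further maps.\<close>

lemma eventually_map_germ:
  assumes "holomorphic_map_germ \<Phi>" "\<forall>\<^sub>F p in nhds 0. P p"
  shows "\<forall>\<^sub>F p in nhds 0. P (\<Phi> p)"
proof -
  have "filterlim \<Phi> (nhds 0) (nhds 0)"
    using holomorphic_map_germ_isCont[OF assms(1)] assms(1)
    by (simp add: isCont_def tendsto_nhds_iff holomorphic_map_germ_def)
  then show ?thesis using assms(2) filterlim_iff by blast
qed

lemma holomorphic_germ_compose:
  assumes "holomorphic_germ f" "holomorphic_map_germ \<Phi>"
  shows "holomorphic_germ (\<lambda>p. f (\<Phi> p))"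
proof -
  obtain T where T: "open T" "0 \<in> T" "holomorphic2_on f T"
    using assms(1) unfolding holomorphic_germ_def by blast
  obtain U V where U: "open U" "0 \<in> U" "holomorphic2_on (\<lambda>p. fst (\<Phi> p)) U"
    and V: "open V" "0 \<in> V" "holomorphic2_on (\<lambda>p. snd (\<Phi> p)) V"
    using assms(2) unfolding holomorphic_map_germ_def holomorphic_germ_def by blast
  obtain W where W: "open W" "0 \<in> W" "\<And>p. p \<in> W \<Longrightarrow> \<Phi> p \<in> T"
    using eventually_map_germ[OF assms(2) eventually_nhds_in_open[OF T(1,2)]]
    unfolding eventually_nhds by blast
  have "holomorphic2_on (\<lambda>p. f (fst (\<Phi> p), snd (\<Phi> p))) (U \<inter> V \<inter> W)"
    by (rule holomorphic2_on_compose[OF _ T(1,3)])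
      (auto intro!: open_Int U(1) V(1) W(1,3) intro: holomorphic2_on_subset[OF U(3)] holomorphic2_on_subset[OF V(3)])
  then have "holomorphic2_on (\<lambda>p. f (\<Phi> p)) (U \<inter> V \<inter> W)" by simp
  moreover have "open (U \<inter> V \<inter> W)" "0 \<in> U \<inter> V \<inter> W" using U V W by auto
  ultimately show ?thesis
    unfolding holomorphic_germ_def by blast
qed

lemma holomorphic_map_germ_fst [germ_intros]: "holomorphic_map_germ \<Phi> \<Longrightarrow> holomorphic_germ (\<lambda>p. fst (\<Phi> p))"
  and holomorphic_map_germ_snd [germ_intros]: "holomorphic_map_germ \<Phi> \<Longrightarrow> holomorphic_germ (\<lambda>p. snd (\<Phi> p))"
  and holomorphic_map_germ_0: "holomorphic_map_germ \<Phi> \<Longrightarrow> \<Phi> 0 = 0"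
  by (auto simp: holomorphic_map_germ_def)

lemma holomorphic_map_germ_compose:
  "holomorphic_map_germ \<Phi> \<Longrightarrow> holomorphic_map_germ \<Psi> \<Longrightarrow> holomorphic_map_germ (\<lambda>p. \<Phi> (\<Psi> p))"
  using holomorphic_germ_compose[of "\<lambda>p. fst (\<Phi> p)" \<Psi>] holomorphic_germ_compose[of "\<lambda>p. snd (\<Phi> p)" \<Psi>]
  by (simp add: holomorphic_map_germ_def)

lemma holomorphic_map_germ_ident [germ_intros]: "holomorphic_map_germ (\<lambda>p. p)"
  by (simp add: holomorphic_map_germ_def germ_intros)

lemma holomorphic_map_germ_Pair [germ_intros]:
  "holomorphic_germ f \<Longrightarrow> holomorphic_germ g \<Longrightarrow> f 0 = 0 \<Longrightarrow> g 0 = 0 \<Longrightarrow> holomorphic_map_germ (\<lambda>p. (f p, g p))"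
  by (simp add: holomorphic_map_germ_def zero_prod_def)

lemma holomorphic_map_germ_funpow [germ_intros]:
  "holomorphic_map_germ \<Phi> \<Longrightarrow> holomorphic_map_germ (\<Phi> ^^ n)"
proof (induction n)
  case 0
  then show ?case using holomorphic_map_germ_ident by (simp add: id_def)
next
  case (Suc n)
  then show ?case using holomorphic_map_germ_compose[of \<Phi> "\<Phi> ^^ n"] by (simp add: o_def)
qed

lemma dx_compose_germ:
  assumes "holomorphic_germ f" "holomorphic_map_germ \<Phi>"
  shows "dx (\<lambda>p. f (\<Phi> p)) 0 = dx f 0 * dx (\<lambda>p. fst (\<Phi> p)) 0 + dy f 0 * dx (\<lambda>p. snd (\<Phi> p)) 0"
    and "dy (\<lambda>p. f (\<Phi> p)) 0 = dx f 0 * dy (\<lambda>p. fst (\<Phi> p)) 0 + dy f 0 * dy (\<lambda>p. snd (\<Phi> p)) 0"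
proof -
  let ?D = "(\<lambda>(u, v).
    (dx (\<lambda>p. fst (\<Phi> p)) 0 * u + dy (\<lambda>p. fst (\<Phi> p)) 0 * v,
     dx (\<lambda>p. snd (\<Phi> p)) 0 * u + dy (\<lambda>p. snd (\<Phi> p)) 0 * v))"
  have "(f has_derivative (\<lambda>(u, v). dx f 0 * u + dy f 0 * v)) (at (\<Phi> 0))"
    using holomorphic_germ_has_derivative[OF assms(1)] assms(2) by (simp add: holomorphic_map_germ_def)
  from has_derivative_compose[OF holomorphic_map_germ_has_derivative[OF assms(2)] this]
  have "((\<lambda>p. f (\<Phi> p)) has_derivative (\<lambda>q. (\<lambda>(u, v). dx f 0 * u + dy f 0 * v) (?D q))) (at 0)" .
  moreover have "(\<lambda>q. (\<lambda>(u, v). dx f 0 * u + dy f 0 * v) (?D q)) = (\<lambda>(u, v).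
     (dx f 0 * dx (\<lambda>p. fst (\<Phi> p)) 0 + dy f 0 * dx (\<lambda>p. snd (\<Phi> p)) 0) * u +
     (dx f 0 * dy (\<lambda>p. fst (\<Phi> p)) 0 + dy f 0 * dy (\<lambda>p. snd (\<Phi> p)) 0) * v)"
    by (auto simp: fun_eq_iff algebra_simps)
  ultimately have "((\<lambda>p. f (\<Phi> p)) has_derivative (\<lambda>(u, v).
     (dx f 0 * dx (\<lambda>p. fst (\<Phi> p)) 0 + dy f 0 * dx (\<lambda>p. snd (\<Phi> p)) 0) * u +
     (dx f 0 * dy (\<lambda>p. fst (\<Phi> p)) 0 + dy f 0 * dy (\<lambda>p. snd (\<Phi> p)) 0) * v)) (at 0)"
    by metis
  from dx_dy_eq[OF this]
  show "dx (\<lambda>p. f (\<Phi> p)) 0 = dx f 0 * dx (\<lambda>p. fst (\<Phi> p)) 0 + dy f 0 * dx (\<lambda>p. snd (\<Phi> p)) 0"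
    and "dy (\<lambda>p. f (\<Phi> p)) 0 = dx f 0 * dy (\<lambda>p. fst (\<Phi> p)) 0 + dy f 0 * dy (\<lambda>p. snd (\<Phi> p)) 0" .
qed

text \<open>Hadamard's lemma: the increment of $f$ is integrated along the segment from $B$ to $A$.\<close>

lemma germ_diff_in_ideal:
  assumes f: "holomorphic_germ f" and A: "holomorphic_map_germ A" and B: "holomorphic_map_germ B"
  shows "in_germ_ideal (\<lambda>p. fst (A p) - fst (B p)) (\<lambda>p. snd (A p) - snd (B p)) (\<lambda>p. f (A p) - f (B p))"
proof -
  obtain R where R: "R > 0" "holomorphic2_on f (ball 0 R)"
    using holomorphic_germ_ball[OF f] .
  have "\<forall>\<^sub>F p in nhds 0. A p \<in> ball 0 R" "\<forall>\<^sub>F p in nhds 0. B p \<in> ball 0 R"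
    using R by (intro eventually_map_germ[OF A] eventually_map_germ[OF B] eventually_nhds_in_open; simp)+
  from eventually_conj[OF this]
  obtain W where W: "open W" "0 \<in> W" "\<And>p. p \<in> W \<Longrightarrow> A p \<in> ball 0 R \<and> B p \<in> ball 0 R"
    unfolding eventually_nhds by blast
  obtain r1 r2 r3 r4 where r: "r1 > 0" "r2 > 0" "r3 > 0" "r4 > 0"
    "holomorphic2_on (\<lambda>p. fst (A p)) (ball 0 r1)" "holomorphic2_on (\<lambda>p. snd (A p)) (ball 0 r2)"
    "holomorphic2_on (\<lambda>p. fst (B p)) (ball 0 r3)" "holomorphic2_on (\<lambda>p. snd (B p)) (ball 0 r4)"
    using A B unfolding holomorphic_map_germ_def by (metis holomorphic_germ_ball)
  define S where "S = W \<inter> ball 0 r1 \<inter> ball 0 r2 \<inter> ball 0 r3 \<inter> ball 0 r4"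
  have S: "open S" "0 \<in> S" using W r by (auto simp: S_def intro!: open_Int)
  have hA: "holomorphic2_on (\<lambda>p. fst (A p)) S" "holomorphic2_on (\<lambda>p. snd (A p)) S"
    and hB: "holomorphic2_on (\<lambda>p. fst (B p)) S" "holomorphic2_on (\<lambda>p. snd (B p)) S"
    using r(5-8) by (auto intro: holomorphic2_on_subset simp: S_def)
  define Z where "Z = (\<lambda>p t::real. (fst (B p) + of_real t * (fst (A p) - fst (B p)),
                             snd (B p) + of_real t * (snd (A p) - snd (B p))))"
  have Z: "Z p t \<in> ball 0 R" if "p \<in> S" "t \<in> {0..1}" for p t
  proof -
    have "(1 - t) *\<^sub>R B p + t *\<^sub>R A p \<in> ball 0 R"
      using W(3)[of p] that by (intro convexD_alt) (auto simp: S_def)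
    moreover have "Z p t = (1 - t) *\<^sub>R B p + t *\<^sub>R A p"
      by (auto simp: Z_def prod_eq_iff scaleR_conv_of_real algebra_simps)
    ultimately show ?thesis by simp
  qed
  have cont_Z: "continuous_on (S \<times> {0..1}) (\<lambda>(p, t). g (Z p t))" if "continuous_on (ball 0 R) g" for g :: "_ \<Rightarrow> complex"
  proof -
    note c = hA[THEN holomorphic2_on_imp_continuous_on[OF S(1)]] hB[THEN holomorphic2_on_imp_continuous_on[OF S(1)]]
    have c': "continuous_on (S \<times> {0..1::real}) (\<lambda>z. h (fst z))" if "continuous_on S h" for h :: "_ \<Rightarrow> complex"
      by (rule continuous_on_compose2[OF that]) (auto intro!: continuous_intros)
    have "continuous_on (S \<times> {0..1}) (\<lambda>z. g (Z (fst z) (snd z)))"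
    proof (rule continuous_on_compose2[OF that])
      show "continuous_on (S \<times> {0..1}) (\<lambda>z. Z (fst z) (snd z))"
        unfolding Z_def by (intro continuous_intros c'[OF c(1)] c'[OF c(2)] c'[OF c(3)] c'[OF c(4)])
    qed (use Z in auto)
    then show ?thesis by (simp add: case_prod_unfold)
  qed
  have M: "holomorphic2_on (\<lambda>p. integral {0..1} (\<lambda>t. g (Z p t))) S" if "holomorphic2_on g (ball 0 R)" for g
  proof (rule holomorphic2_on_integral[OF S(1)])
    show "continuous_on (S \<times> {0..1}) (\<lambda>(p, t). g (Z p t))"
      by (rule cont_Z[OF holomorphic2_on_imp_continuous_on[OF open_ball that]])
    fix t :: real assume t: "t \<in> {0..1}"
    show "holomorphic2_on (\<lambda>p. g (Z p t)) S"
      unfolding Z_def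
      by (rule holomorphic2_on_compose[OF S(1) open_ball that])
        (use Z[OF _ t] in \<open>auto intro!: holomorphic2_on_add holomorphic2_on_cmult holomorphic2_on_diff hA hB simp: Z_def simp del: mem_ball\<close>)
  qed
  have eq: "f (A p) - f (B p) = integral {0..1} (\<lambda>t. dx f (Z p t)) * (fst (A p) - fst (B p)) +
      integral {0..1} (\<lambda>t. dy f (Z p t)) * (snd (A p) - snd (B p))" if p: "p \<in> S" for p
  proof -
    let ?d1 = "fst (A p) - fst (B p)" and ?d2 = "snd (A p) - snd (B p)"
    have int: "(\<lambda>t. g (Z p t)) integrable_on {0..1}" if "continuous_on (ball 0 R) g" for g :: "_ \<Rightarrow> complex"
    proof -
      have "continuous_on {0..1::real} (\<lambda>t. (p, t))"
        by (intro continuous_on_Pair continuous_on_const continuous_on_id)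
      from continuous_on_compose2[OF cont_Z[OF that] this] show ?thesis
        using p by (intro integrable_continuous_interval) auto
    qed
    have "((\<lambda>t. f (Z p t)) has_vector_derivative (dx f (Z p t) * ?d1 + dy f (Z p t) * ?d2)) (at t within {0..1})"
      if t: "t \<in> {0..1}" for t
    proof -
      have "((\<lambda>t. Z p t) has_derivative (\<lambda>h. (of_real h * ?d1, of_real h * ?d2))) (at t within {0..1})"
        unfolding Z_def by (auto intro!: derivative_eq_intros has_derivative_Pair)
      from has_derivative_compose[OF this holomorphic2_on_has_derivative[OF open_ball R(2) Z[OF p t]]]
      show ?thesis
        by (simp add: has_vector_derivative_def scaleR_conv_of_real algebra_simps)
    qed
    from fundamental_theorem_of_calculus[OF _ this]
    have "((\<lambda>t. dx f (Z p t) * ?d1 + dy f (Z p t) * ?d2) has_integral f (Z p 1) - f (Z p 0)) {0..1}"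
      by simp
    moreover have "((\<lambda>t. dx f (Z p t) * ?d1 + dy f (Z p t) * ?d2) has_integral
       integral {0..1} (\<lambda>t. dx f (Z p t)) * ?d1 + integral {0..1} (\<lambda>t. dy f (Z p t)) * ?d2) {0..1}"
      using R(2) by (intro has_integral_add has_integral_mult_left integrable_integral int
          holomorphic2_on_imp_continuous_on[OF open_ball] holomorphic2_on_dx holomorphic2_on_dy) auto
    ultimately show ?thesis
      by (auto simp: Z_def dest: has_integral_unique)
  qed
  have "holomorphic_germ (\<lambda>p. integral {0..1} (\<lambda>t. dx f (Z p t)))"
    "holomorphic_germ (\<lambda>p. integral {0..1} (\<lambda>t. dy f (Z p t)))"
    unfolding holomorphic_germ_def
    by (intro exI[of _ S] conjI S M holomorphic2_on_dx holomorphic2_on_dy open_ball R(2))+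
  moreover have "\<forall>\<^sub>F p in nhds 0. f (A p) - f (B p) =
      integral {0..1} (\<lambda>t. dx f (Z p t)) * (fst (A p) - fst (B p)) +
      integral {0..1} (\<lambda>t. dy f (Z p t)) * (snd (A p) - snd (B p))"
    using eventually_nhds_in_open[OF S] eq by (rule eventually_mono)
  ultimately show ?thesis
    unfolding in_germ_ideal_def by blast
qed


text \<open>The real inverse function theorem gives an inverse that is merely real differentiable.
  Its derivative is the inverse of a complex linear bijection, hence complex linear, so the inverse
  is holomorphic.\<close>

lemma inverse_germ:
  assumes \<phi>: "holomorphic_map_germ \<phi>"
    and det: "dx (\<lambda>p. fst (\<phi> p)) 0 * dy (\<lambda>p. snd (\<phi> p)) 0 \<noteq> dy (\<lambda>p. fst (\<phi> p)) 0 * dx (\<lambda>p. snd (\<phi> p)) 0"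
  obtains \<psi> where "local_coordinates \<phi> \<psi>"
proof -
  define f1 where "f1 = (\<lambda>p. fst (\<phi> p))"
  define f2 where "f2 = (\<lambda>p. snd (\<phi> p))"
  obtain r1 r2 where r: "r1 > 0" "r2 > 0" "holomorphic2_on f1 (ball 0 r1)" "holomorphic2_on f2 (ball 0 r2)"
    using \<phi> unfolding holomorphic_map_germ_def f1_def f2_def by (metis holomorphic_germ_ball)
  define U where "U = ball (0 :: complex \<times> complex) (min r1 r2)"
  have U: "open U" "0 \<in> U" using r by (auto simp: U_def)
  have h: "holomorphic2_on f1 U" "holomorphic2_on f2 U"
    using r by (auto simp: U_def intro: holomorphic2_on_subset)
  define E1 where "E1 = Blinfun (\<lambda>x::complex. (x, 0::complex))"
  define E2 where "E2 = Blinfun (\<lambda>x::complex. (0::complex, x))"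
  have E: "blinfun_apply E1 = (\<lambda>x. (x, 0))" "blinfun_apply E2 = (\<lambda>x. (0, x))"
    unfolding E1_def E2_def by (auto intro!: bounded_linear_Blinfun_apply bounded_linear_Pair
        bounded_linear_ident bounded_linear_zero)
  define L where "L = (\<lambda>a b c d :: complex.
      ((E1 o\<^sub>L (blinfun_mult_right a o\<^sub>L fst_blinfun)) + (E1 o\<^sub>L (blinfun_mult_right b o\<^sub>L snd_blinfun))) +
      ((E2 o\<^sub>L (blinfun_mult_right c o\<^sub>L fst_blinfun)) + (E2 o\<^sub>L (blinfun_mult_right d o\<^sub>L snd_blinfun))))"
  have L: "blinfun_apply (L a b c d) = (\<lambda>(u, v). (a * u + b * v, c * u + d * v))" for a b c d
    by (auto simp: L_def E blinfun.add_left fun_eq_iff)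
  define f' where "f' = (\<lambda>p. L (dx f1 p) (dy f1 p) (dx f2 p) (dy f2 p))"
  have der: "(\<phi> has_derivative blinfun_apply (f' p)) (at p)" if "p \<in> U" for p
  proof -
    have "((\<lambda>p. (f1 p, f2 p)) has_derivative (\<lambda>q.
        ((\<lambda>(u, v). dx f1 p * u + dy f1 p * v) q, (\<lambda>(u, v). dx f2 p * u + dy f2 p * v) q))) (at p)"
      by (intro has_derivative_Pair holomorphic2_on_has_derivative[OF U(1)] h that)
    then show ?thesis
      by (simp add: f'_def L f1_def f2_def case_prod_unfold)
  qed
  have cont: "continuous_on U f'"
  proof -
    have c: "continuous_on U (dx f1)" "continuous_on U (dy f1)" "continuous_on U (dx f2)" "continuous_on U (dy f2)"
      by (intro holomorphic2_on_imp_continuous_on[OF U(1)] holomorphic2_on_dx holomorphic2_on_dy U h)+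
    have b: "bounded_linear (\<lambda>a. E o\<^sub>L (blinfun_mult_right a o\<^sub>L F))"
      for E :: "complex \<Rightarrow>\<^sub>L (complex \<times> complex)" and F :: "(complex \<times> complex) \<Rightarrow>\<^sub>L complex"
      by (intro bounded_linear_intros)
    show ?thesis
      unfolding f'_def L_def by (intro continuous_intros bounded_linear.continuous_on[OF b] c)
  qed
  define a b c d where abcd: "a = dx f1 0" "b = dy f1 0" "c = dx f2 0" "d = dy f2 0"
  define k where "k = a * d - b * c"
  have "k \<noteq> 0" using det by (simp add: k_def abcd f1_def f2_def)
  \<comment> \<open>The theorem wants an explicit left inverse of the derivative at the origin: the
    adjugate matrix divided by the determinant \<open>k\<close>.\<close>
  have "L (d / k) (- b / k) (- c / k) (a / k) o\<^sub>L f' 0 = id_blinfun"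
  proof (rule blinfun_eqI)
    fix q :: "complex \<times> complex"
    obtain u v where q: "q = (u, v)" by fastforce
    have "d * (a * u + b * v) - b * (c * u + d * v) = k * u" "a * (c * u + d * v) - c * (a * u + b * v) = k * v"
      by (simp_all add: k_def algebra_simps)
    then have "d / k * (a * u + b * v) + - b / k * (c * u + d * v) = u"
      "- c / k * (a * u + b * v) + a / k * (c * u + d * v) = v"
      using \<open>k \<noteq> 0\<close> by (simp_all add: field_simps)
    then show "blinfun_apply (L (d / k) (- b / k) (- c / k) (a / k) o\<^sub>L f' 0) q = blinfun_apply id_blinfun q"
      by (simp add: f'_def L q abcd)
  qed
  from inverse_function_theorem[OF U(1) der cont U(2) this]
  obtain U' V g g' where g: "open U'" "U' \<subseteq> U" "0 \<in> U'" "open V" "\<phi> 0 \<in> V" "homeomorphism U' V \<phi> g"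
    "\<And>y. y \<in> V \<Longrightarrow> (g has_derivative (g' y)) (at y)"
    "\<And>y. y \<in> V \<Longrightarrow> g' y = inv (blinfun_apply (f' (g y)))"
    "\<And>y. y \<in> V \<Longrightarrow> bij (blinfun_apply (f' (g y)))" by metis
  have "0 \<in> V" using g(5) holomorphic_map_germ_0[OF \<phi>] by simp
  have clinear: "g' y (u, v) = (fst (g' y (1, 0)) * u + fst (g' y (0, 1)) * v, snd (g' y (1, 0)) * u + snd (g' y (0, 1)) * v)"
    if y: "y \<in> V" for y u v
  proof -
    have bij: "bij (blinfun_apply (f' (g y)))" and g': "g' y = inv (blinfun_apply (f' (g y)))"
      using g y by auto
    have scale: "g' y (cscale z q) = cscale z (g' y q)" for z q
    proof -
      have "blinfun_apply (f' (g y)) (cscale z (g' y q)) = cscale z (blinfun_apply (f' (g y)) (g' y q))"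
        by (simp add: f'_def L cscale_def case_prod_unfold algebra_simps)
      also have "\<dots> = cscale z q" using bij by (simp add: g' bij_is_surj surj_f_inv_f)
      finally show ?thesis using bij by (metis g' bij_inv_eq_iff)
    qed
    have "g' y (u, v) = g' y (cscale u (1, 0) + cscale v (0, 1))" by (simp add: cscale_def)
    also have "\<dots> = cscale u (g' y (1, 0)) + cscale v (g' y (0, 1))"
      using has_derivative_linear[OF g(7)[OF y]] by (simp add: linear_add scale)
    finally show ?thesis by (simp add: cscale_def mult.commute)
  qed
  have "holomorphic2_on (\<lambda>y. fst (g y)) V" "holomorphic2_on (\<lambda>y. snd (g y)) V"
    unfolding holomorphic2_on_open[OF g(4)]
  proof safe
    fix y assume y: "(y :: complex \<times> complex) \<in> V"
    have D: "(\<lambda>q. fst (g' y q)) = (\<lambda>(u, v). fst (g' y (1, 0)) * u + fst (g' y (0, 1)) * v)"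
      "(\<lambda>q. snd (g' y q)) = (\<lambda>(u, v). snd (g' y (1, 0)) * u + snd (g' y (0, 1)) * v)"
      unfolding fun_eq_iff case_prod_unfold
      by (intro allI, metis clinear[OF y] fst_conv prod.collapse, metis clinear[OF y] snd_conv prod.collapse)
    show "\<exists>a b. ((\<lambda>y. fst (g y)) has_derivative (\<lambda>(u, v). a * u + b * v)) (at y)"
      using has_derivative_fst[OF g(7)[OF y]] unfolding D by blast
    show "\<exists>a b. ((\<lambda>y. snd (g y)) has_derivative (\<lambda>(u, v). a * u + b * v)) (at y)"
      using has_derivative_snd[OF g(7)[OF y]] unfolding D by blast
  qed
  moreover have "g 0 = 0"
    using g(3,6) holomorphic_map_germ_0[OF \<phi>] by (metis homeomorphism_apply1)
  ultimately have "holomorphic_map_germ g"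
    unfolding holomorphic_map_germ_def holomorphic_germ_def using g(4) \<open>0 \<in> V\<close> by blast
  moreover have "\<forall>\<^sub>F p in nhds 0. g (\<phi> p) = p"
    using eventually_nhds_in_open[OF g(1,3)] by eventually_elim (use g(6) in \<open>auto simp: homeomorphism_def\<close>)
  moreover have "\<forall>\<^sub>F p in nhds 0. \<phi> (g p) = p"
    using eventually_nhds_in_open[OF g(4) \<open>0 \<in> V\<close>] by eventually_elim (use g(6) in \<open>auto simp: homeomorphism_def\<close>)
  ultimately show ?thesis
    using \<phi> that unfolding local_coordinates_def by blast
qed

section \<open>Congruences modulo powers of the first coordinate and multiplicities\<close>

lemma holomorphic_germ_tendsto:
  assumes "holomorphic_germ f" shows "(f \<longlongrightarrow> f 0) (nhds 0)"
  using holomorphic_germ_isCont[OF assms] by (simp add: isCont_def tendsto_nhds_iff)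

lemma holomorphic_germ_eventually_nonzero:
  assumes "holomorphic_germ f" "f 0 \<noteq> 0" shows "\<forall>\<^sub>F p in nhds 0. f p \<noteq> 0"
  by (rule tendsto_imp_eventually_ne[OF holomorphic_germ_tendsto[OF assms(1)] assms(2)])

text \<open>Congruence modulo the ideal generated by x^n: the coefficients of 1, x, ..., x^(n-1), as
  functions of y, agree without being named. Only the quotient \<open>h\<close> has to be a germ, so
  the relation can be stated for expressions whose holomorphy has not been shown.\<close>

definition xcong :: "nat \<Rightarrow> (complex \<times> complex \<Rightarrow> complex) \<Rightarrow> (complex \<times> complex \<Rightarrow> complex) \<Rightarrow> bool" where
  "xcong n f g \<longleftrightarrow> (\<exists>h. holomorphic_germ h \<and> (\<forall>\<^sub>F p in nhds 0. f p = g p + fst p ^ n * h p))"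

lemma xcongE:
  assumes "xcong n f g"
  obtains h where "holomorphic_germ h" "\<forall>\<^sub>F p in nhds 0. f p = g p + fst p ^ n * h p"
  using assms unfolding xcong_def by blast

lemma xcongI:
  "holomorphic_germ h \<Longrightarrow> \<forall>\<^sub>F p in nhds 0. f p = g p + fst p ^ n * h p \<Longrightarrow> xcong n f g"
  unfolding xcong_def by blast

lemma xcong_eventually_eq: "\<forall>\<^sub>F p in nhds 0. f p = g p \<Longrightarrow> xcong n f g"
  by (rule xcongI[of "\<lambda>_. 0"]) (auto intro: germ_intros elim: eventually_mono)

lemma xcong_refl [simp]: "xcong n f f"
  by (simp add: xcong_eventually_eq)

lemma xcong_sym:
  assumes "xcong n f g" shows "xcong n g f"
proof -
  obtain h where h: "holomorphic_germ h" "\<forall>\<^sub>F p in nhds 0. f p = g p + fst p ^ n * h p"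
    using assms by (rule xcongE)
  show ?thesis
    by (rule xcongI[of "\<lambda>p. - h p"], intro germ_intros h, use h(2) in eventually_elim) simp
qed

lemma xcong_trans [trans]:
  assumes "xcong n f g" "xcong n g k" shows "xcong n f k"
proof -
  obtain h where h: "holomorphic_germ h" "\<forall>\<^sub>F p in nhds 0. f p = g p + fst p ^ n * h p"
    using assms(1) by (rule xcongE)
  obtain h' where h': "holomorphic_germ h'" "\<forall>\<^sub>F p in nhds 0. g p = k p + fst p ^ n * h' p"
    using assms(2) by (rule xcongE)
  show ?thesis
    by (rule xcongI[of "\<lambda>p. h p + h' p"], intro germ_intros h h', use h(2) h'(2) in eventually_elim)
      (simp add: algebra_simps)
qed

lemma xcong_add:
  assumes "xcong n f g" "xcong n f' g'" shows "xcong n (\<lambda>p. f p + f' p) (\<lambda>p. g p + g' p)"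
proof -
  obtain h where h: "holomorphic_germ h" "\<forall>\<^sub>F p in nhds 0. f p = g p + fst p ^ n * h p"
    using assms(1) by (rule xcongE)
  obtain h' where h': "holomorphic_germ h'" "\<forall>\<^sub>F p in nhds 0. f' p = g' p + fst p ^ n * h' p"
    using assms(2) by (rule xcongE)
  show ?thesis
    by (rule xcongI[of "\<lambda>p. h p + h' p"], intro germ_intros h h', use h(2) h'(2) in eventually_elim)
      (simp add: algebra_simps)
qed

text \<open>A factor divisible by x^m improves the precision of the other factor by m. Thanks to
  this gain, each normalization step needs the new coefficient only on the axis x = 0.\<close>

lemma xcong_mult_shift:
  assumes "xcong m f (\<lambda>p. 0)" "xcong n g k"
  shows "xcong (m + n) (\<lambda>p. f p * g p) (\<lambda>p. f p * k p)"
proof -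
  obtain h where h: "holomorphic_germ h" "\<forall>\<^sub>F p in nhds 0. f p = 0 + fst p ^ m * h p"
    using assms(1) by (rule xcongE)
  obtain h' where h': "holomorphic_germ h'" "\<forall>\<^sub>F p in nhds 0. g p = k p + fst p ^ n * h' p"
    using assms(2) by (rule xcongE)
  show ?thesis
    by (rule xcongI[of "\<lambda>p. h p * h' p"], intro germ_intros h h', use h(2) h'(2) in eventually_elim)
      (simp add: algebra_simps power_add)
qed

lemma xcong_0_germ: "holomorphic_germ f \<Longrightarrow> xcong 0 f (\<lambda>p. 0)"
  by (rule xcongI[of f]) auto

lemma xcong_fst_power: "xcong n (\<lambda>p. fst p ^ n) (\<lambda>p. 0)"
  by (rule xcongI[of "\<lambda>p. 1"]) (auto intro: germ_intros)

lemma xcong_mult_left: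
  "holomorphic_germ f \<Longrightarrow> xcong n g k \<Longrightarrow> xcong n (\<lambda>p. f p * g p) (\<lambda>p. f p * k p)"
  using xcong_mult_shift[OF xcong_0_germ] by simp

lemma xcong_mult:
  assumes "holomorphic_germ f" "holomorphic_germ g'" "xcong n f g" "xcong n f' g'"
  shows "xcong n (\<lambda>p. f p * f' p) (\<lambda>p. g p * g' p)"
  using xcong_trans[OF xcong_mult_left[OF assms(1,4)]] xcong_mult_left[OF assms(2,3)]
  by (simp add: mult.commute)

lemma xcong_cmult: "xcong n f g \<Longrightarrow> xcong n (\<lambda>p. c * f p) (\<lambda>p. c * g p)"
  by (rule xcong_mult_left[OF holomorphic_germ_const])

lemma xcong_diff:
  "xcong n f g \<Longrightarrow> xcong n f' g' \<Longrightarrow> xcong n (\<lambda>p. f p - f' p) (\<lambda>p. g p - g' p)"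
  using xcong_add[OF _ xcong_cmult[of n f' g' "-1"]] by simp

lemma xcong_mono:
  assumes "xcong n f g" "m \<le> n" shows "xcong m f g"
proof -
  obtain h where h: "holomorphic_germ h" "\<forall>\<^sub>F p in nhds 0. f p = g p + fst p ^ n * h p"
    using assms(1) by (rule xcongE)
  have "fst p ^ n = fst p ^ m * fst p ^ (n - m)" for p :: "complex \<times> complex"
    using assms(2) by (simp flip: power_add)
  then show ?thesis
    by (intro xcongI[of "\<lambda>p. fst p ^ (n - m) * h p"] germ_intros h, use h(2) in eventually_elim)
      (simp add: mult.assoc)
qed

lemma xcong_power_zero:
  assumes "xcong 1 f (\<lambda>p. 0)" shows "xcong n (\<lambda>p. f p ^ n) (\<lambda>p. 0)"
proof (induction n)
  case 0
  show ?case by (rule xcong_0_germ) (auto intro: germ_intros)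
next
  case (Suc n)
  show ?case using xcong_mult_shift[OF assms Suc] by simp
qed

text \<open>If \<Phi> preserves the axis x = 0, its first component is x times a germ
  \<open>k\<close>, and x^n pulls back to x^n k^n.\<close>

lemma xcong_compose:
  assumes "xcong n f g" "holomorphic_map_germ \<Phi>" "xcong 1 (\<lambda>p. fst (\<Phi> p)) (\<lambda>p. 0)"
  shows "xcong n (\<lambda>p. f (\<Phi> p)) (\<lambda>p. g (\<Phi> p))"
proof -
  obtain h where h: "holomorphic_germ h" "\<forall>\<^sub>F p in nhds 0. f p = g p + fst p ^ n * h p"
    using assms(1) by (rule xcongE)
  obtain k where k: "holomorphic_germ k" "\<forall>\<^sub>F p in nhds 0. fst (\<Phi> p) = 0 + fst p ^ 1 * k p"
    using assms(3) by (rule xcongE)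
  show ?thesis
  proof (rule xcongI[of "\<lambda>p. k p ^ n * h (\<Phi> p)"])
    show "\<forall>\<^sub>F p in nhds 0. f (\<Phi> p) = g (\<Phi> p) + fst p ^ n * (k p ^ n * h (\<Phi> p))"
      using eventually_map_germ[OF assms(2) h(2)] k(2)
      by eventually_elim (simp add: power_mult_distrib)
  qed (intro holomorphic_germ_mult holomorphic_germ_power k holomorphic_germ_compose[OF h(1) assms(2)])
qed

text \<open>Hadamard's lemma writes f(A) - f(B) as a combination of the differences of the two
  components, each divisible by x^n.\<close>

lemma xcong_compose_left:
  assumes f: "holomorphic_germ f" and AB: "holomorphic_map_germ A" "holomorphic_map_germ B"
    and "xcong n (\<lambda>p. fst (A p)) (\<lambda>p. fst (B p))" "xcong n (\<lambda>p. snd (A p)) (\<lambda>p. snd (B p))"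
  shows "xcong n (\<lambda>p. f (A p)) (\<lambda>p. f (B p))"
proof -
  obtain h where h: "holomorphic_germ h" "\<forall>\<^sub>F p in nhds 0. fst (A p) = fst (B p) + fst p ^ n * h p"
    using assms(4) by (rule xcongE)
  obtain h' where h': "holomorphic_germ h'" "\<forall>\<^sub>F p in nhds 0. snd (A p) = snd (B p) + fst p ^ n * h' p"
    using assms(5) by (rule xcongE)
  obtain a b where ab: "holomorphic_germ a" "holomorphic_germ b"
    "\<forall>\<^sub>F p in nhds 0. f (A p) - f (B p) = a p * (fst (A p) - fst (B p)) + b p * (snd (A p) - snd (B p))"
    using germ_diff_in_ideal[OF f AB] unfolding in_germ_ideal_def by blast
  show ?thesis
  proof (rule xcongI[of "\<lambda>p. a p * h p + b p * h' p"])
    show "\<forall>\<^sub>F p in nhds 0. f (A p) = f (B p) + fst p ^ n * (a p * h p + b p * h' p)"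
      using ab(3) h(2) h'(2)
    proof eventually_elim
      case (elim p)
      then have "f (A p) - f (B p) = a p * (fst p ^ n * h p) + b p * (fst p ^ n * h' p)" by simp
      then show ?case by (simp add: algebra_simps)
    qed
  qed (intro germ_intros ab h h')
qed

text \<open>The identity and the projection to (0, y) agree modulo x, so a germ is determined modulo
  x by its values on the axis.\<close>

lemma xcong_1_snd:
  assumes "holomorphic_germ f" shows "xcong 1 f (\<lambda>p. f (0, snd p))"
proof -
  have "holomorphic_map_germ (\<lambda>p::complex \<times> complex. (0, snd p))"
    by (intro holomorphic_map_germ_Pair germ_intros) auto
  from xcong_compose_left[OF assms holomorphic_map_germ_ident this, of 1] show ?thesis
    using xcong_fst_power[of 1] by simp
qed

lemma xcong_1_zeroI:
  assumes "holomorphic_germ f" "\<forall>\<^sub>F p :: complex \<times> complex in nhds 0. f (0, snd p) = 0"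
  shows "xcong 1 f (\<lambda>p. 0)"
  by (rule xcong_trans[OF xcong_1_snd[OF assms(1)] xcong_eventually_eq]) (rule assms(2))

section \<open>Ideals of germs and invariance of the multiplicity under coordinate changes\<close>

lemma in_germ_ideal_left: "in_germ_ideal f g f"
  unfolding in_germ_ideal_def by (intro exI[of _ "\<lambda>_. 1"] exI[of _ "\<lambda>_. 0"]) (simp add: germ_intros)

lemma in_germ_ideal_right: "in_germ_ideal f g g"
  unfolding in_germ_ideal_def by (rule exI[of _ "\<lambda>_. 0"], rule exI[of _ "\<lambda>_. 1"]) (simp add: germ_intros)

lemma in_germ_ideal_eventually_eq:
  assumes "\<forall>\<^sub>F p in nhds 0. u p = v p" "in_germ_ideal f g u" shows "in_germ_ideal f g v"
proof -
  obtain a b where ab: "holomorphic_germ a" "holomorphic_germ b" "\<forall>\<^sub>F p in nhds 0. u p = a p * f p + b p * g p"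
    using assms(2) unfolding in_germ_ideal_def by blast
  then have "\<forall>\<^sub>F p in nhds 0. v p = a p * f p + b p * g p"
    using assms(1) by (auto elim: eventually_elim2)
  then show ?thesis unfolding in_germ_ideal_def using ab by blast
qed

lemma in_germ_ideal_add:
  assumes "in_germ_ideal f g u" "in_germ_ideal f g v" shows "in_germ_ideal f g (\<lambda>p. u p + v p)"
proof -
  obtain a b where ab: "holomorphic_germ a" "holomorphic_germ b" "\<forall>\<^sub>F p in nhds 0. u p = a p * f p + b p * g p"
    using assms(1) unfolding in_germ_ideal_def by blast
  obtain c d where cd: "holomorphic_germ c" "holomorphic_germ d" "\<forall>\<^sub>F p in nhds 0. v p = c p * f p + d p * g p"
    using assms(2) unfolding in_germ_ideal_def by blast
  have "\<forall>\<^sub>F p in nhds 0. u p + v p = (a p + c p) * f p + (b p + d p) * g p"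
    using ab(3) cd(3) by eventually_elim (simp add: algebra_simps)
  then show ?thesis
    unfolding in_germ_ideal_def using holomorphic_germ_add[OF ab(1) cd(1)] holomorphic_germ_add[OF ab(2) cd(2)] by blast
qed

lemma in_germ_ideal_mult:
  assumes "holomorphic_germ h" "in_germ_ideal f g u" shows "in_germ_ideal f g (\<lambda>p. h p * u p)"
proof -
  obtain a b where ab: "holomorphic_germ a" "holomorphic_germ b" "\<forall>\<^sub>F p in nhds 0. u p = a p * f p + b p * g p"
    using assms(2) unfolding in_germ_ideal_def by blast
  have "\<forall>\<^sub>F p in nhds 0. h p * u p = (h p * a p) * f p + (h p * b p) * g p"
    using ab(3) by eventually_elim (simp add: algebra_simps)
  then show ?thesis
    unfolding in_germ_ideal_def using holomorphic_germ_mult[OF assms(1) ab(1)] holomorphic_germ_mult[OF assms(1) ab(2)] by blast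
qed

lemma in_germ_ideal_sum:
  "(\<And>i. i \<in> I \<Longrightarrow> in_germ_ideal f g (u i)) \<Longrightarrow> in_germ_ideal f g (\<lambda>p. \<Sum>i\<in>I. u i p)"
proof (induction I rule: infinite_finite_induct)
  case (insert i I)
  then show ?case by (simp add: in_germ_ideal_add)
qed (use in_germ_ideal_mult[OF holomorphic_germ_const[of 0] in_germ_ideal_left] in simp_all)

lemma in_germ_ideal_trans:
  assumes "in_germ_ideal f g f'" "in_germ_ideal f g g'" "in_germ_ideal f' g' u"
  shows "in_germ_ideal f g u"
proof -
  obtain a b where ab: "holomorphic_germ a" "holomorphic_germ b" "\<forall>\<^sub>F p in nhds 0. u p = a p * f' p + b p * g' p"
    using assms(3) unfolding in_germ_ideal_def by blast
  have "in_germ_ideal f g (\<lambda>p. a p * f' p + b p * g' p)"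
    by (intro in_germ_ideal_add in_germ_ideal_mult ab assms)
  then show ?thesis
    by (rule in_germ_ideal_eventually_eq[rotated]) (use ab(3) in \<open>auto elim: eventually_mono\<close>)
qed

lemma in_germ_ideal_compose:
  assumes "in_germ_ideal f g u" "holomorphic_map_germ \<Phi>"
  shows "in_germ_ideal (\<lambda>p. f (\<Phi> p)) (\<lambda>p. g (\<Phi> p)) (\<lambda>p. u (\<Phi> p))"
proof -
  obtain a b where ab: "holomorphic_germ a" "holomorphic_germ b" "\<forall>\<^sub>F p in nhds 0. u p = a p * f p + b p * g p"
    using assms(1) unfolding in_germ_ideal_def by blast
  show ?thesis
    unfolding in_germ_ideal_def
    using holomorphic_germ_compose[OF ab(1) assms(2)] holomorphic_germ_compose[OF ab(2) assms(2)]
      eventually_map_germ[OF assms(2) ab(3)] by blast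
qed

text \<open>The ideal of \<open>f'\<close> and \<open>g'\<close> is the smaller one, so a family
  spanning its quotient also spans the quotient by the ideal of \<open>f\<close> and
  \<open>g\<close>.\<close>

lemma solution_multiplicity_mono:
  assumes "in_germ_ideal f g f'" "in_germ_ideal f g g'"
  shows "solution_multiplicity f g \<le> solution_multiplicity f' g'"
  unfolding solution_multiplicity_def
proof (rule Inf_superset_mono, safe)
  fix d and e :: "nat \<Rightarrow> complex \<times> complex \<Rightarrow> complex"
  assume e: "\<forall>i<d. holomorphic_germ (e i)"
    and span: "\<forall>u. holomorphic_germ u \<longrightarrow> (\<exists>c. in_germ_ideal f' g' (\<lambda>p. u p - (\<Sum>i<d. c i * e i p)))"
  have "\<exists>c. in_germ_ideal f g (\<lambda>p. u p - (\<Sum>i<d. c i * e i p))" if "holomorphic_germ u" for u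
  proof -
    from span[rule_format, OF that] obtain c where "in_germ_ideal f' g' (\<lambda>p. u p - (\<Sum>i<d. c i * e i p))"
      by (rule exE)
    from in_germ_ideal_trans[OF assms this] show ?thesis by (intro exI[of _ c])
  qed
  then show "\<exists>d'. enat d = enat d' \<and> (\<exists>e. (\<forall>i<d'. holomorphic_germ (e i)) \<and>
      (\<forall>u. holomorphic_germ u \<longrightarrow> (\<exists>c. in_germ_ideal f g (\<lambda>p. u p - (\<Sum>i<d'. c i * e i p)))))"
    using e by (intro exI[of _ d] conjI refl exI[of _ e] allI impI) auto
qed

text \<open>A spanning family pulled back along \<psi> spans again: a germ u is expanded in the old
  coordinates as the composite of u with \<phi>. Equality will follow by exchanging the roles of
  \<phi> and \<psi>.\<close>

lemma solution_multiplicity_coordinates_le: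
  assumes lc: "local_coordinates \<phi> \<psi>"
  shows "solution_multiplicity (\<lambda>p. f (\<psi> p)) (\<lambda>p. g (\<psi> p)) \<le> solution_multiplicity f g"
  unfolding solution_multiplicity_def
proof (rule Inf_superset_mono, safe)
  fix d and e :: "nat \<Rightarrow> complex \<times> complex \<Rightarrow> complex"
  assume e: "\<forall>i<d. holomorphic_germ (e i)"
    "\<forall>u. holomorphic_germ u \<longrightarrow> (\<exists>c. in_germ_ideal f g (\<lambda>p. u p - (\<Sum>i<d. c i * e i p)))"
  have maps: "holomorphic_map_germ \<phi>" "holomorphic_map_germ \<psi>" and inv: "\<forall>\<^sub>F p in nhds 0. \<phi> (\<psi> p) = p"
    using lc by (auto simp: local_coordinates_def)
  have "\<exists>c. in_germ_ideal (\<lambda>p. f (\<psi> p)) (\<lambda>p. g (\<psi> p)) (\<lambda>p. u p - (\<Sum>i<d. c i * e i (\<psi> p)))"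
    if u: "holomorphic_germ u" for u
  proof -
    from e(2)[rule_format, OF holomorphic_germ_compose[OF u maps(1)]]
    obtain c where "in_germ_ideal f g (\<lambda>p. u (\<phi> p) - (\<Sum>i<d. c i * e i p))"
      by (rule exE)
    from in_germ_ideal_compose[OF this maps(2)]
    have "in_germ_ideal (\<lambda>p. f (\<psi> p)) (\<lambda>p. g (\<psi> p)) (\<lambda>p. u p - (\<Sum>i<d. c i * e i (\<psi> p)))"
      by (rule in_germ_ideal_eventually_eq[rotated]) (use inv in \<open>auto elim: eventually_mono\<close>)
    then show ?thesis by (intro exI[of _ c])
  qed
  moreover have "holomorphic_germ (\<lambda>p. e i (\<psi> p))" if "i < d" for i
    using e(1) maps(2) that by (auto intro: holomorphic_germ_compose)
  ultimately show "\<exists>d'. enat d = enat d' \<and> (\<exists>e. (\<forall>i<d'. holomorphic_germ (e i)) \<and>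
      (\<forall>u. holomorphic_germ u \<longrightarrow> (\<exists>c. in_germ_ideal (\<lambda>p. f (\<psi> p)) (\<lambda>p. g (\<psi> p)) (\<lambda>p. u p - (\<Sum>i<d'. c i * e i p)))))"
    by (intro exI[of _ d] conjI refl exI[of _ "\<lambda>i p. e i (\<psi> p)"] allI impI)
qed

lemma local_coordinates_sym: "local_coordinates \<phi> \<psi> \<Longrightarrow> local_coordinates \<psi> \<phi>"
  by (auto simp: local_coordinates_def)

lemma solution_multiplicity_coordinates:
  assumes lc: "local_coordinates \<phi> \<psi>"
  shows "solution_multiplicity (\<lambda>p. f (\<psi> p)) (\<lambda>p. g (\<psi> p)) = solution_multiplicity f g"
proof (rule antisym[OF solution_multiplicity_coordinates_le[OF lc]])
  \<comment> \<open>The composite of \<psi> with \<phi> is the identity only near the origin, so the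
    pulled back functions are compared with the original ones through the ideals they
    generate.\<close>
  have "\<forall>\<^sub>F p in nhds 0. \<psi> (\<phi> p) = p" using lc by (simp add: local_coordinates_def)
  then have "solution_multiplicity f g \<le> solution_multiplicity (\<lambda>p. f (\<psi> (\<phi> p))) (\<lambda>p. g (\<psi> (\<phi> p)))"
    by (intro solution_multiplicity_mono in_germ_ideal_eventually_eq[OF _ in_germ_ideal_left]
        in_germ_ideal_eventually_eq[OF _ in_germ_ideal_right]) (auto elim: eventually_mono)
  also have "\<dots> \<le> solution_multiplicity (\<lambda>p. f (\<psi> p)) (\<lambda>p. g (\<psi> p))"
    using solution_multiplicity_coordinates_le[OF local_coordinates_sym[OF lc], of "\<lambda>p. f (\<psi> p)" "\<lambda>p. g (\<psi> p)"] .
  finally show "solution_multiplicity f g \<le> solution_multiplicity (\<lambda>p. f (\<psi> p)) (\<lambda>p. g (\<psi> p))" .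
qed

text \<open>The inner pair of coordinate changes cancels only near the origin, so in each step the
  cancellation has to be pulled back along the iterate already reached.\<close>

lemma funpow_conjugate:
  assumes lc: "local_coordinates \<phi> \<psi>" and H: "holomorphic_map_germ H"
    and K: "\<forall>\<^sub>F p in nhds 0. K p = \<phi> (H (\<psi> p))"
  shows "\<forall>\<^sub>F p in nhds 0. (K ^^ n) p = \<phi> ((H ^^ n) (\<psi> p))"
proof (induction n)
  case 0
  then show ?case using lc by (auto simp: local_coordinates_def elim: eventually_mono)
next
  case (Suc n)
  have maps: "holomorphic_map_germ \<phi>" "holomorphic_map_germ \<psi>" and inv: "\<forall>\<^sub>F p in nhds 0. \<psi> (\<phi> p) = p"
    using lc by (auto simp: local_coordinates_def)
  have m: "holomorphic_map_germ (\<lambda>p. (H ^^ n) (\<psi> p))"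
    by (rule holomorphic_map_germ_compose[OF holomorphic_map_germ_funpow[OF H] maps(2)])
  have "\<forall>\<^sub>F p in nhds 0. K (\<phi> ((H ^^ n) (\<psi> p))) = \<phi> (H (\<psi> (\<phi> ((H ^^ n) (\<psi> p)))))"
    by (rule eventually_map_germ[OF holomorphic_map_germ_compose[OF maps(1) m] K])
  with Suc eventually_map_germ[OF m inv] show ?case
    by eventually_elim simp
qed

text \<open>Displacements do not transform by substitution alone, as \<phi> need not be linear.
  Hadamard's lemma for the components of \<phi>, at the iterate of H after \<psi> and at \<psi>
  itself, puts the displacement of the iterate of K into the ideal of the displacement of that of H,
  pulled back by \<psi>.\<close>

lemma fixed_point_multiplicity_conjugate_le:
  assumes lc: "local_coordinates \<phi> \<psi>" and H: "holomorphic_map_germ H"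
    and K: "\<forall>\<^sub>F p in nhds 0. K p = \<phi> (H (\<psi> p))"
  shows "fixed_point_multiplicity H n \<le> fixed_point_multiplicity K n"
proof -
  have maps: "holomorphic_map_germ \<phi>" "holomorphic_map_germ \<psi>" and inv: "\<forall>\<^sub>F p in nhds 0. \<phi> (\<psi> p) = p"
    using lc by (auto simp: local_coordinates_def)
  have Kn: "\<forall>\<^sub>F p in nhds 0. (K ^^ n) p = \<phi> ((H ^^ n) (\<psi> p))"
    by (rule funpow_conjugate[OF lc H K])
  have m: "holomorphic_map_germ (\<lambda>p. (H ^^ n) (\<psi> p))"
    by (rule holomorphic_map_germ_compose[OF holomorphic_map_germ_funpow[OF H] maps(2)])
  have "in_germ_ideal (\<lambda>p. fst ((H ^^ n) (\<psi> p)) - fst (\<psi> p)) (\<lambda>p. snd ((H ^^ n) (\<psi> p)) - snd (\<psi> p))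
     (\<lambda>p. fst ((K ^^ n) p) - fst p)"
    by (rule in_germ_ideal_eventually_eq[OF _ germ_diff_in_ideal[OF holomorphic_map_germ_fst[OF maps(1)] m maps(2)]])
      (use Kn inv in eventually_elim, simp)
  moreover have "in_germ_ideal (\<lambda>p. fst ((H ^^ n) (\<psi> p)) - fst (\<psi> p)) (\<lambda>p. snd ((H ^^ n) (\<psi> p)) - snd (\<psi> p))
     (\<lambda>p. snd ((K ^^ n) p) - snd p)"
    by (rule in_germ_ideal_eventually_eq[OF _ germ_diff_in_ideal[OF holomorphic_map_germ_snd[OF maps(1)] m maps(2)]])
      (use Kn inv in eventually_elim, simp)
  ultimately have "solution_multiplicity (\<lambda>p. fst ((H ^^ n) (\<psi> p)) - fst (\<psi> p)) (\<lambda>p. snd ((H ^^ n) (\<psi> p)) - snd (\<psi> p))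
      \<le> fixed_point_multiplicity K n"
    unfolding fixed_point_multiplicity_def by (rule solution_multiplicity_mono)
  then show ?thesis
    unfolding fixed_point_multiplicity_def
    using solution_multiplicity_coordinates[OF lc, of "\<lambda>p. fst ((H ^^ n) p) - fst p" "\<lambda>p. snd ((H ^^ n) p) - snd p"] by simp
qed

lemma fixed_point_multiplicity_conjugate:
  assumes lc: "local_coordinates \<phi> \<psi>" and H: "holomorphic_map_germ H"
  shows "fixed_point_multiplicity (\<lambda>p. \<phi> (H (\<psi> p))) n = fixed_point_multiplicity H n"
proof (rule antisym)
  have maps: "holomorphic_map_germ \<phi>" "holomorphic_map_germ \<psi>" and inv: "\<forall>\<^sub>F p in nhds 0. \<psi> (\<phi> p) = p"
    using lc by (auto simp: local_coordinates_def)
  have K: "holomorphic_map_germ (\<lambda>p. \<phi> (H (\<psi> p)))"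
    by (rule holomorphic_map_germ_compose[OF maps(1) holomorphic_map_germ_compose[OF H maps(2)]])
  have "\<forall>\<^sub>F p in nhds 0. H p = \<psi> (\<phi> (H (\<psi> (\<phi> p))))"
    using inv eventually_map_germ[OF H inv] by eventually_elim simp
  then show "fixed_point_multiplicity (\<lambda>p. \<phi> (H (\<psi> p))) n \<le> fixed_point_multiplicity H n"
    by (rule fixed_point_multiplicity_conjugate_le[OF local_coordinates_sym[OF lc] K])
  show "fixed_point_multiplicity H n \<le> fixed_point_multiplicity (\<lambda>p. \<phi> (H (\<psi> p))) n"
    by (rule fixed_point_multiplicity_conjugate_le[OF lc H]) simp
qed


section \<open>Multiplicity when the second equation defines a smooth curve\<close>

lemma dx_dy_coordinates [simp]: "dx fst p = 1" "dy fst p = 0" "dx snd p = 0" "dy snd p = 1"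
  by (simp_all add: dx_def dy_def)

text \<open>Hadamard's lemma at the origin gives u = u(0) + a x + b y, and expanding
  \<open>a\<close> in turn produces the Taylor polynomial on the axis y = 0. Thus 1, x, ..., x^(k-1)
  span the quotient by (x^k, y).\<close>

lemma taylor_mod_ideal:
  assumes "holomorphic_germ u"
  shows "\<exists>c. in_germ_ideal (\<lambda>p. fst p ^ k) snd (\<lambda>p. u p - (\<Sum>i<k. c i * fst p ^ i))"
  using assms
proof (induction k arbitrary: u)
  case 0
  have "in_germ_ideal (\<lambda>p. 1) snd (\<lambda>p. u p * 1)"
    by (rule in_germ_ideal_mult[OF 0 in_germ_ideal_left])
  then show ?case by simp
next
  case (Suc k)
  have "in_germ_ideal (\<lambda>p. fst p - fst (0 :: complex \<times> complex)) (\<lambda>p. snd p - snd (0 :: complex \<times> complex)) (\<lambda>p. u p - u 0)"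
    by (rule germ_diff_in_ideal[OF Suc.prems holomorphic_map_germ_ident])
      (simp add: holomorphic_map_germ_def germ_intros)
  then obtain a b where ab: "holomorphic_germ a" "holomorphic_germ b" "\<forall>\<^sub>F p in nhds 0. u p - u 0 = a p * fst p + b p * snd p"
    unfolding in_germ_ideal_def by auto
  obtain c \<alpha> \<beta> where c: "holomorphic_germ \<alpha>" "holomorphic_germ \<beta>"
    "\<forall>\<^sub>F p in nhds 0. a p - (\<Sum>i<k. c i * fst p ^ i) = \<alpha> p * fst p ^ k + \<beta> p * snd p"
    using Suc.IH[OF ab(1)] unfolding in_germ_ideal_def by blast
  \<comment> \<open>The constant term of \<open>u\<close> goes in front of the coefficients of
    \<open>a\<close>, which move up by one degree.\<close>
  let ?c = "case_nat (u 0) c"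
  have "\<forall>\<^sub>F p in nhds 0. u p - (\<Sum>i<Suc k. ?c i * fst p ^ i) = \<alpha> p * fst p ^ Suc k + (b p + fst p * \<beta> p) * snd p"
    using ab(3) c(3)
  proof eventually_elim
    case (elim p)
    have "(\<Sum>i<Suc k. ?c i * fst p ^ i) = u 0 + fst p * (\<Sum>i<k. c i * fst p ^ i)"
      by (simp only: sum.lessThan_Suc_shift nat.case power_0 sum_distrib_left) (simp add: mult_ac)
    moreover have "u p = u 0 + fst p * a p + b p * snd p"
      using elim(1) by (simp add: algebra_simps)
    moreover have "a p = (\<Sum>i<k. c i * fst p ^ i) + \<alpha> p * fst p ^ k + \<beta> p * snd p"
      using elim(2) by (simp add: algebra_simps)
    ultimately show ?case by (simp add: algebra_simps)
  qed
  moreover have "holomorphic_germ (\<lambda>p. b p + fst p * \<beta> p)"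
    by (intro germ_intros ab c)
  ultimately show ?case
    unfolding in_germ_ideal_def using c(1) by (intro exI[of _ ?c] exI conjI) auto
qed

text \<open>The limit at 0 isolates the constant term, which must vanish; away from 0 one factor x
  is then cancelled, and induction on k applies.\<close>

lemma polynomial_eq_power_mult:
  fixes a :: "complex \<Rightarrow> complex"
  assumes "isCont a 0" "\<forall>\<^sub>F x in at 0. (\<Sum>j<k. c j * x ^ j) = x ^ k * a x" "j < k"
  shows "c j = 0"
  using assms(2,3)
proof (induction k arbitrary: c j)
  case (Suc k)
  have split: "(\<Sum>j<Suc k. c j * x ^ j) = c 0 + x * (\<Sum>j<k. c (Suc j) * x ^ j)" for x :: complex
    by (simp only: sum.lessThan_Suc_shift sum_distrib_left) (simp add: mult_ac)
  have "((\<lambda>x. \<Sum>j<Suc k. c j * x ^ j) \<longlongrightarrow> c 0 + 0 * (\<Sum>j<k. c (Suc j) * 0 ^ j)) (at 0)"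
    unfolding split by (intro tendsto_intros)
  moreover have "((\<lambda>x. x ^ Suc k * a x) \<longlongrightarrow> 0 ^ Suc k * a 0) (at 0)"
    using assms(1) by (intro tendsto_intros) (simp add: isCont_def)
  then have "((\<lambda>x. \<Sum>j<Suc k. c j * x ^ j) \<longlongrightarrow> 0 ^ Suc k * a 0) (at 0)"
    by (rule Lim_transform_eventually) (use Suc.prems(1) in \<open>auto elim: eventually_mono\<close>)
  ultimately have "c 0 + 0 * (\<Sum>j<k. c (Suc j) * 0 ^ j) = 0 ^ Suc k * a 0"
    by (intro tendsto_unique[of "at 0"]) auto
  then have c0: "c 0 = 0" by simp
  have "\<forall>\<^sub>F x in at 0. (\<Sum>j<k. c (Suc j) * x ^ j) = x ^ k * a x"
    using Suc.prems(1) eventually_neq_at_within[of 0 0 UNIV]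
    by eventually_elim (simp add: split c0 del: sum.lessThan_Suc)
  from Suc.IH[OF this] show ?case using c0 Suc.prems(2) by (cases j) auto
qed simp

text \<open>Restriction to y = 0 kills the second generator and leaves a polynomial of degree below
  k that is divisible by x^k. So the monomials of degree below k are independent in the
  quotient.\<close>

lemma polynomial_in_ideal_zero:
  assumes "in_germ_ideal (\<lambda>p. fst p ^ k) snd (\<lambda>p. \<Sum>j<k. c j * fst p ^ j)" "j < k"
  shows "c j = 0"
proof -
  obtain a b where ab: "holomorphic_germ a" "\<forall>\<^sub>F p in nhds 0. (\<Sum>j<k. c j * fst p ^ j) = a p * fst p ^ k + b p * snd p"
    using assms(1) unfolding in_germ_ideal_def by blast
  have lim: "filterlim (\<lambda>x::complex. (x, 0::complex)) (nhds 0) (nhds 0)"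
    unfolding zero_prod_def by (intro tendsto_Pair tendsto_const filterlim_ident)
  from filterlim_compose[OF holomorphic_germ_tendsto[OF ab(1)] lim] have "isCont (\<lambda>x. a (x, 0)) 0"
    by (simp add: isCont_def tendsto_nhds_iff zero_prod_def)
  moreover have "\<forall>\<^sub>F x in nhds 0. (\<Sum>j<k. c j * x ^ j) = x ^ k * a (x, 0)"
    using lim ab(2) by (auto simp: filterlim_iff mult.commute)
  then have "\<forall>\<^sub>F x in at 0. (\<Sum>j<k. c j * x ^ j) = x ^ k * a (x, 0)"
    by (simp add: eventually_at_filter eventually_mono)
  ultimately show ?thesis using assms(2) by (rule polynomial_eq_power_mult)
qed

text \<open>The dimension count takes place in a concrete vector space; polynomials supply one
  without fixing the dimension in a type.\<close>

interpretation poly_space: vector_space "smult :: complex \<Rightarrow> complex poly \<Rightarrow> complex poly"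
  by unfold_locales (auto simp: smult_add_right smult_add_left)

text \<open>An identity matrix of size k that factors through dimension d forces k <= d. The rows of
  \<open>t\<close> are encoded as polynomials; they span the k monomials of degree below k, which
  are independent.\<close>

lemma card_le_of_factorization:
  fixes s t :: "nat \<Rightarrow> nat \<Rightarrow> complex"
  assumes "\<And>l j. l < k \<Longrightarrow> j < k \<Longrightarrow> (\<Sum>i<d. s l i * t i j) = (if l = j then 1 else 0)"
  shows "k \<le> d"
proof -
  define v where "v = (\<lambda>i. \<Sum>j<k. monom (t i j) j)"
  define E where "E = (\<lambda>l. monom (1::complex) l) ` {..<k}"
  have inj: "inj_on (\<lambda>l. monom (1::complex) l) A" for A
    by (auto simp: inj_on_def monom_eq_iff')
  have coeff_v: "coeff (v i) j = (if j < k then t i j else 0)" for i j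
    by (simp add: v_def coeff_sum)
  have "poly_space.independent E"
  proof (rule poly_space.independent_if_scalars_zero)
    fix f :: "complex poly \<Rightarrow> complex" and x
    assume sum: "(\<Sum>x\<in>E. smult (f x) x) = 0" and "x \<in> E"
    then obtain l where l: "x = monom 1 l" "l < k" by (auto simp: E_def)
    have "(\<Sum>i<k. smult (f (monom 1 i)) (monom 1 i)) = 0"
      using sum unfolding E_def by (simp add: sum.reindex[OF inj])
    then have "coeff (\<Sum>i<k. smult (f (monom 1 i)) (monom 1 i)) l = 0" by simp
    then show "f x = 0" using l by (simp add: coeff_sum smult_monom)
  qed (simp add: E_def)
  moreover have "E \<subseteq> poly_space.span (v ` {..<d})"
  proof
    fix x assume "x \<in> E"
    then obtain l where l: "x = monom 1 l" "l < k" by (auto simp: E_def)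
    have "x = (\<Sum>i<d. smult (s l i) (v i))"
    proof (rule poly_eqI)
      fix j
      show "coeff x j = coeff (\<Sum>i<d. smult (s l i) (v i)) j"
        using assms[OF l(2), of j] l by (cases "j < k") (auto simp: coeff_sum coeff_v)
    qed
    then show "x \<in> poly_space.span (v ` {..<d})"
      by (simp only:) (rule poly_space.span_sum, rule poly_space.span_scale, rule poly_space.span_base, erule imageI)
  qed
  ultimately have "card E \<le> card (v ` {..<d})"
    using poly_space.independent_span_bound[of "v ` {..<d}" E] by simp
  also have "\<dots> \<le> d" using card_image_le[of "{..<d}" v] by simp
  finally show ?thesis by (simp add: E_def card_image[OF inj])
qed

text \<open>For the lower bound, a spanning family of size d factors the identity: \<open>s\<close>
  expresses the monomials by the family, \<open>t\<close> expresses the family by the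
  monomials.\<close>

lemma solution_multiplicity_fst_power_snd:
  "solution_multiplicity (\<lambda>p. fst p ^ k) snd = enat k"
proof (rule antisym)
  show "solution_multiplicity (\<lambda>p. fst p ^ k) snd \<le> enat k"
    unfolding solution_multiplicity_def
  proof (rule Inf_lower, intro CollectI exI[of _ k] conjI refl exI[of _ "\<lambda>i p. fst p ^ i"])
  qed (auto intro: germ_intros taylor_mod_ideal)
next
  show "enat k \<le> solution_multiplicity (\<lambda>p. fst p ^ k) snd"
    unfolding solution_multiplicity_def
  proof (rule Inf_greatest, safe)
    fix d and e :: "nat \<Rightarrow> complex \<times> complex \<Rightarrow> complex"
    assume e: "\<forall>i<d. holomorphic_germ (e i)"
      and span: "\<forall>u. holomorphic_germ u \<longrightarrow> (\<exists>c. in_germ_ideal (\<lambda>p. fst p ^ k) snd (\<lambda>p. u p - (\<Sum>i<d. c i * e i p)))"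
    have "\<forall>i. \<exists>t. i < d \<longrightarrow> in_germ_ideal (\<lambda>p. fst p ^ k) snd (\<lambda>p. e i p - (\<Sum>j<k. t j * fst p ^ j))"
      using taylor_mod_ideal[OF e[rule_format], of _ k] by simp
    from choice[OF this] obtain t
      where t: "\<forall>i. i < d \<longrightarrow> in_germ_ideal (\<lambda>p. fst p ^ k) snd (\<lambda>p. e i p - (\<Sum>j<k. t i j * fst p ^ j))"
      by (rule exE)
    have "\<forall>l. \<exists>s. in_germ_ideal (\<lambda>p. fst p ^ k) snd (\<lambda>p. fst p ^ l - (\<Sum>i<d. s i * e i p))"
      by (rule allI, rule span[rule_format, OF holomorphic_germ_power[OF holomorphic_germ_fst]])
    from choice[OF this] obtain s
      where s: "\<forall>l. in_germ_ideal (\<lambda>p. fst p ^ k) snd (\<lambda>p. fst p ^ l - (\<Sum>i<d. s l i * e i p))"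
      by (rule exE)
    have "k \<le> d"
    proof (rule card_le_of_factorization)
      fix l j assume "l < k" "j < k"
      \<comment> \<open>Substituting the expansions of the \<open>e i\<close> into that of x^l
        leaves a polynomial of degree below k in the ideal, so its coefficients vanish.\<close>
      have "in_germ_ideal (\<lambda>p. fst p ^ k) snd (\<lambda>p. (fst p ^ l - (\<Sum>i<d. s l i * e i p)) +
          (\<Sum>i<d. s l i * (e i p - (\<Sum>j<k. t i j * fst p ^ j))))"
        by (rule in_germ_ideal_add[OF s[rule_format] in_germ_ideal_sum], rule in_germ_ideal_mult[OF holomorphic_germ_const])
          (use t in auto)
      moreover have "(fst p ^ l - (\<Sum>i<d. s l i * e i p)) + (\<Sum>i<d. s l i * (e i p - (\<Sum>j<k. t i j * fst p ^ j)))
        = (\<Sum>j<k. ((if l = j then 1 else 0) - (\<Sum>i<d. s l i * t i j)) * fst p ^ j)" for p :: "complex \<times> complex"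
      proof -
        have "(\<Sum>i<d. s l i * (\<Sum>j<k. t i j * fst p ^ j)) = (\<Sum>j<k. (\<Sum>i<d. s l i * t i j) * fst p ^ j)"
          unfolding sum_distrib_left sum_distrib_right by (subst sum.swap) (simp add: mult.assoc)
        moreover have "(\<Sum>j<k. (if l = j then 1 else 0) * fst p ^ j) = fst p ^ l"
          using \<open>l < k\<close> by (simp add: if_distrib[of "\<lambda>x. x * _"] cong: if_cong)
        ultimately show ?thesis
          by (simp add: right_diff_distrib left_diff_distrib sum_subtractf)
      qed
      ultimately have "in_germ_ideal (\<lambda>p. fst p ^ k) snd
          (\<lambda>p. \<Sum>j<k. ((if l = j then 1 else 0) - (\<Sum>i<d. s l i * t i j)) * fst p ^ j)" by simp
      from polynomial_in_ideal_zero[OF this \<open>j < k\<close>]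
      show "(\<Sum>i<d. s l i * t i j) = (if l = j then 1 else 0)" by simp
    qed
    then show "enat k \<le> enat d" by simp
  qed
qed

text \<open>On the axis x = 0 the function G equals \<alpha> y, so (x, G) has Jacobian \<alpha> at
  the origin and is a coordinate system.\<close>

lemma straighten_second:
  assumes G: "holomorphic_germ G" "xcong 1 G (\<lambda>p. \<alpha> * snd p)" and "\<alpha> \<noteq> 0"
  obtains \<Theta> where "local_coordinates (\<lambda>p. (fst p, G p)) \<Theta>"
    "\<forall>\<^sub>F p in nhds 0. fst (\<Theta> p) = fst p" "\<forall>\<^sub>F p in nhds 0. G (\<Theta> p) = snd p"
proof -
  obtain h where h: "holomorphic_germ h" "\<forall>\<^sub>F p in nhds 0. G p = \<alpha> * snd p + fst p ^ 1 * h p"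
    using G(2) by (rule xcongE)
  have "G 0 = 0" using eventually_nhds_x_imp_x[OF h(2)] by simp
  then have m: "holomorphic_map_germ (\<lambda>p. (fst p, G p))"
    by (intro germ_intros G) auto
  have "filterlim (\<lambda>y::complex. (0::complex, y)) (nhds 0) (nhds 0)"
    unfolding zero_prod_def by (intro tendsto_Pair tendsto_const filterlim_ident)
  then have "\<forall>\<^sub>F y in nhds 0. G (0, y) = \<alpha> * y"
    using h(2) by (auto simp: filterlim_iff)
  then have "dy G 0 = deriv (\<lambda>y. \<alpha> * y) 0"
    unfolding dy_def by (intro deriv_cong_ev) auto
  then have "dy G 0 = \<alpha>" by simp
  then obtain \<Theta> where lc: "local_coordinates (\<lambda>p. (fst p, G p)) \<Theta>"
    using inverse_germ[OF m] \<open>\<alpha> \<noteq> 0\<close> by (auto simp: dx_dy_coordinates)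
  then have "\<forall>\<^sub>F p in nhds 0. (fst (\<Theta> p), G (\<Theta> p)) = p" by (simp add: local_coordinates_def)
  then show ?thesis
    by (intro that[OF lc]; eventually_elim) (metis fst_conv, metis snd_conv)
qed

lemma solution_multiplicity_straight:
  assumes lc: "local_coordinates (\<lambda>p. (fst p, G p)) \<Theta>" and G: "\<forall>\<^sub>F p in nhds 0. G (\<Theta> p) = snd p"
  shows "solution_multiplicity F G = solution_multiplicity (\<lambda>p. F (\<Theta> p)) snd"
proof -
  have "solution_multiplicity F G = solution_multiplicity (\<lambda>p. F (\<Theta> p)) (\<lambda>p. G (\<Theta> p))"
    by (rule solution_multiplicity_coordinates[OF lc, symmetric])
  also have "\<dots> = solution_multiplicity (\<lambda>p. F (\<Theta> p)) snd"
    by (intro antisym solution_multiplicity_mono in_germ_ideal_left in_germ_ideal_eventually_eq[OF _ in_germ_ideal_right])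
      (use G in \<open>auto elim: eventually_mono\<close>)
  finally show ?thesis .
qed

lemma solution_multiplicity_fst_power:
  assumes G: "holomorphic_germ G" "xcong 1 G (\<lambda>p. \<alpha> * snd p)" and "\<alpha> \<noteq> 0"
  shows "solution_multiplicity (\<lambda>p. fst p ^ k) G = enat k"
proof -
  obtain \<Theta> where \<Theta>: "local_coordinates (\<lambda>p. (fst p, G p)) \<Theta>"
    "\<forall>\<^sub>F p in nhds 0. fst (\<Theta> p) = fst p" "\<forall>\<^sub>F p in nhds 0. G (\<Theta> p) = snd p"
    using straighten_second[OF assms] .
  have "solution_multiplicity (\<lambda>p. fst p ^ k) G = solution_multiplicity (\<lambda>p. fst (\<Theta> p) ^ k) snd"
    by (rule solution_multiplicity_straight[OF \<Theta>(1,3)])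
  also have "\<dots> = solution_multiplicity (\<lambda>p. fst p ^ k) snd"
    by (intro antisym solution_multiplicity_mono in_germ_ideal_right in_germ_ideal_eventually_eq[OF _ in_germ_ideal_left])
      (use \<Theta>(2) in \<open>auto elim: eventually_mono\<close>)
  finally show ?thesis by (simp add: solution_multiplicity_fst_power_snd)
qed

lemma solution_multiplicity_ge:
  assumes G: "holomorphic_germ G" "xcong 1 G (\<lambda>p. \<alpha> * snd p)" and "\<alpha> \<noteq> 0"
    and F: "xcong k F (\<lambda>p. 0)"
  shows "enat k \<le> solution_multiplicity F G"
proof -
  obtain h where h: "holomorphic_germ h" "\<forall>\<^sub>F p in nhds 0. F p = 0 + fst p ^ k * h p"
    using F by (rule xcongE)
  have "in_germ_ideal (\<lambda>p. fst p ^ k) G F"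
    by (rule in_germ_ideal_eventually_eq[OF _ in_germ_ideal_mult[OF h(1) in_germ_ideal_left]])
      (use h(2) in \<open>auto elim!: eventually_mono\<close>)
  then show ?thesis
    using solution_multiplicity_mono[OF _ in_germ_ideal_right] solution_multiplicity_fst_power[OF assms(1-3)] by metis
qed

text \<open>F is x^k times the unit c + x h, so F and x^k generate the same ideal together with
  G.\<close>

lemma solution_multiplicity_eq:
  assumes G: "holomorphic_germ G" "xcong 1 G (\<lambda>p. \<alpha> * snd p)" and "\<alpha> \<noteq> 0"
    and F: "xcong (Suc k) F (\<lambda>p. c * fst p ^ k)" and "c \<noteq> 0"
  shows "solution_multiplicity F G = enat k"
proof -
  obtain h where h: "holomorphic_germ h" "\<forall>\<^sub>F p in nhds 0. F p = c * fst p ^ k + fst p ^ Suc k * h p"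
    using F by (rule xcongE)
  define w where "w = (\<lambda>p. c + fst p * h p)"
  have w: "holomorphic_germ w" "w 0 \<noteq> 0" unfolding w_def using \<open>c \<noteq> 0\<close> by (intro germ_intros h, simp)
  have eq: "\<forall>\<^sub>F p in nhds 0. F p = 0 + fst p ^ k * w p"
    using h(2) by eventually_elim (simp add: w_def algebra_simps)
  from w(1) this have "xcong k F (\<lambda>p. 0)"
    by (rule xcongI)
  then have "enat k \<le> solution_multiplicity F G"
    by (rule solution_multiplicity_ge[OF assms(1-3)])
  moreover have "\<forall>\<^sub>F p in nhds 0. inverse (w p) * F p = fst p ^ k"
    using eq holomorphic_germ_eventually_nonzero[OF w] by eventually_elim simp
  then have "in_germ_ideal F G (\<lambda>p. fst p ^ k)"
    by (rule in_germ_ideal_eventually_eq[OF _ in_germ_ideal_mult[OF holomorphic_germ_inverse[OF w] in_germ_ideal_left]])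
  then have "solution_multiplicity F G \<le> enat k"
    using solution_multiplicity_mono[OF _ in_germ_ideal_right] solution_multiplicity_fst_power[OF assms(1-3)] by metis
  ultimately show ?thesis by simp
qed

text \<open>Along the smooth curve G = 0, straightened to y = 0, F becomes a function of x with an
  isolated zero, that is, x^n times a unit. Hence x^n lies in the ideal, and n bounds the
  multiplicity.\<close>

lemma solution_multiplicity_finite:
  assumes F: "holomorphic_germ F" "F 0 = 0"
    and G: "holomorphic_germ G" "xcong 1 G (\<lambda>p. \<alpha> * snd p)" and "\<alpha> \<noteq> 0"
    and isolated: "\<forall>\<^sub>F p in at 0. F p \<noteq> 0 \<or> G p \<noteq> 0"
  shows "\<exists>m. solution_multiplicity F G \<le> enat m"
proof -
  obtain \<Theta> where \<Theta>: "local_coordinates (\<lambda>p. (fst p, G p)) \<Theta>"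
    "\<forall>\<^sub>F p in nhds 0. fst (\<Theta> p) = fst p" "\<forall>\<^sub>F p in nhds 0. G (\<Theta> p) = snd p"
    using straighten_second[OF G assms(5)] .
  then have m\<Theta>: "holomorphic_map_germ \<Theta>" by (simp add: local_coordinates_def)
  define F' where "F' = (\<lambda>p. F (\<Theta> p))"
  have F': "holomorphic_germ F'" unfolding F'_def by (rule holomorphic_germ_compose[OF F(1) m\<Theta>])
  define f where "f = (\<lambda>x. F' (x, 0))"
  obtain r0 where r0: "r0 > 0" "holomorphic2_on F' (ball 0 r0)" using holomorphic_germ_ball[OF F'] .
  have hol: "f holomorphic_on ball 0 r0"
    unfolding f_def using r0
    by (intro holomorphic2_on_compose_curve[OF open_ball open_ball r0(2)] holomorphic_intros) (auto simp: norm_Pair)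
  have f0: "f 0 = 0"
    using F(2) holomorphic_map_germ_0[OF m\<Theta>] by (simp add: f_def F'_def zero_prod_def)
  have lim: "filterlim (\<lambda>x::complex. (x, 0::complex)) (nhds 0) (nhds 0)"
    unfolding zero_prod_def by (intro tendsto_Pair tendsto_const filterlim_ident)
  \<comment> \<open>If F vanished along the whole curve, F and G would have common zeros other than
    the origin arbitrarily close to it.\<close>
  have nonconst: "\<not> f constant_on ball 0 r0"
  proof
    assume "f constant_on ball 0 r0"
    then have z: "f x = 0" if "x \<in> ball 0 r0" for x
      using f0 that r0(1) unfolding constant_on_def by (metis centre_in_ball)
    have "\<forall>\<^sub>F p in nhds 0. p \<noteq> 0 \<longrightarrow> F p \<noteq> 0 \<or> G p \<noteq> 0"
      using isolated by (simp add: eventually_at_filter)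
    from eventually_map_germ[OF m\<Theta> this] \<Theta>(2,3)
    have "\<forall>\<^sub>F p in nhds 0. fst p \<noteq> 0 \<longrightarrow> F (\<Theta> p) \<noteq> 0 \<or> snd p \<noteq> 0"
      by eventually_elim auto
    then have "\<forall>\<^sub>F x in nhds 0. x \<noteq> 0 \<longrightarrow> f x \<noteq> 0"
      using lim by (auto simp: filterlim_iff f_def F'_def)
    moreover have "\<forall>\<^sub>F x in nhds 0. f x = 0"
      using eventually_nhds_in_open[of "ball 0 r0" "0::complex"] r0(1) z by (auto elim!: eventually_mono)
    ultimately have "\<forall>\<^sub>F x in nhds (0::complex). x = 0" by eventually_elim auto
    then have "\<forall>\<^sub>F x in at (0::complex). False" by (simp add: eventually_at_filter)
    then show False by simp
  qed
  have r0': "0 \<in> ball (0::complex) r0" using r0(1) by simp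
  obtain g r n where g: "0 < n" "0 < r" "ball (0::complex) r \<subseteq> ball 0 r0" "g holomorphic_on ball 0 r"
    "\<And>x. x \<in> ball 0 r \<Longrightarrow> f x = (x - 0) ^ n * g x" "\<And>x. x \<in> ball 0 r \<Longrightarrow> g x \<noteq> 0"
    by (rule holomorphic_factor_zero_nonconstant[OF hol open_ball connected_ball r0' f0 nonconst], rule that)
  define w where "w = (\<lambda>p::complex \<times> complex. g (fst p))"
  have w: "holomorphic_germ w" "w 0 \<noteq> 0"
    unfolding w_def using g by (auto intro!: holomorphic_germ_compose_holomorphic[OF holomorphic_germ_fst g(4)])
  have fl: "filterlim fst (nhds (0::complex)) (nhds (0::complex \<times> complex))"
    using holomorphic_germ_tendsto[OF holomorphic_germ_fst] by simp
  have ev: "\<forall>\<^sub>F p::complex \<times> complex in nhds 0. fst p \<in> ball 0 r"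
    using fl eventually_nhds_in_open[of "ball 0 r" "0::complex"] g(2) unfolding filterlim_iff by auto
  \<comment> \<open>Passing from (x, y) to (x, 0) changes \<open>F'\<close> by a multiple of y
    only.\<close>
  have "in_germ_ideal (\<lambda>p. fst p - fst (fst p, 0::complex)) (\<lambda>p. snd p - snd (fst p, 0::complex)) (\<lambda>p. F' p - F' (fst p, 0))"
    by (rule germ_diff_in_ideal[OF F' holomorphic_map_germ_ident]) (intro germ_intros; simp)
  then obtain b where b: "holomorphic_germ b" "\<forall>\<^sub>F p in nhds 0. F' p - F' (fst p, 0) = b p * snd p"
    unfolding in_germ_ideal_def by auto
  have "in_germ_ideal F' snd (\<lambda>p. inverse (w p) * (F' p + (- b p) * snd p))"
    by (intro in_germ_ideal_mult[OF holomorphic_germ_inverse[OF w]] in_germ_ideal_add in_germ_ideal_left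
        in_germ_ideal_mult[OF holomorphic_germ_uminus[OF b(1)]] in_germ_ideal_right)
  then have "in_germ_ideal F' snd (\<lambda>p. fst p ^ n)"
  proof (rule in_germ_ideal_eventually_eq[rotated])
    show "\<forall>\<^sub>F p in nhds 0. inverse (w p) * (F' p + (- b p) * snd p) = fst p ^ n"
      using ev b(2)
    proof eventually_elim
      case (elim p)
      then have "F' p + (- b p) * snd p = fst p ^ n * w p" "w p \<noteq> 0"
        using g(5,6)[of "fst p"] by (auto simp: f_def w_def algebra_simps)
      then show ?case by (simp add: field_simps)
    qed
  qed
  from solution_multiplicity_mono[OF this in_germ_ideal_right]
  have "solution_multiplicity F' snd \<le> enat n" by (simp add: solution_multiplicity_fst_power_snd)
  then show ?thesis
    using solution_multiplicity_straight[OF \<Theta>(1,3), of F] by (auto simp: F'_def)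
qed

section \<open>Normalization of coefficients\<close>

text \<open>\<open>K\<close> is the composite as a total function and not merely near the origin, so
  that a chain of conjugations composes by plain rewriting and its coordinates can be recovered at
  the end.\<close>

definition germ_conj :: "(complex \<times> complex \<Rightarrow> complex \<times> complex) \<Rightarrow> (complex \<times> complex \<Rightarrow> complex \<times> complex) \<Rightarrow> bool" where
  "germ_conj H K \<longleftrightarrow> (\<exists>\<phi> \<psi>. local_coordinates \<phi> \<psi> \<and> K = (\<lambda>p. \<phi> (H (\<psi> p))))"

lemma germ_conj_map_germ:
  assumes "germ_conj H K" "holomorphic_map_germ H" shows "holomorphic_map_germ K"
proof -
  obtain \<phi> \<psi> where "local_coordinates \<phi> \<psi>" "K = (\<lambda>p. \<phi> (H (\<psi> p)))"
    using assms(1) unfolding germ_conj_def by blast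
  then show ?thesis
    using holomorphic_map_germ_compose[OF _ holomorphic_map_germ_compose[OF assms(2)]]
    by (simp add: local_coordinates_def)
qed

lemma germ_conj_refl: "germ_conj K K"
  unfolding germ_conj_def local_coordinates_def
  by (intro exI[of _ "\<lambda>p. p"]) (auto intro: holomorphic_map_germ_ident)

lemma local_coordinates_compose:
  assumes "local_coordinates \<phi> \<psi>" "local_coordinates \<phi>' \<psi>'"
  shows "local_coordinates (\<lambda>p. \<phi>' (\<phi> p)) (\<lambda>p. \<psi> (\<psi>' p))"
proof -
  have m: "holomorphic_map_germ \<phi>" "holomorphic_map_germ \<psi>" "holomorphic_map_germ \<phi>'" "holomorphic_map_germ \<psi>'"
    and inv: "\<forall>\<^sub>F p in nhds 0. \<psi> (\<phi> p) = p" "\<forall>\<^sub>F p in nhds 0. \<phi> (\<psi> p) = p"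
      "\<forall>\<^sub>F p in nhds 0. \<psi>' (\<phi>' p) = p" "\<forall>\<^sub>F p in nhds 0. \<phi>' (\<psi>' p) = p"
    using assms by (auto simp: local_coordinates_def)
  have "\<forall>\<^sub>F p in nhds 0. \<psi> (\<psi>' (\<phi>' (\<phi> p))) = p"
    using eventually_map_germ[OF m(1) inv(3)] inv(1) by eventually_elim simp
  moreover have "\<forall>\<^sub>F p in nhds 0. \<phi>' (\<phi> (\<psi> (\<psi>' p))) = p"
    using eventually_map_germ[OF m(4) inv(2)] inv(4) by eventually_elim simp
  ultimately show ?thesis
    using holomorphic_map_germ_compose[OF m(3,1)] holomorphic_map_germ_compose[OF m(2,4)]
    by (simp add: local_coordinates_def)
qed

lemma germ_conj_trans [trans]:
  assumes "germ_conj H K" "germ_conj K L" shows "germ_conj H L"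
proof -
  obtain \<phi> \<psi> where 1: "local_coordinates \<phi> \<psi>" "K = (\<lambda>p. \<phi> (H (\<psi> p)))"
    using assms(1) unfolding germ_conj_def by blast
  obtain \<phi>' \<psi>' where 2: "local_coordinates \<phi>' \<psi>'" "L = (\<lambda>p. \<phi>' (K (\<psi>' p)))"
    using assms(2) unfolding germ_conj_def by blast
  show ?thesis
    unfolding germ_conj_def using local_coordinates_compose[OF 1(1) 2(1)] 1(2) 2(2)
    by (intro exI[of _ "\<lambda>p. \<phi>' (\<phi> p)"] exI[of _ "\<lambda>p. \<psi> (\<psi>' p)"]) simp
qed

lemma dx_mult_germ:
  assumes "holomorphic_germ f" "holomorphic_germ g"
  shows "dx (\<lambda>p. f p * g p) 0 = f 0 * dx g 0 + dx f 0 * g 0"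
proof -
  have "((\<lambda>p. f p * g p) has_derivative (\<lambda>q. f 0 * (\<lambda>(u, v). dx g 0 * u + dy g 0 * v) q +
      (\<lambda>(u, v). dx f 0 * u + dy f 0 * v) q * g 0)) (at 0)"
    by (intro has_derivative_mult holomorphic_germ_has_derivative assms)
  moreover have "(\<lambda>q. f 0 * (\<lambda>(u, v). dx g 0 * u + dy g 0 * v) q + (\<lambda>(u, v). dx f 0 * u + dy f 0 * v) q * g 0)
    = (\<lambda>(u, v). (f 0 * dx g 0 + dx f 0 * g 0) * u + (f 0 * dy g 0 + dy f 0 * g 0) * v)"
    by (auto simp: fun_eq_iff algebra_simps)
  ultimately have "((\<lambda>p. f p * g p) has_derivative
      (\<lambda>(u, v). (f 0 * dx g 0 + dx f 0 * g 0) * u + (f 0 * dy g 0 + dy f 0 * g 0) * v)) (at 0)"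
    by metis
  then show ?thesis by (rule dx_dy_eq(1))
qed

text \<open>The Jacobian at the origin is w(0). The change maps the axis x = 0 to itself, hence so
  does its inverse, and congruences modulo powers of x can be transported.\<close>

lemma fst_scaling_coordinates:
  assumes w: "holomorphic_germ w" "w 0 \<noteq> 0"
  obtains \<Psi> where "local_coordinates (\<lambda>p. (fst p * w p, snd p)) \<Psi>" "xcong 1 (\<lambda>p. fst (\<Psi> p)) (\<lambda>p. 0)"
proof -
  let ?\<Phi> = "\<lambda>p. (fst p * w p, snd p)"
  have m: "holomorphic_map_germ ?\<Phi>"
    by (intro germ_intros w) auto
  have "dx (\<lambda>p. fst p * w p) 0 = w 0"
    using dx_mult_germ[OF holomorphic_germ_fst w(1)] by simp
  then obtain \<Psi> where lc: "local_coordinates ?\<Phi> \<Psi>"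
    using inverse_germ[OF m] w(2) by auto
  then have \<Psi>: "holomorphic_map_germ \<Psi>" "\<forall>\<^sub>F p in nhds 0. \<Psi> (?\<Phi> p) = p"
    by (auto simp: local_coordinates_def)
  have "holomorphic_map_germ (\<lambda>p::complex \<times> complex. (0, snd p))"
    by (intro germ_intros) auto
  from eventually_map_germ[OF this \<Psi>(2)]
  have "\<forall>\<^sub>F p::complex \<times> complex in nhds 0. fst (\<Psi> (0, snd p)) = 0"
    by eventually_elim simp
  with \<Psi>(1) have "xcong 1 (\<lambda>p. fst (\<Psi> p)) (\<lambda>p. 0)"
    by (intro xcong_1_zeroI germ_intros)
  with lc that show ?thesis by blast
qed

text \<open>In the coordinate $X = x\,w$, congruences modulo powers of $X$ may be checked after pulling back to $x$.\<close>

lemma conjugate_by_fst_scaling: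
  assumes K: "holomorphic_map_germ K" and w: "holomorphic_germ w" "w 0 \<noteq> 0"
  obtains K' where "germ_conj K K'"
    "\<And>n R. xcong n (\<lambda>p. fst (K p) * w (K p)) (\<lambda>p. R (fst p * w p, snd p)) \<Longrightarrow> xcong n (\<lambda>p. fst (K' p)) R"
    "\<And>n R. xcong n (\<lambda>p. snd (K p)) (\<lambda>p. R (fst p * w p, snd p)) \<Longrightarrow> xcong n (\<lambda>p. snd (K' p)) R"
proof -
  let ?\<Phi> = "\<lambda>p. (fst p * w p, snd p)"
  obtain \<Psi> where \<Psi>: "local_coordinates ?\<Phi> \<Psi>" "xcong 1 (\<lambda>p. fst (\<Psi> p)) (\<lambda>p. 0)"
    using fst_scaling_coordinates[OF w] .
  then have m: "holomorphic_map_germ \<Psi>" and inv: "\<forall>\<^sub>F p in nhds 0. ?\<Phi> (\<Psi> p) = p"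
    by (auto simp: local_coordinates_def)
  show ?thesis
  proof (rule that)
    show "germ_conj K (\<lambda>p. ?\<Phi> (K (\<Psi> p)))"
      unfolding germ_conj_def using \<Psi>(1) by (intro exI[of _ ?\<Phi>] exI[of _ \<Psi>]) simp
  next
    fix n and R :: "complex \<times> complex \<Rightarrow> complex"
    have R: "\<forall>\<^sub>F p in nhds 0. R (?\<Phi> (\<Psi> p)) = R p"
      using inv by eventually_elim simp
    show "xcong n (\<lambda>p. fst (?\<Phi> (K (\<Psi> p)))) R"
      if "xcong n (\<lambda>p. fst (K p) * w (K p)) (\<lambda>p. R (?\<Phi> p))"
      using xcong_trans[OF xcong_compose[OF that m \<Psi>(2)] xcong_eventually_eq[OF R]] by simp
    show "xcong n (\<lambda>p. snd (?\<Phi> (K (\<Psi> p)))) R"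
      if "xcong n (\<lambda>p. snd (K p)) (\<lambda>p. R (?\<Phi> p))"
      using xcong_trans[OF xcong_compose[OF that m \<Psi>(2)] xcong_eventually_eq[OF R]] by simp
  qed
qed

section \<open>The cohomological equation\<close>

lemma holomorphic_linear_bound:
  fixes b :: "complex \<Rightarrow> complex"
  assumes s: "0 < s" "s < r" and b: "b holomorphic_on ball 0 r" "b 0 = 0"
  obtains C where "C \<ge> 0" "\<And>y. y \<in> cball 0 s \<Longrightarrow> cmod (b y) \<le> C * cmod y"
proof -
  have "continuous_on (cball 0 s) (deriv b)"
    using s holomorphic_deriv[OF b(1) open_ball] by (auto intro!: holomorphic_on_imp_continuous_on holomorphic_on_subset[of _ "ball 0 r"])
  then have "compact (deriv b ` cball 0 s)"
    by (intro compact_continuous_image compact_cball)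
  then obtain C where C: "\<And>y. y \<in> cball 0 s \<Longrightarrow> cmod (deriv b y) \<le> C"
    using compact_imp_bounded bounded_iff by (metis (no_types, lifting) imageI)
  have lip: "cmod (b y) \<le> C * cmod y" if "y \<in> cball 0 s" for y
  proof -
    have "cmod (b y - b 0) \<le> C * cmod (y - 0)"
    proof (rule field_differentiable_bound[where S = "cball 0 s" and f' = "deriv b"])
      fix z assume z: "z \<in> cball (0::complex) s"
      then have "z \<in> ball 0 r" using s by simp
      from has_field_derivative_at_within[OF holomorphic_derivI[OF b(1) open_ball this]]
      show "(b has_field_derivative deriv b z) (at z within cball 0 s)" .
      show "cmod (deriv b z) \<le> C" by (rule C[OF z])
    qed (use that s in simp_all)
    then show ?thesis by (simp add: b(2))
  qed
  have "C \<ge> 0" using order_trans[OF norm_ge_zero C[of 0]] s by simp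
  with lip that show ?thesis by blast
qed

text \<open>The linear bound for the derivative is used on the disc of radius |y|, where the
  derivative is at most C |y|.\<close>

lemma holomorphic_quadratic_bound:
  fixes b :: "complex \<Rightarrow> complex"
  assumes s: "0 < s" "s < r" and b: "b holomorphic_on ball 0 r" "b 0 = 0" "deriv b 0 = 0"
  obtains C where "C \<ge> 0" "\<And>y. y \<in> cball 0 s \<Longrightarrow> cmod (b y) \<le> C * (cmod y)\<^sup>2"
proof -
  obtain C where C: "C \<ge> 0" "\<And>y. y \<in> cball 0 s \<Longrightarrow> cmod (deriv b y) \<le> C * cmod y"
    using holomorphic_linear_bound[OF s holomorphic_deriv[OF b(1) open_ball] b(3)] by blast
  have "cmod (b y) \<le> C * (cmod y)\<^sup>2" if y: "y \<in> cball 0 s" for y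
  proof -
    have "cmod (b y - b 0) \<le> (C * cmod y) * cmod (y - 0)"
    proof (rule field_differentiable_bound[where S = "cball 0 (cmod y)" and f' = "deriv b"])
      fix z assume z: "z \<in> cball (0::complex) (cmod y)"
      then have "z \<in> ball 0 r" "z \<in> cball 0 s" using s y by auto
      from has_field_derivative_at_within[OF holomorphic_derivI[OF b(1) open_ball this(1)]]
      show "(b has_field_derivative deriv b z) (at z within cball 0 (cmod y))" .
      have "cmod (deriv b z) \<le> C * cmod z" by (rule C(2)[OF \<open>z \<in> cball 0 s\<close>])
      also have "\<dots> \<le> C * cmod y" using z C(1) by (intro mult_left_mono) auto
      finally show "cmod (deriv b z) \<le> C * cmod y" .
    qed simp_all
    then show ?thesis by (simp add: b(2) power2_eq_square mult.assoc)
  qed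
  with C(1) that show ?thesis by blast
qed

text \<open>As |c| = 1, the powers of c give no decay. It comes from b(0) = 0: then |b(\<mu>^n y)|
  <= C |\<mu>|^n |y|, and the series converges uniformly on a smaller disc.\<close>

lemma cohomological_equation:
  fixes b :: "complex \<Rightarrow> complex"
  assumes r: "r > 0" and b: "b holomorphic_on ball 0 r" "b 0 = 0" and \<mu>: "cmod \<mu> < 1" and c: "cmod c = 1"
  obtains s u where "s > 0" "u holomorphic_on ball 0 s" "\<And>y. y \<in> ball 0 s \<Longrightarrow> u y - c * u (\<mu> * y) = b y" "u 0 = 0"
proof -
  define s where "s = r / 2"
  have s: "s > 0" "s < r" using r by (auto simp: s_def)
  obtain C where "C \<ge> 0" and lip: "\<And>y. y \<in> cball 0 s \<Longrightarrow> cmod (b y) \<le> C * cmod y"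
    using holomorphic_linear_bound[OF s b] by blast
  define t where "t = (\<lambda>n y. c ^ n * b (\<mu> ^ n * y))"
  define u where "u = (\<lambda>y. \<Sum>n. t n y)"
  have in_ball: "\<mu> ^ n * y \<in> ball 0 s" if "y \<in> ball 0 s" for n y
  proof -
    have "cmod \<mu> ^ n * cmod y \<le> 1 * cmod y"
      using \<mu> by (intro mult_right_mono power_le_one) auto
    then show ?thesis using that by (simp add: norm_mult norm_power)
  qed
  have bound: "cmod (t n y) \<le> C * s * cmod \<mu> ^ n" if "y \<in> ball 0 s" for n y
  proof -
    have "cmod (t n y) = cmod (b (\<mu> ^ n * y))" by (simp add: t_def norm_mult norm_power c)
    also have "\<dots> \<le> C * (cmod \<mu> ^ n * cmod y)"
      using lip[of "\<mu> ^ n * y"] in_ball[OF that, of n] by (simp add: norm_mult norm_power)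
    also have "\<dots> \<le> C * (cmod \<mu> ^ n * s)"
      using that \<open>C \<ge> 0\<close> by (intro mult_left_mono) auto
    finally show ?thesis by (simp add: mult_ac)
  qed
  have summ: "summable (\<lambda>n. C * s * cmod \<mu> ^ n)"
    using \<mu> by (intro summable_mult summable_geometric) simp
  have lim: "uniform_limit (ball 0 s) (\<lambda>n y. \<Sum>i<n. t i y) u sequentially"
    unfolding u_def by (rule Weierstrass_m_test[OF bound summ])
  have hol_t: "t n holomorphic_on ball 0 s" for n
  proof -
    have "(\<lambda>y. \<mu> ^ n * y) ` ball 0 s \<subseteq> ball 0 r"
      using in_ball[of _ n] s by fastforce
    then have "(b \<circ> (\<lambda>y. \<mu> ^ n * y)) holomorphic_on ball 0 s"
      by (intro holomorphic_on_compose_gen[OF _ b(1)] holomorphic_intros)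
    then have "(\<lambda>y. b (\<mu> ^ n * y)) holomorphic_on ball 0 s" by (simp add: o_def)
    then show ?thesis unfolding t_def by (intro holomorphic_intros)
  qed
  have "u holomorphic_on ball 0 s"
  proof (rule holomorphic_uniform_sequence[OF open_ball])
    show "(\<lambda>y. \<Sum>i<n. t i y) holomorphic_on ball 0 s" for n
      by (intro holomorphic_intros hol_t)
    fix x assume "x \<in> ball (0::complex) s"
    then obtain d where "d > 0" "cball x d \<subseteq> ball 0 s" using open_contains_cball open_ball by blast
    then show "\<exists>d>0. cball x d \<subseteq> ball 0 s \<and> uniform_limit (cball x d) (\<lambda>n y. \<Sum>i<n. t i y) u sequentially"
      using uniform_limit_on_subset[OF lim] by blast
  qed
  moreover have "u y - c * u (\<mu> * y) = b y" if y: "y \<in> ball 0 s" for y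
  proof -
    have sum: "summable (\<lambda>n. t n y)" if "y \<in> ball 0 s" for y
      using summable_comparison_test'[OF summ, of 0 "\<lambda>n. t n y"] bound[OF that] by simp
    have "u y = t 0 y + (\<Sum>n. t (Suc n) y)"
      unfolding u_def using suminf_split_head[OF sum[OF y]] by simp
    \<comment> \<open>Shifting the index takes out one factor c and replaces y by \<mu> y; this is
      the functional equation.\<close>
    also have "(\<lambda>n. t (Suc n) y) = (\<lambda>n. c * t n (\<mu> * y))"
      by (simp add: t_def fun_eq_iff mult_ac)
    also have "(\<Sum>n. c * t n (\<mu> * y)) = c * u (\<mu> * y)"
      unfolding u_def using in_ball[OF y, of 1] by (intro suminf_mult sum) simp
    finally show ?thesis by (simp add: t_def)
  qed
  moreover have "u 0 = 0" by (simp add: u_def t_def b(2))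
  ultimately show ?thesis using s that by blast
qed

section \<open>Normalizing the coefficients, one degree at a time\<close>

lemma germ_snd_slice:
  assumes "holomorphic_germ g"
  obtains r where "r > 0" "(\<lambda>y. g (0, y)) holomorphic_on ball 0 r"
proof -
  obtain r where r: "r > 0" "holomorphic2_on g (ball 0 r)" using holomorphic_germ_ball[OF assms] .
  then have "(\<lambda>y. g (0, y)) holomorphic_on ball 0 r"
    by (intro holomorphic2_on_compose_curve[OF open_ball open_ball r(2)] holomorphic_intros) (auto simp: norm_Pair)
  with r that show ?thesis by blast
qed

lemma eventually_snd_ball:
  assumes "r > 0" shows "\<forall>\<^sub>F p :: complex \<times> complex in nhds 0. snd p \<in> ball 0 r"
  using topological_tendstoD[OF holomorphic_germ_tendsto[OF holomorphic_germ_snd] open_ball, of 0 r] assms by simp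

text \<open>In the factorization of f^(k+1) - g^(k+1) each term is f - g times k factors divisible
  by x.\<close>

lemma xcong_power:
  assumes f: "holomorphic_germ f" "xcong 1 f (\<lambda>p. 0)" and g: "xcong 1 g (\<lambda>p. 0)"
    and "xcong n f g"
  shows "xcong (n + k) (\<lambda>p. f p ^ Suc k) (\<lambda>p. g p ^ Suc k)"
proof (induction k)
  case (Suc k)
  have "xcong (1 + (n + k)) (\<lambda>p. f p * f p ^ Suc k) (\<lambda>p. f p * g p ^ Suc k)"
    by (rule xcong_mult_shift[OF f(2) Suc])
  also have "xcong (Suc k + n) (\<lambda>p. g p ^ Suc k * f p) (\<lambda>p. g p ^ Suc k * g p)"
    by (rule xcong_mult_shift[OF xcong_power_zero[OF g] assms(4)])
  then have "xcong (1 + (n + k)) (\<lambda>p. f p * g p ^ Suc k) (\<lambda>p. g p * g p ^ Suc k)"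
    by (simp add: mult.commute add.commute)
  finally show ?case by simp
qed (use assms(4) in simp)


lemma xcong_binomial:
  fixes c :: complex
  shows "xcong (2 * d) (\<lambda>p. (1 + c * fst p ^ d) ^ m) (\<lambda>p. 1 + of_nat m * c * fst p ^ d)"
proof (induction m)
  case (Suc m)
  have "xcong (2 * d) (\<lambda>p. (1 + c * fst p ^ d) * (1 + c * fst p ^ d) ^ m)
      (\<lambda>p. (1 + c * fst p ^ d) * (1 + of_nat m * c * fst p ^ d))"
    by (rule xcong_mult_left[OF _ Suc]) (intro germ_intros)
  \<comment> \<open>Beyond degree d the product contains only the term m c^2 x^(2d).\<close>
  also have "xcong (2 * d) (\<lambda>p. (1 + c * fst p ^ d) * (1 + of_nat m * c * fst p ^ d))
      (\<lambda>p. 1 + of_nat (Suc m) * c * fst p ^ d)"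
    by (rule xcongI[of "\<lambda>p. of_nat m * c ^ 2"])
      (auto intro!: germ_intros always_eventually simp: algebra_simps power2_eq_square power_mult mult_2 power_add)
  finally show ?case by simp
qed simp

text \<open>For X = x exp(v(y)) the linear coefficient becomes \<open>lam\<close> when g(0, y)
  exp(v(\<mu> y)) = \<open>lam\<close> exp(v(y)). In logarithms this is the cohomological equation
  with c = 1 for Ln(g(0, y) / \<open>lam\<close>), which vanishes at y = 0.\<close>

lemma linear_part_normalization:
  assumes K: "holomorphic_map_germ K" and g: "holomorphic_germ g" "g 0 = lam" "lam \<noteq> 0"
    and fst_K: "\<forall>\<^sub>F p in nhds 0. fst (K p) = fst p * g p"
    and snd_K: "xcong 1 (\<lambda>p. snd (K p)) (\<lambda>p. \<mu> * snd p)" and \<mu>: "cmod \<mu> < 1"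
  obtains K' where "germ_conj K K'" "xcong 2 (\<lambda>p. fst (K' p)) (\<lambda>p. lam * fst p)"
    "xcong 1 (\<lambda>p. snd (K' p)) (\<lambda>p. \<mu> * snd p)"
proof -
  obtain r where r: "r > 0" "(\<lambda>y. g (0, y)) holomorphic_on ball 0 r"
    using germ_snd_slice[OF g(1)] .
  define a where "a = (\<lambda>y. g (0, y) / lam)"
  have a: "a holomorphic_on ball 0 r" "a 0 = 1"
    unfolding a_def using r g by (auto intro!: holomorphic_intros simp: zero_prod_def)
  have "isCont a 0"
    using holomorphic_on_imp_continuous_on[OF a(1)] r(1) by (simp add: continuous_on_eq_continuous_at)
  then have "\<forall>\<^sub>F y in nhds 0. a y \<in> ball 1 1"
    using a(2) by (intro topological_tendstoD[of a "a 0"]) (auto simp: isCont_def tendsto_nhds_iff)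
  then obtain \<epsilon> where \<epsilon>: "\<epsilon> > 0" "\<And>y. y \<in> ball 0 \<epsilon> \<Longrightarrow> a y \<in> ball 1 1"
    unfolding eventually_nhds_metric by (auto simp: dist_commute)
  define \<rho> where "\<rho> = min r \<epsilon>"
  have \<rho>: "\<rho> > 0" "\<And>y. y \<in> ball 0 \<rho> \<Longrightarrow> a y \<in> ball 1 1" "a holomorphic_on ball 0 \<rho>"
    using r \<epsilon> a(1) by (auto simp: \<rho>_def intro: holomorphic_on_subset)
  \<comment> \<open>The principal logarithm is holomorphic off the nonpositive reals, which the unit
    disc about 1 avoids.\<close>
  have slit: "z \<notin> \<real>\<^sub>\<le>\<^sub>0" if "z \<in> ball 1 1" for z :: complex
  proof
    assume "z \<in> \<real>\<^sub>\<le>\<^sub>0"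
    then have "1 \<le> Re (1 - z)" by (simp add: complex_nonpos_Reals_iff)
    also have "\<dots> \<le> cmod (1 - z)" by (rule complex_Re_le_cmod)
    finally have "1 \<le> cmod (1 - z)" .
    with that show False by (simp add: dist_norm)
  qed
  have Ln_a: "(\<lambda>y. Ln (a y)) holomorphic_on ball 0 \<rho>"
    using \<rho> slit by (intro holomorphic_intros) auto
  obtain s v where v: "s > 0" "v holomorphic_on ball 0 s"
    "\<And>y. y \<in> ball 0 s \<Longrightarrow> v y - 1 * v (\<mu> * y) = Ln (a y)" "v 0 = 0"
    by (rule cohomological_equation[OF \<rho>(1) Ln_a _ \<mu> norm_one], simp add: a(2), rule that)
  define w where "w = (\<lambda>p::complex \<times> complex. exp (v (snd p)))"
  have "holomorphic_germ (\<lambda>p. v (snd p))"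
    using v by (intro holomorphic_germ_compose_holomorphic[OF holomorphic_germ_snd v(2)]) auto
  then have w: "holomorphic_germ w" "w 0 \<noteq> 0"
    unfolding w_def by (auto intro!: holomorphic_germ_compose_holomorphic[of _ exp UNIV] holomorphic_intros)
  obtain K' where K': "germ_conj K K'"
    "\<And>n R. xcong n (\<lambda>p. fst (K p) * w (K p)) (\<lambda>p. R (fst p * w p, snd p)) \<Longrightarrow> xcong n (\<lambda>p. fst (K' p)) R"
    "\<And>n R. xcong n (\<lambda>p. snd (K p)) (\<lambda>p. R (fst p * w p, snd p)) \<Longrightarrow> xcong n (\<lambda>p. snd (K' p)) R"
    using conjugate_by_fst_scaling[OF K w] by blast
  have fst1: "xcong 1 (\<lambda>p. fst (K p)) (\<lambda>p. 0)"
    by (rule xcongI[OF g(1)]) (use fst_K in simp)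
  have wK: "xcong 1 (\<lambda>p. w (K p)) (\<lambda>p. w (0, \<mu> * snd p))"
  proof -
    have "holomorphic_map_germ (\<lambda>p::complex \<times> complex. (0, \<mu> * snd p))" by (intro germ_intros) auto
    from xcong_compose_left[OF w(1) K this] show ?thesis using fst1 snd_K by simp
  qed
  have "xcong 1 (\<lambda>p. g p * w (K p)) (\<lambda>p. g (0, snd p) * w (0, \<mu> * snd p))"
  proof (rule xcong_mult[OF g(1) _ xcong_1_snd[OF g(1)] wK])
    have "holomorphic_map_germ (\<lambda>p::complex \<times> complex. (0, \<mu> * snd p))" by (intro germ_intros) auto
    from holomorphic_germ_compose[OF w(1) this] show "holomorphic_germ (\<lambda>p. w (0, \<mu> * snd p))" .
  qed
  also have "xcong 1 (\<lambda>p. g (0, snd p) * w (0, \<mu> * snd p)) (\<lambda>p. lam * w p)"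
  proof (rule xcong_eventually_eq)
    have "\<forall>\<^sub>F p :: complex \<times> complex in nhds 0. snd p \<in> ball 0 (min s \<rho>)"
      using v(1) \<rho>(1) by (intro eventually_snd_ball) simp
    then show "\<forall>\<^sub>F p :: complex \<times> complex in nhds 0. g (0, snd p) * w (0, \<mu> * snd p) = lam * w p"
    proof eventually_elim
      case (elim p)
      then have "a (snd p) \<noteq> 0" using \<rho>(2)[of "snd p"] by auto
      then have "exp (v (snd p)) = a (snd p) * exp (v (\<mu> * snd p))"
        using v(3)[of "snd p"] elim by (simp add: exp_add algebra_simps)
      then show ?case using g(3) by (simp add: w_def a_def)
    qed
  qed
  finally have "xcong (1 + 1) (\<lambda>p. fst p * (g p * w (K p))) (\<lambda>p. fst p * (lam * w p))"
    using xcong_fst_power[of 1] by (intro xcong_mult_shift) auto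
  then have *: "xcong 2 (\<lambda>p. fst p * (g p * w (K p))) (\<lambda>p. lam * (fst p * w p))"
    by (simp add: mult.left_commute numeral_2_eq_2)
  have "\<forall>\<^sub>F p in nhds 0. fst p * (g p * w (K p)) = fst (K p) * w (K p)"
    using fst_K by eventually_elim simp
  from xcong_trans[OF xcong_sym[OF xcong_eventually_eq[OF this]] *]
  have "xcong 2 (\<lambda>p. fst (K p) * w (K p)) (\<lambda>p. lam * (fst p * w p))" .
  then have "xcong 2 (\<lambda>p. fst (K' p)) (\<lambda>p. lam * fst p)"
    by (intro K'(2)) simp
  moreover have "xcong 1 (\<lambda>p. snd (K' p)) (\<lambda>p. \<mu> * snd p)"
    using snd_K by (intro K'(3)) simp
  ultimately show ?thesis using that K'(1) by blast
qed

lemma xcong_fst_cmult_zero: "xcong 1 (\<lambda>p. c * fst p) (\<lambda>p. 0)"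
  using xcong_cmult[OF xcong_fst_power[of 1], of c] by simp

lemma normal_form_leading:
  assumes "xcong n f (\<lambda>p. lam * (fst p + c * fst p ^ N))" "2 \<le> n" "2 \<le> N"
  shows "xcong 2 f (\<lambda>p. lam * fst p)" "xcong 1 f (\<lambda>p. 0)"
proof -
  have "xcong 2 (\<lambda>p. c * fst p ^ N) (\<lambda>p. c * 0)"
    using xcong_mono[OF xcong_fst_power assms(3)] by (rule xcong_cmult)
  from xcong_cmult[OF xcong_add[OF xcong_refl this]]
  have "xcong 2 (\<lambda>p. lam * (fst p + c * fst p ^ N)) (\<lambda>p. lam * (fst p + c * 0))" .
  from xcong_trans[OF xcong_mono[OF assms(1,2)] this]
  show *: "xcong 2 f (\<lambda>p. lam * fst p)" by simp
  show "xcong 1 f (\<lambda>p. 0)"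
    by (rule xcong_trans[OF xcong_mono[OF *] xcong_fst_cmult_zero]) simp
qed

text \<open>The coordinate $X = x + u(y) x^n$ makes the coefficient of $x^n$ constant, and even zero unless
  the monomial $x^n$ is resonant, when
  $u(y) - \lambda^{n-1} u(\mu y) = a(y) - A$, where $\lambda a(y)$ is the old coefficient.\<close>

lemma coefficient_normalization:
  assumes K: "holomorphic_map_germ K" and lam: "cmod lam = 1" and \<mu>: "cmod \<mu> < 1"
    and fst_K: "xcong n (\<lambda>p. fst (K p)) (\<lambda>p. lam * (fst p + c * fst p ^ N))"
    and snd_K: "xcong 1 (\<lambda>p. snd (K p)) (\<lambda>p. \<mu> * snd p)" and n: "2 \<le> n" and N: "2 \<le> N"
  obtains K' A where "germ_conj K K'"
    "xcong (Suc n) (\<lambda>p. fst (K' p)) (\<lambda>p. lam * (fst p + c * fst p ^ N + A * fst p ^ n))"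
    "xcong 1 (\<lambda>p. snd (K' p)) (\<lambda>p. \<mu> * snd p)"
    "lam ^ (n - 1) = 1 \<or> A = 0"
proof -
  have "lam \<noteq> 0" using lam by auto
  obtain g where g: "holomorphic_germ g" "\<forall>\<^sub>F p in nhds 0. fst (K p) = lam * (fst p + c * fst p ^ N) + fst p ^ n * g p"
    using fst_K by (rule xcongE)
  obtain r where r: "r > 0" "(\<lambda>y. g (0, y)) holomorphic_on ball 0 r"
    using germ_snd_slice[OF g(1)] .
  define a where "a = (\<lambda>y. g (0, y) / lam)"
  define \<kappa> where "\<kappa> = lam ^ (n - 1)"
  \<comment> \<open>At y = 0 the equation reads (1 - \<kappa>) u(0) = a(0) - A. If \<kappa> = 1,
    this forces A = a(0) and leaves u(0) free, chosen as 0; otherwise A = 0 is possible and u(0) is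
    found by division. The rest of u solves the equation with right-hand side a(y) - a(0).\<close>
  define A where "A = (if \<kappa> = 1 then a 0 else 0)"
  define u0 where "u0 = (if \<kappa> = 1 then 0 else a 0 / (1 - \<kappa>))"
  have a: "(\<lambda>y. a y - a 0) holomorphic_on ball 0 r"
    unfolding a_def using r by (intro holomorphic_intros) (auto simp: \<open>lam \<noteq> 0\<close>)
  have \<kappa>: "cmod \<kappa> = 1" by (simp add: \<kappa>_def norm_power lam)
  obtain s v where v: "s > 0" "v holomorphic_on ball 0 s"
    "\<And>y. y \<in> ball 0 s \<Longrightarrow> v y - \<kappa> * v (\<mu> * y) = a y - a 0" "v 0 = 0"
    by (rule cohomological_equation[OF r(1) a _ \<mu> \<kappa>], simp, rule that)
  define u where "u = (\<lambda>y. u0 + v y)"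
  have u_eq: "u y - \<kappa> * u (\<mu> * y) = a y - A" if "y \<in> ball 0 s" for y
  proof -
    have "u0 - \<kappa> * u0 = a 0 - A" by (auto simp: u0_def A_def field_simps)
    moreover have "u y - \<kappa> * u (\<mu> * y) = (u0 - \<kappa> * u0) + (v y - \<kappa> * v (\<mu> * y))"
      by (simp add: u_def algebra_simps)
    ultimately show ?thesis using v(3)[OF that] by simp
  qed
  define U where "U = (\<lambda>p::complex \<times> complex. u (snd p))"
  have U: "holomorphic_germ U"
    unfolding U_def u_def
    using v by (intro germ_intros holomorphic_germ_compose_holomorphic[OF holomorphic_germ_snd v(2)]) auto
  define w where "w = (\<lambda>p. 1 + U p * fst p ^ (n - 1))"
  have w: "holomorphic_germ w" "w 0 \<noteq> 0"
    unfolding w_def using n by (intro germ_intros U, simp add: power_0_left)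
  obtain K' where K': "germ_conj K K'"
    "\<And>n R. xcong n (\<lambda>p. fst (K p) * w (K p)) (\<lambda>p. R (fst p * w p, snd p)) \<Longrightarrow> xcong n (\<lambda>p. fst (K' p)) R"
    "\<And>n R. xcong n (\<lambda>p. snd (K p)) (\<lambda>p. R (fst p * w p, snd p)) \<Longrightarrow> xcong n (\<lambda>p. snd (K' p)) R"
    using conjugate_by_fst_scaling[OF K w] by blast
  have pow: "z * z ^ (n - 1) = z ^ n" for z :: complex
    using n by (cases n) auto
  define X where "X = (\<lambda>p. fst p + U p * fst p ^ n)"
  have X: "fst p * w p = X p" for p
    using pow[of "fst p"] by (simp add: X_def w_def algebra_simps)
  have fK: "holomorphic_germ (\<lambda>p. fst (K p))" by (intro germ_intros K)
  note lead = normal_form_leading[OF fst_K n N]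
  have "xcong (n + 1) (\<lambda>p. fst p ^ n * g p) (\<lambda>p. fst p ^ n * g (0, snd p))"
    by (rule xcong_mult_shift[OF xcong_fst_power xcong_1_snd[OF g(1)]])
  then have "xcong (Suc n) (\<lambda>p. lam * (fst p + c * fst p ^ N) + fst p ^ n * g p)
      (\<lambda>p. lam * (fst p + c * fst p ^ N) + fst p ^ n * g (0, snd p))"
    by (intro xcong_add) auto
  then have part1: "xcong (Suc n) (\<lambda>p. fst (K p)) (\<lambda>p. lam * (fst p + c * fst p ^ N) + fst p ^ n * g (0, snd p))"
    by (rule xcong_trans[OF xcong_eventually_eq[OF g(2)]])
  have UK: "xcong 1 (\<lambda>p. U (K p)) (\<lambda>p. U (0, \<mu> * snd p))"
  proof -
    have "holomorphic_map_germ (\<lambda>p::complex \<times> complex. (0, \<mu> * snd p))" by (intro germ_intros) auto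
    from xcong_compose_left[OF U K this] show ?thesis using lead(2) snd_K by simp
  qed
  \<comment> \<open>The n-th power already contributes order n, so \<open>U (K p)\<close> has to be
    known only modulo x.\<close>
  have "xcong (n + 1) (\<lambda>p. fst (K p) ^ n * U (K p)) (\<lambda>p. fst (K p) ^ n * U (0, \<mu> * snd p))"
    by (rule xcong_mult_shift[OF xcong_power_zero[OF lead(2)] UK])
  also have "xcong (n + 1) (\<lambda>p. fst (K p) ^ n * U (0, \<mu> * snd p)) (\<lambda>p. (lam * fst p) ^ n * U (0, \<mu> * snd p))"
  proof -
    have "xcong (2 + (n - 1)) (\<lambda>p. fst (K p) ^ Suc (n - 1)) (\<lambda>p. (lam * fst p) ^ Suc (n - 1))"
      by (rule xcong_power[OF fK lead(2) xcong_fst_cmult_zero lead(1)])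
    moreover have "Suc (n - 1) = n" "2 + (n - 1) = n + 1" using n by auto
    ultimately have *: "xcong (n + 1) (\<lambda>p. fst (K p) ^ n) (\<lambda>p. (lam * fst p) ^ n)" by metis
    have "holomorphic_map_germ (\<lambda>p::complex \<times> complex. (0, \<mu> * snd p))" by (intro germ_intros) auto
    from xcong_mult_left[OF holomorphic_germ_compose[OF U this] *] show ?thesis by (simp add: mult.commute)
  qed
  finally have part2: "xcong (Suc n) (\<lambda>p. fst (K p) ^ n * U (K p)) (\<lambda>p. (lam * fst p) ^ n * U (0, \<mu> * snd p))" by simp
  have hX: "holomorphic_germ X" unfolding X_def by (intro germ_intros U)
  have X_n: "xcong n X fst"
    by (rule xcongI[OF U]) (simp add: X_def mult.commute)
  have X_1: "xcong 1 X (\<lambda>p. 0)"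
    using xcong_trans[OF xcong_mono[OF X_n] xcong_fst_power[of 1, simplified]] n by simp
  \<comment> \<open>X and x differ from order n on, so their powers with exponent at least 2 differ
    only from order n + 1 on. The new and the old coordinate are interchangeable except in the
    linear term.\<close>
  have X_pow: "xcong (Suc n) (\<lambda>p. X p ^ k) (\<lambda>p. fst p ^ k)" if "2 \<le> k" for k
  proof -
    have "xcong (n + (k - 1)) (\<lambda>p. X p ^ Suc (k - 1)) (\<lambda>p. fst p ^ Suc (k - 1))"
      using xcong_fst_power[of 1] by (intro xcong_power[OF hX X_1 _ X_n]) simp
    then have "xcong (n + (k - 1)) (\<lambda>p. X p ^ k) (\<lambda>p. fst p ^ k)"
      using that by (cases k) auto
    then show ?thesis by (rule xcong_mono) (use that in auto)
  qed
  have part3: "xcong (Suc n) (\<lambda>p. lam * (X p + c * X p ^ N + A * X p ^ n))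
      (\<lambda>p. lam * (X p + c * fst p ^ N + A * fst p ^ n))"
    by (intro xcong_cmult xcong_add X_pow n N xcong_refl)
  \<comment> \<open>The balance in degree n is g(0, y) + \<open>lam\<close> \<kappa> u(\<mu> y) =
    \<open>lam\<close> (u(y) + A), which is the equation solved by u.\<close>
  have "\<forall>\<^sub>F p in nhds 0. lam * (fst p + c * fst p ^ N) + fst p ^ n * g (0, snd p) + (lam * fst p) ^ n * U (0, \<mu> * snd p)
      = lam * (X p + c * fst p ^ N + A * fst p ^ n)"
    using eventually_snd_ball[OF v(1)]
  proof eventually_elim
    case (elim p)
    have 1: "g (0, snd p) = lam * (A + u (snd p) - \<kappa> * u (\<mu> * snd p))"
      using u_eq[OF elim] \<open>lam \<noteq> 0\<close> by (simp add: a_def field_simps)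
    have 2: "(lam * fst p) ^ n = lam * \<kappa> * fst p ^ n"
      using pow[of lam] by (simp add: \<kappa>_def power_mult_distrib)
    show ?case
      by (simp only: 1 2 X_def U_def snd_conv) (simp add: algebra_simps)
  qed
  then have mid: "xcong (Suc n) (\<lambda>p. lam * (fst p + c * fst p ^ N) + fst p ^ n * g (0, snd p) + (lam * fst p) ^ n * U (0, \<mu> * snd p))
      (\<lambda>p. lam * (X p + c * fst p ^ N + A * fst p ^ n))"
    by (rule xcong_eventually_eq)
  have "fst (K p) * w (K p) = fst (K p) + fst (K p) ^ n * U (K p)" for p
    using pow[of "fst (K p)"] by (simp add: w_def algebra_simps)
  then have "xcong (Suc n) (\<lambda>p. fst (K p) * w (K p)) (\<lambda>p. lam * (X p + c * X p ^ N + A * X p ^ n))"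
    using xcong_trans[OF xcong_trans[OF xcong_add[OF part1 part2] mid] xcong_sym[OF part3]] by simp
  then have "xcong (Suc n) (\<lambda>p. fst (K' p)) (\<lambda>p. lam * (fst p + c * fst p ^ N + A * fst p ^ n))"
    by (intro K'(2)) (simp add: X)
  moreover have "xcong 1 (\<lambda>p. snd (K' p)) (\<lambda>p. \<mu> * snd p)"
    using snd_K by (intro K'(3)) simp
  moreover have "lam ^ (n - 1) = 1 \<or> A = 0" by (simp add: A_def \<kappa>_def)
  ultimately show ?thesis using that K'(1) by blast
qed

text \<open>The coordinate $X = x + b x^{d+1}$ changes the coefficient of $x^{N+d}$ by $bc(d + 1 - N)$.\<close>

lemma resonant_coefficient_removal:
  assumes K: "holomorphic_map_germ K" and lam: "lam ^ d = 1"
    and fst_K: "xcong (Suc (N + d)) (\<lambda>p. fst (K p)) (\<lambda>p. lam * (fst p + c * fst p ^ N + A * fst p ^ (N + d)))"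
    and snd_K: "xcong 1 (\<lambda>p. snd (K p)) (\<lambda>p. \<mu> * snd p)" and d: "1 \<le> d" "Suc d < N" and c: "c \<noteq> 0"
  obtains K' where "germ_conj K K'"
    "xcong (Suc (N + d)) (\<lambda>p. fst (K' p)) (\<lambda>p. lam * (fst p + c * fst p ^ N))"
    "xcong 1 (\<lambda>p. snd (K' p)) (\<lambda>p. \<mu> * snd p)"
proof -
  define e where "e = N - 1"
  have N: "N = Suc e" "1 \<le> e" using d by (auto simp: e_def)
  \<comment> \<open>\<open>b\<close> equates the coefficients of x^(N+d) on both sides, A + b c
    (d+1) = c N b; the divisor N - (d+1) is nonzero because \<open>Suc d < N\<close>.\<close>
  define b where "b = A / (c * (of_nat N - of_nat (Suc d)))"
  have ne: "(of_nat N :: complex) - of_nat (Suc d) \<noteq> 0"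
    using d of_nat_eq_iff[of N "Suc d", where ?'a = complex] by (metis eq_iff_diff_eq_0 less_irrefl)
  then have b: "A + b * of_nat (Suc d) * c = c * (of_nat N * b)"
    using c by (simp add: b_def divide_simps) (simp add: algebra_simps)
  define w where "w = (\<lambda>p::complex \<times> complex. 1 + b * fst p ^ d)"
  have w: "holomorphic_germ w" "w 0 \<noteq> 0"
    unfolding w_def using d by (intro germ_intros, simp add: power_0_left)
  obtain K' where K': "germ_conj K K'"
    "\<And>n R. xcong n (\<lambda>p. fst (K p) * w (K p)) (\<lambda>p. R (fst p * w p, snd p)) \<Longrightarrow> xcong n (\<lambda>p. fst (K' p)) R"
    "\<And>n R. xcong n (\<lambda>p. snd (K p)) (\<lambda>p. R (fst p * w p, snd p)) \<Longrightarrow> xcong n (\<lambda>p. snd (K' p)) R"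
    using conjugate_by_fst_scaling[OF K w] by blast
  have fK: "holomorphic_germ (\<lambda>p. fst (K p))" by (intro germ_intros K)
  let ?P = "\<lambda>p::complex \<times> complex. lam * (fst p + c * fst p ^ N)"
  have tail: "xcong (N + d) (\<lambda>p. lam * (fst p + c * fst p ^ N + A * fst p ^ (N + d))) ?P"
    using xcong_cmult[OF xcong_add[OF xcong_refl xcong_cmult[OF xcong_fst_power]], of "N + d" lam "\<lambda>p. fst p + c * fst p ^ N" A]
    by simp
  have low: "xcong (N + d) (\<lambda>p. fst (K p)) ?P"
    by (rule xcong_trans[OF xcong_mono[OF fst_K] tail]) simp
  have lead: "xcong 1 (\<lambda>p. fst (K p)) (\<lambda>p. 0)"
    by (rule normal_form_leading(2)[OF low]) (use d in simp_all)
  have lead': "xcong 1 ?P (\<lambda>p. 0)"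
    by (rule normal_form_leading(2)[where n = 2, OF xcong_refl]) (use d in simp_all)
  have "xcong (N + d + d) (\<lambda>p. fst (K p) ^ Suc d) (\<lambda>p. ?P p ^ Suc d)"
    by (rule xcong_power[OF fK lead lead' low])
  then have "xcong (Suc (N + d)) (\<lambda>p. fst (K p) ^ Suc d) (\<lambda>p. ?P p ^ Suc d)"
    by (rule xcong_mono) (use d in simp)
  also have "xcong (Suc (N + d)) (\<lambda>p. ?P p ^ Suc d) (\<lambda>p. lam * (fst p ^ Suc d + of_nat (Suc d) * c * fst p ^ (N + d)))"
  proof -
    \<comment> \<open>The binomial error starts in degree d + 1 + 2(N-1), which is beyond N + d
      because N >= 2.\<close>
    have "xcong (Suc d + 2 * e) (\<lambda>p. fst p ^ Suc d * (1 + c * fst p ^ e) ^ Suc d)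
        (\<lambda>p. fst p ^ Suc d * (1 + of_nat (Suc d) * c * fst p ^ e))"
      by (rule xcong_mult_shift[OF xcong_fst_power xcong_binomial])
    then have *: "xcong (Suc (N + d)) (\<lambda>p. lam * (fst p ^ Suc d * (1 + c * fst p ^ e) ^ Suc d))
        (\<lambda>p. lam * (fst p ^ Suc d * (1 + of_nat (Suc d) * c * fst p ^ e)))"
      by (intro xcong_cmult, rule xcong_mono) (use N in simp)
    have e1: "lam * (x ^ Suc d * (1 + c * x ^ e) ^ Suc d) = (lam * (x + c * x ^ N)) ^ Suc d" for x
    proof -
      have "lam * (x + c * x ^ N) = lam * (x * (1 + c * x ^ e))" by (simp add: N algebra_simps)
      moreover have "lam ^ Suc d = lam" using lam by simp
      ultimately show ?thesis by (simp only: power_mult_distrib)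
    qed
    have e2: "lam * (x ^ Suc d * (1 + of_nat (Suc d) * c * x ^ e)) = lam * (x ^ Suc d + of_nat (Suc d) * c * x ^ (N + d))" for x :: complex
      by (simp add: N power_add algebra_simps)
    show ?thesis using * by (simp only: e1 e2)
  qed
  finally have pow: "xcong (Suc (N + d)) (\<lambda>p. fst (K p) ^ Suc d) (\<lambda>p. lam * (fst p ^ Suc d + of_nat (Suc d) * c * fst p ^ (N + d)))" .
  have lhs: "xcong (Suc (N + d)) (\<lambda>p. fst (K p) + b * fst (K p) ^ Suc d)
      (\<lambda>p. lam * (fst p + c * fst p ^ N + A * fst p ^ (N + d)) + b * (lam * (fst p ^ Suc d + of_nat (Suc d) * c * fst p ^ (N + d))))"
    by (intro xcong_add fst_K xcong_cmult pow)
  have "xcong (N + 2 * d) (\<lambda>p. fst p ^ N * (1 + b * fst p ^ d) ^ N) (\<lambda>p. fst p ^ N * (1 + of_nat N * b * fst p ^ d))"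
    by (rule xcong_mult_shift[OF xcong_fst_power xcong_binomial])
  then have "xcong (Suc (N + d)) (\<lambda>p. fst p ^ N * (1 + b * fst p ^ d) ^ N) (\<lambda>p. fst p ^ N * (1 + of_nat N * b * fst p ^ d))"
    by (rule xcong_mono) (use d in simp)
  then have rhs: "xcong (Suc (N + d)) (\<lambda>p. lam * (fst p * w p + c * (fst p ^ N * (1 + b * fst p ^ d) ^ N)))
      (\<lambda>p. lam * (fst p * w p + c * (fst p ^ N * (1 + of_nat N * b * fst p ^ d))))"
    by (intro xcong_cmult xcong_add xcong_refl)
  have eq: "lam * (x + c * x ^ N + A * x ^ (N + d)) + b * (lam * (x ^ Suc d + of_nat (Suc d) * c * x ^ (N + d)))
      = lam * (x * (1 + b * x ^ d) + c * (x ^ N * (1 + of_nat N * b * x ^ d)))" for x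
  proof -
    have "lam * (x + c * x ^ N + A * x ^ (N + d)) + b * (lam * (x ^ Suc d + of_nat (Suc d) * c * x ^ (N + d)))
      = lam * (x + c * x ^ N + b * x ^ Suc d + (A + b * of_nat (Suc d) * c) * x ^ (N + d))"
      by (simp only: distrib_left distrib_right mult_ac add_ac)
    also have "\<dots> = lam * (x + c * x ^ N + b * x ^ Suc d + (c * (of_nat N * b)) * x ^ (N + d))"
      by (simp only: b)
    also have "\<dots> = lam * (x * (1 + b * x ^ d) + c * (x ^ N * (1 + of_nat N * b * x ^ d)))"
      by (simp add: power_add algebra_simps)
    finally show ?thesis .
  qed
  have "xcong (Suc (N + d)) (\<lambda>p. fst (K p) + b * fst (K p) ^ Suc d)
      (\<lambda>p. lam * (fst p * w p + c * (fst p ^ N * (1 + b * fst p ^ d) ^ N)))"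
    using xcong_trans[OF lhs[unfolded eq] xcong_sym[OF rhs[unfolded w_def]]] by (simp only: w_def)
  moreover have "fst p ^ N * (1 + b * fst p ^ d) ^ N = (fst p * w p) ^ N" for p :: "complex \<times> complex"
    by (simp add: w_def power_mult_distrib)
  moreover have "fst (K p) + b * fst (K p) ^ Suc d = fst (K p) * w (K p)" for p
    by (simp add: w_def algebra_simps)
  ultimately have "xcong (Suc (N + d)) (\<lambda>p. fst (K p) * w (K p)) (\<lambda>p. lam * (fst p * w p + c * (fst p * w p) ^ N))"
    by simp
  then have "xcong (Suc (N + d)) (\<lambda>p. fst (K' p)) ?P"
    by (intro K'(2)) simp
  moreover have "xcong 1 (\<lambda>p. snd (K' p)) (\<lambda>p. \<mu> * snd p)"
    using snd_K by (intro K'(3)) simp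
  ultimately show ?thesis using that K'(1) by blast
qed

text \<open>With X = s x the coefficient A becomes A / s^(N-1), so \<open>s\<close> has to be a root
  of A of order N - 1.\<close>

lemma leading_coefficient_scaling:
  assumes K: "holomorphic_map_germ K" and N: "2 \<le> N" and A: "A \<noteq> 0"
    and fst_K: "xcong n (\<lambda>p. fst (K p)) (\<lambda>p. lam * (fst p + A * fst p ^ N))"
    and snd_K: "xcong 1 (\<lambda>p. snd (K p)) (\<lambda>p. \<mu> * snd p)"
  obtains K' where "germ_conj K K'"
    "xcong n (\<lambda>p. fst (K' p)) (\<lambda>p. lam * (fst p + 1 * fst p ^ N))"
    "xcong 1 (\<lambda>p. snd (K' p)) (\<lambda>p. \<mu> * snd p)"
proof -
  define s where "s = exp (Ln A / of_nat (N - 1))"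
  have "s ^ (N - 1) = exp (of_nat (N - 1) * (Ln A / of_nat (N - 1)))"
    unfolding s_def by (rule exp_of_nat_mult[symmetric])
  also have "\<dots> = A" using N A by simp
  finally have s1: "s ^ (N - 1) = A" .
  have s: "s ^ N = A * s" using N s1 by (cases N) auto
  have "s \<noteq> 0" by (simp add: s_def)
  then obtain K' where K': "germ_conj K K'"
    "\<And>n R. xcong n (\<lambda>p. fst (K p) * s) (\<lambda>p. R (fst p * s, snd p)) \<Longrightarrow> xcong n (\<lambda>p. fst (K' p)) R"
    "\<And>n R. xcong n (\<lambda>p. snd (K p)) (\<lambda>p. R (fst p * s, snd p)) \<Longrightarrow> xcong n (\<lambda>p. snd (K' p)) R"
    using conjugate_by_fst_scaling[OF K holomorphic_germ_const[of s]] by blast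
  have eq: "s * (lam * (x + A * x ^ N)) = lam * (x * s + 1 * (x * s) ^ N)" for x
    by (simp add: power_mult_distrib s algebra_simps)
  have "xcong n (\<lambda>p. s * fst (K p)) (\<lambda>p. lam * (fst p * s + 1 * (fst p * s) ^ N))"
    using xcong_cmult[OF fst_K, of s] by (simp only: eq)
  then have "xcong n (\<lambda>p. fst (K' p)) (\<lambda>p. lam * (fst p + 1 * fst p ^ N))"
    by (intro K'(2)) (simp add: mult.commute)
  moreover have "xcong 1 (\<lambda>p. snd (K' p)) (\<lambda>p. \<mu> * snd p)"
    using snd_K by (intro K'(3)) simp
  ultimately show ?thesis using that K'(1) by blast
qed

section \<open>Iterates and the first resonant term\<close>

lemma iterate_on_axis:
  assumes K: "holomorphic_map_germ K"
    and fst_K: "xcong 1 (\<lambda>p. fst (K p)) (\<lambda>p. 0)" and snd_K: "xcong 1 (\<lambda>p. snd (K p)) (\<lambda>p. \<mu> * snd p)"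
  shows "xcong 1 (\<lambda>p. fst ((K ^^ j) p)) (\<lambda>p. 0) \<and> xcong 1 (\<lambda>p. snd ((K ^^ j) p)) (\<lambda>p. \<mu> ^ j * snd p)"
proof (induction j)
  case 0
  show ?case using xcong_fst_power[of 1] by simp
next
  case (Suc j)
  have Kj: "holomorphic_map_germ (K ^^ j)" by (intro germ_intros K)
  have "xcong 1 (\<lambda>p. snd (K ((K ^^ j) p))) (\<lambda>p. \<mu> * snd ((K ^^ j) p))"
    by (rule xcong_compose[OF snd_K Kj conjunct1[OF Suc]])
  also have "xcong 1 (\<lambda>p. \<mu> * snd ((K ^^ j) p)) (\<lambda>p. \<mu> * (\<mu> ^ j * snd p))"
    by (intro xcong_cmult conjunct2[OF Suc])
  finally show ?case
    using xcong_compose[OF fst_K Kj conjunct1[OF Suc]] by (simp add: mult.assoc)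
qed

text \<open>Modulo x^(N+1) only the linear part of an iterate enters its N-th power, and resonance
  makes each of the j steps contribute the same c. The resonance condition is multiplied by c so
  that it also covers c = 0, the case of a germ linear in x to high order.\<close>

lemma iterate_normal_form:
  assumes K: "holomorphic_map_germ K"
    and fst_K: "xcong (Suc N) (\<lambda>p. fst (K p)) (\<lambda>p. lam * (fst p + c * fst p ^ N))"
    and N: "2 \<le> N" and c: "c * lam ^ N = c * lam"
  shows "xcong (Suc N) (\<lambda>p. fst ((K ^^ j) p)) (\<lambda>p. lam ^ j * (fst p + of_nat j * c * fst p ^ N))"
proof (induction j)
  case 0
  show ?case by simp
next
  case (Suc j)
  have Kj: "holomorphic_map_germ (K ^^ j)" by (intro germ_intros K)
  have lead: "xcong 2 (\<lambda>p. fst ((K ^^ j) p)) (\<lambda>p. lam ^ j * fst p)" "xcong 1 (\<lambda>p. fst ((K ^^ j) p)) (\<lambda>p. 0)"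
    using normal_form_leading[OF Suc] N by auto
  have cj: "c * (lam ^ j) ^ N = c * lam ^ j" for j
  proof (induction j)
    case (Suc j)
    have "c * (lam ^ Suc j) ^ N = (c * lam ^ N) * (lam ^ j) ^ N" by (simp add: power_mult_distrib)
    also have "\<dots> = lam * (c * (lam ^ j) ^ N)" by (simp only: c) (simp add: mult_ac)
    also have "\<dots> = c * lam ^ Suc j" by (simp only: Suc) (simp add: mult_ac)
    finally show ?case .
  qed simp
    have "xcong (Suc N) (\<lambda>p. fst (K ((K ^^ j) p))) (\<lambda>p. lam * (fst ((K ^^ j) p) + c * fst ((K ^^ j) p) ^ N))"
      by (rule xcong_compose[OF fst_K Kj lead(2)])
    also have "xcong (Suc N) (\<lambda>p. lam * (fst ((K ^^ j) p) + c * fst ((K ^^ j) p) ^ N))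
       (\<lambda>p. lam * (lam ^ j * (fst p + of_nat j * c * fst p ^ N) + c * (lam ^ j * fst p) ^ N))"
    proof (intro xcong_cmult xcong_add Suc)
      have "xcong (2 + (N - 1)) (\<lambda>p. fst ((K ^^ j) p) ^ Suc (N - 1)) (\<lambda>p. (lam ^ j * fst p) ^ Suc (N - 1))"
        by (rule xcong_power[OF holomorphic_map_germ_fst[OF Kj] lead(2) xcong_fst_cmult_zero lead(1)])
      moreover have "2 + (N - 1) = Suc N" "Suc (N - 1) = N" using N by auto
      ultimately show "xcong (Suc N) (\<lambda>p. fst ((K ^^ j) p) ^ N) (\<lambda>p. (lam ^ j * fst p) ^ N)" by metis
    qed
    finally have main: "xcong (Suc N) (\<lambda>p. fst (K ((K ^^ j) p)))
       (\<lambda>p. lam * (lam ^ j * (fst p + of_nat j * c * fst p ^ N) + c * (lam ^ j * fst p) ^ N))" .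
    have eq: "lam * (lam ^ j * (x + of_nat j * c * x ^ N) + c * (lam ^ j * x) ^ N)
       = lam ^ Suc j * (x + of_nat (Suc j) * c * x ^ N)" for x
    proof -
      have e: "c * (lam ^ j * x) ^ N = c * lam ^ j * x ^ N"
        by (simp only: power_mult_distrib cj flip: mult.assoc)
      show ?thesis by (simp only: e) (simp add: algebra_simps)
    qed
    show ?case using main by (simp only: eq funpow.simps o_apply)
qed

text \<open>Coefficients are normalized degree by degree. A nonzero surviving constant is resonant
  and ends the process; otherwise the precision grows by one. The first alternative does not mention
  n, so once reached it persists through the induction.\<close>

lemma leading_term_dichotomy:
  assumes K: "holomorphic_map_germ K" and lam: "cmod lam = 1" and \<mu>: "cmod \<mu> < 1"
    and fst_K: "xcong 2 (\<lambda>p. fst (K p)) (\<lambda>p. lam * fst p)"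
    and snd_K: "xcong 1 (\<lambda>p. snd (K p)) (\<lambda>p. \<mu> * snd p)" and n: "2 \<le> n"
  shows "(\<exists>K' N A. germ_conj K K' \<and> 2 \<le> N \<and> A \<noteq> 0 \<and> lam ^ (N - 1) = 1 \<and>
        xcong (Suc N) (\<lambda>p. fst (K' p)) (\<lambda>p. lam * (fst p + A * fst p ^ N)) \<and>
        xcong 1 (\<lambda>p. snd (K' p)) (\<lambda>p. \<mu> * snd p)) \<or>
     (\<exists>K'. germ_conj K K' \<and> xcong n (\<lambda>p. fst (K' p)) (\<lambda>p. lam * fst p) \<and>
        xcong 1 (\<lambda>p. snd (K' p)) (\<lambda>p. \<mu> * snd p))"
  (is "?resonant \<or> ?flat n")
  using n
proof (induction n rule: nat_induct_at_least)
  case base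
  show ?case using germ_conj_refl fst_K snd_K by blast
next
  case (Suc n)
  show ?case
  proof (cases ?resonant)
    case False
    then obtain K1 where K1: "germ_conj K K1" "xcong n (\<lambda>p. fst (K1 p)) (\<lambda>p. lam * fst p)"
        "xcong 1 (\<lambda>p. snd (K1 p)) (\<lambda>p. \<mu> * snd p)"
      using Suc.IH by blast
    \<comment> \<open>Coefficient 0 with the placeholder exponent 2 gives the shape that
      \<open>coefficient_normalization\<close> expects.\<close>
    have "xcong n (\<lambda>p. fst (K1 p)) (\<lambda>p. lam * (fst p + 0 * fst p ^ 2))" using K1(2) by simp
    then obtain K2 A where K2: "germ_conj K1 K2"
      "xcong (Suc n) (\<lambda>p. fst (K2 p)) (\<lambda>p. lam * (fst p + 0 * fst p ^ 2 + A * fst p ^ n))"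
      "xcong 1 (\<lambda>p. snd (K2 p)) (\<lambda>p. \<mu> * snd p)" "lam ^ (n - 1) = 1 \<or> A = 0"
      using coefficient_normalization[OF germ_conj_map_germ[OF K1(1) K] lam \<mu> _ K1(3) Suc.hyps, of 0 2] by blast
    have "A = 0"
    proof (rule ccontr)
      assume A: "A \<noteq> 0"
      then have "?resonant"
        using K2 germ_conj_trans[OF K1(1) K2(1)] Suc.hyps
        by (intro exI[of _ K2] exI[of _ n] exI[of _ A]) auto
      with False show False ..
    qed
    then show ?thesis using K2 germ_conj_trans[OF K1(1) K2(1)] by auto
  qed simp
qed

section \<open>The strong stable curve\<close>

lemma dx_dy_eventually_cong:
  assumes "\<forall>\<^sub>F p in nhds 0. f p = g p" "holomorphic_germ g"
  shows "dx f 0 = dx g 0" "dy f 0 = dy g 0"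
proof -
  obtain S where S: "open S" "0 \<in> S" "\<And>p. p \<in> S \<Longrightarrow> f p = g p"
    using assms(1) unfolding eventually_nhds by blast
  have "(f has_derivative (\<lambda>(u, v). dx g 0 * u + dy g 0 * v)) (at 0)"
    by (rule has_derivative_transform_within_open[OF holomorphic_germ_has_derivative[OF assms(2)] S(1,2)])
      (simp add: S(3))
  from dx_dy_eq[OF this] show "dx f 0 = dx g 0" "dy f 0 = dy g 0" .
qed

text \<open>These are the four entries of the matrix identity D\<Psi> D\<Phi> = 1 at the
  origin.\<close>

lemma dx_compose_left_inverse:
  assumes \<Phi>: "holomorphic_map_germ \<Phi>" and \<Psi>: "holomorphic_map_germ \<Psi>" and inv: "\<forall>\<^sub>F p in nhds 0. \<Psi> (\<Phi> p) = p"
  defines "D \<equiv> \<lambda>f. dx (\<lambda>p. f (\<Phi> p)) 0" and "E \<equiv> \<lambda>f. dy (\<lambda>p. f (\<Phi> p)) 0"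
  shows "dx (\<lambda>p. fst (\<Psi> p)) 0 * D fst + dy (\<lambda>p. fst (\<Psi> p)) 0 * D snd = 1"
    "dx (\<lambda>p. fst (\<Psi> p)) 0 * E fst + dy (\<lambda>p. fst (\<Psi> p)) 0 * E snd = 0"
    "dx (\<lambda>p. snd (\<Psi> p)) 0 * D fst + dy (\<lambda>p. snd (\<Psi> p)) 0 * D snd = 0"
    "dx (\<lambda>p. snd (\<Psi> p)) 0 * E fst + dy (\<lambda>p. snd (\<Psi> p)) 0 * E snd = 1"
proof -
  have 1: "\<forall>\<^sub>F p in nhds 0. fst (\<Psi> (\<Phi> p)) = fst p" and 2: "\<forall>\<^sub>F p in nhds 0. snd (\<Psi> (\<Phi> p)) = snd p"
    using inv by (auto elim: eventually_mono)
  note c1 = dx_dy_eventually_cong[OF 1 holomorphic_germ_fst]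
  note c2 = dx_dy_eventually_cong[OF 2 holomorphic_germ_snd]
  note d1 = dx_compose_germ[OF holomorphic_map_germ_fst[OF \<Psi>] \<Phi>]
  note d2 = dx_compose_germ[OF holomorphic_map_germ_snd[OF \<Psi>] \<Phi>]
  show "dx (\<lambda>p. fst (\<Psi> p)) 0 * D fst + dy (\<lambda>p. fst (\<Psi> p)) 0 * D snd = 1"
    "dx (\<lambda>p. fst (\<Psi> p)) 0 * E fst + dy (\<lambda>p. fst (\<Psi> p)) 0 * E snd = 0"
    "dx (\<lambda>p. snd (\<Psi> p)) 0 * D fst + dy (\<lambda>p. snd (\<Psi> p)) 0 * D snd = 0"
    "dx (\<lambda>p. snd (\<Psi> p)) 0 * E fst + dy (\<lambda>p. snd (\<Psi> p)) 0 * E snd = 1"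
    using c1 c2 d1 d2 by (simp_all add: D_def E_def)
qed

lemma norm_diag_le:
  fixes u v :: complex
  assumes "cmod a \<le> l" "cmod d \<le> l"
  shows "norm (a * u, d * v) \<le> l * norm (u, v)"
proof -
  have l: "0 \<le> l" using assms norm_ge_zero order_trans by blast
  have "(cmod (a * u))\<^sup>2 + (cmod (d * v))\<^sup>2 \<le> l\<^sup>2 * ((cmod u)\<^sup>2 + (cmod v)\<^sup>2)"
    using mult_right_mono[OF power_mono[OF assms(1), of 2], of "(cmod u)\<^sup>2"]
      mult_right_mono[OF power_mono[OF assms(2), of 2], of "(cmod v)\<^sup>2"]
    by (simp add: norm_mult power_mult_distrib algebra_simps)
  then have "norm (a * u, d * v) \<le> sqrt (l\<^sup>2 * ((cmod u)\<^sup>2 + (cmod v)\<^sup>2))"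
    unfolding norm_Pair by (rule real_sqrt_le_mono)
  also have "\<dots> = l * norm (u, v)"
    using l by (simp add: norm_Pair real_sqrt_mult)
  finally show ?thesis .
qed

text \<open>In the Euclidean norm a diagonal matrix has the largest modulus of its entries as
  operator norm. The partial derivatives are continuous, so near the origin the diagonal stays below
  some l' < l and the off-diagonal entries are negligible; the mean value inequality does the
  rest.\<close>

lemma lipschitz_near_diagonal:
  assumes G: "holomorphic_map_germ G"
    and off: "dy (\<lambda>p. fst (G p)) 0 = 0" "dx (\<lambda>p. snd (G p)) 0 = 0"
    and diag: "cmod (dx (\<lambda>p. fst (G p)) 0) < l" "cmod (dy (\<lambda>p. snd (G p)) 0) < l"
  shows "\<forall>\<^sub>F \<delta> in at_right 0. \<forall>z \<in> ball 0 \<delta>. \<forall>w \<in> ball 0 \<delta>. norm (G z - G w) \<le> l * norm (z - w)"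
proof -
  define f1 where "f1 = (\<lambda>p. fst (G p))"
  define f2 where "f2 = (\<lambda>p. snd (G p))"
  have f: "holomorphic_germ f1" "holomorphic_germ f2" using G by (auto simp: holomorphic_map_germ_def f1_def f2_def)
  obtain l' where l': "cmod (dx f1 0) < l'" "cmod (dy f2 0) < l'" "l' < l"
    using dense[of "max (cmod (dx f1 0)) (cmod (dy f2 0))" l] diag by (auto simp: f1_def f2_def)
  define e where "e = (l - l') / 2"
  have e: "e > 0" "l' + 2 * e = l" using l' by (auto simp: e_def field_simps)
  obtain r1 r2 where r: "r1 > 0" "r2 > 0" "holomorphic2_on f1 (ball 0 r1)" "holomorphic2_on f2 (ball 0 r2)"
    using f by (metis holomorphic_germ_ball)
  have nt: "((\<lambda>p. cmod (h p)) \<longlongrightarrow> cmod (h 0)) (nhds 0)" if "holomorphic_germ h" for h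
    by (intro tendsto_norm holomorphic_germ_tendsto that)
  have "\<forall>\<^sub>F p in nhds 0. p \<in> ball 0 r1 \<and> p \<in> ball 0 r2 \<and> cmod (dx f1 p) < l' \<and> cmod (dy f2 p) < l'
     \<and> cmod (dy f1 p) < e \<and> cmod (dx f2 p) < e"
    using r(1,2) l' e off
    by (intro eventually_conj eventually_nhds_in_open order_tendstoD(2)[OF nt] holomorphic_germ_dx holomorphic_germ_dy f)
      (auto simp: f1_def f2_def)
  then obtain d where d: "d > 0" "\<And>p. p \<in> ball 0 d \<Longrightarrow> p \<in> ball 0 r1 \<and> p \<in> ball 0 r2 \<and> cmod (dx f1 p) < l' \<and> cmod (dy f2 p) < l'
     \<and> cmod (dy f1 p) < e \<and> cmod (dx f2 p) < e"
    unfolding eventually_nhds_metric by (auto simp: dist_commute)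
  have "norm (G z - G w) \<le> l * norm (z - w)" if zw: "z \<in> ball 0 d" "w \<in> ball 0 d" for z w
  proof (rule differentiable_bound[OF convex_ball _ _ zw])
    fix p :: "complex \<times> complex" assume p: "p \<in> ball 0 d"
    let ?D = "\<lambda>q. ((\<lambda>(u, v). dx f1 p * u + dy f1 p * v) q, (\<lambda>(u, v). dx f2 p * u + dy f2 p * v) q)"
    have "((\<lambda>p. (f1 p, f2 p)) has_derivative ?D) (at p)"
      using d(2)[OF p] by (intro has_derivative_Pair holomorphic2_on_has_derivative[OF open_ball r(3)]
          holomorphic2_on_has_derivative[OF open_ball r(4)]) auto
    then have "(G has_derivative ?D) (at p)" by (simp add: f1_def f2_def)
    then show "(G has_derivative ?D) (at p within ball 0 d)" by (rule has_derivative_at_withinI)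
    show "onorm ?D \<le> l"
    proof (rule onorm_le)
      fix q :: "complex \<times> complex"
      obtain u v where q: "q = (u, v)" by fastforce
      have "?D q = (dx f1 p * u, dy f2 p * v) + (dy f1 p * v, dx f2 p * u)" by (simp add: q)
      also have "norm \<dots> \<le> norm (dx f1 p * u, dy f2 p * v) + norm (dy f1 p * v, dx f2 p * u)"
        by (rule norm_triangle_ineq)
      also have "\<dots> \<le> l' * norm (u, v) + e * norm (v, u)"
        using d(2)[OF p] by (intro add_mono norm_diag_le) auto
      also have "\<dots> \<le> l * norm q"
        using e by (simp add: q norm_Pair add.commute flip: distrib_right) (intro mult_right_mono; simp)
      finally show "norm (?D q) \<le> l * norm q" .
    qed
  qed
  with d(1) show ?thesis
    unfolding eventually_at_right_field by (intro exI[of _ d]) auto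
qed

text \<open>The curve $\gamma$ with $G(\gamma(\mu t)) = \gamma(t)$ is the limit of $\gamma_{n+1}(t) = G(\gamma_n(\mu t))$.
  One application of $G$ expands by less than $\ell < |\mu|^{-2}$, while rescaling $t$ shrinks quadratic errors
  by $|\mu|^2$.\<close>

lemma invariant_curve:
  assumes G: "holomorphic_map_germ G"
    and off: "dy (\<lambda>p. fst (G p)) 0 = 0" "dx (\<lambda>p. snd (G p)) 0 = 0"
    and diag: "cmod (dx (\<lambda>p. fst (G p)) 0) = 1" "dy (\<lambda>p. snd (G p)) 0 = 1 / \<mu>"
    and \<mu>: "cmod \<mu> < 1" "\<mu> \<noteq> 0"
  obtains \<gamma> r C where "r > 0" "C \<ge> 0" "(\<lambda>t. fst (\<gamma> t)) holomorphic_on ball 0 r" "(\<lambda>t. snd (\<gamma> t)) holomorphic_on ball 0 r"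
    "\<And>t. t \<in> ball 0 r \<Longrightarrow> norm (\<gamma> t - (0, t)) \<le> C * (cmod t)\<^sup>2"
    "\<And>t. t \<in> ball 0 r \<Longrightarrow> \<gamma> t = G (\<gamma> (\<mu> * t))"
proof -
  define m where "m = cmod \<mu>"
  have m: "0 < m" "m < 1" using \<mu> by (auto simp: m_def)
  \<comment> \<open>Above 1/m, hence above both diagonal moduli 1 and 1/m, to be a Lipschitz
    constant near the origin; below 1/m^2 to make the ratio \<theta> less than 1. There is room
    because m < 1.\<close>
  obtain l where l: "1 / m < l" "l < 1 / m\<^sup>2"
  proof -
    have "m\<^sup>2 < m" using m by (simp add: power2_eq_square)
    then have "1 / m < 1 / m\<^sup>2" using m by (intro divide_strict_left_mono) auto
    then show ?thesis using that dense by blast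
  qed
  have "1 < 1 / m" using m by simp
  with l have l1: "1 < l" by linarith
  define \<theta> where "\<theta> = l * m\<^sup>2"
  have \<theta>: "0 \<le> \<theta>" "\<theta> < 1" using l l1 m by (auto simp: \<theta>_def field_simps)
  define f1 where "f1 = (\<lambda>p. fst (G p))"
  define f2 where "f2 = (\<lambda>p. snd (G p))"
  have f: "holomorphic_germ f1" "holomorphic_germ f2" using G by (auto simp: holomorphic_map_germ_def f1_def f2_def)
  obtain r1 r2 where r12: "r1 > 0" "r2 > 0" "holomorphic2_on f1 (ball 0 r1)" "holomorphic2_on f2 (ball 0 r2)"
    using f by (metis holomorphic_germ_ball)
  have "\<forall>\<^sub>F \<delta> in at_right 0. \<forall>z \<in> ball 0 \<delta>. \<forall>w \<in> ball 0 \<delta>. norm (G z - G w) \<le> l * norm (z - w)"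
    using l l1 diag by (intro lipschitz_near_diagonal[OF G off]) (auto simp: norm_divide m_def)
  moreover have "\<forall>\<^sub>F \<delta> in at_right 0. 0 < \<delta> \<and> \<delta> < min r1 r2"
    using r12 unfolding eventually_at_right_field by (intro exI[of _ "min r1 r2"]) auto
  ultimately have "\<forall>\<^sub>F \<delta> in at_right 0. (0 < \<delta> \<and> \<delta> < min r1 r2) \<and> (\<forall>z \<in> ball 0 \<delta>. \<forall>w \<in> ball 0 \<delta>. norm (G z - G w) \<le> l * norm (z - w))"
    by (rule eventually_conj[rotated])
  then obtain \<delta> where \<delta>: "0 < \<delta>" "\<delta> < min r1 r2"
    and lip: "\<And>z w. z \<in> ball 0 \<delta> \<Longrightarrow> w \<in> ball 0 \<delta> \<Longrightarrow> norm (G z - G w) \<le> l * norm (z - w)"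
    using eventually_happens'[of "at_right (0::real)"] by (metis (no_types, lifting) trivial_limit_at_right_real)
  have hol: "holomorphic2_on f1 (ball 0 \<delta>)" "holomorphic2_on f2 (ball 0 \<delta>)"
    using \<delta> r12 by (auto intro: holomorphic2_on_subset)
  have slice: "(\<lambda>y. f (0, y)) holomorphic_on ball 0 \<delta>" if "holomorphic2_on f (ball 0 \<delta>)" for f
    by (intro holomorphic2_on_compose_curve[OF open_ball open_ball that] holomorphic_intros) (auto simp: norm_Pair)
  have G0: "G (0, 0) = (0, 0)" using holomorphic_map_germ_0[OF G] by (simp add: zero_prod_def)
  have half: "0 < \<delta> / 2" "\<delta> / 2 < \<delta>" using \<delta> by auto
  have d1: "deriv (\<lambda>y. f1 (0, y)) 0 = 0"
    using off(1) by (simp add: dy_def f1_def)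
  have d2: "deriv (\<lambda>y. f2 (0, y)) 0 = 1 / \<mu>"
    using diag(2) by (simp add: dy_def f2_def)
  \<comment> \<open>G(0, \<mu> t) agrees with (0, t) to first order: on the y-axis the first
    component of G has no linear term and the second has linear term y / \<mu>. So the first
    correction is quadratic in t.\<close>
  obtain C1 where C1: "C1 \<ge> 0" "\<And>y. y \<in> cball 0 (\<delta> / 2) \<Longrightarrow> cmod (f1 (0, y)) \<le> C1 * (cmod y)\<^sup>2"
    using holomorphic_quadratic_bound[OF half slice[OF hol(1)] _ d1] G0 by (auto simp: f1_def)
  have "((\<lambda>y. f2 (0, y)) has_field_derivative 1 / \<mu>) (at 0)"
    using holomorphic_derivI[OF slice[OF hol(2)] open_ball, of 0] \<delta> d2 by simp
  then have "((\<lambda>y. f2 (0, y) - y / \<mu>) has_field_derivative 1 / \<mu> - 1 / \<mu>) (at 0)"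
    by (intro derivative_intros) (use \<mu> in \<open>auto intro!: derivative_eq_intros\<close>)
  then have "deriv (\<lambda>y. f2 (0, y) - y / \<mu>) 0 = 0"
    using DERIV_imp_deriv by fastforce
  moreover have "(\<lambda>y. f2 (0, y) - y / \<mu>) holomorphic_on ball 0 \<delta>"
    by (intro holomorphic_intros slice[OF hol(2)]) (use \<mu> in auto)
  ultimately obtain C2 where C2: "C2 \<ge> 0" "\<And>y. y \<in> cball 0 (\<delta> / 2) \<Longrightarrow> cmod (f2 (0, y) - y / \<mu>) \<le> C2 * (cmod y)\<^sup>2"
    using holomorphic_quadratic_bound[OF half, of "\<lambda>y. f2 (0, y) - y / \<mu>"] G0 by (auto simp: f2_def)
  define C where "C = C1 + C2"
  have C: "C \<ge> 0" using C1 C2 by (simp add: C_def)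
  have init: "norm (G (0, \<mu> * t) - (0, t)) \<le> C * (cmod t)\<^sup>2" if t: "t \<in> cball 0 (\<delta> / 2)" for t
  proof -
    have mt: "\<mu> * t \<in> cball 0 (\<delta> / 2)" "(cmod (\<mu> * t))\<^sup>2 \<le> (cmod t)\<^sup>2"
      using t \<mu> mult_right_mono[of "cmod \<mu>" 1 "cmod t"] by (auto simp: norm_mult intro!: power_mono)
    have "norm (G (0, \<mu> * t) - (0, t)) \<le> cmod (fst (G (0, \<mu> * t) - (0, t))) + cmod (snd (G (0, \<mu> * t) - (0, t)))"
      using norm_Pair_le[of "fst (G (0, \<mu> * t) - (0, t))" "snd (G (0, \<mu> * t) - (0, t))"]
      by (simp only: prod.collapse)
    also have "\<dots> = cmod (f1 (0, \<mu> * t)) + cmod (f2 (0, \<mu> * t) - (\<mu> * t) / \<mu>)"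
      using \<mu> by (simp add: f1_def f2_def)
    also have "\<dots> \<le> C1 * (cmod (\<mu> * t))\<^sup>2 + C2 * (cmod (\<mu> * t))\<^sup>2"
      by (intro add_mono C1 C2 mt)
    also have "\<dots> \<le> C * (cmod t)\<^sup>2"
      using mult_left_mono[OF mt(2) C] by (simp add: C_def algebra_simps)
    finally show ?thesis .
  qed
  \<comment> \<open>C' sums the geometric series of corrections C \<theta>^n. With the r below all
    iterates have norm at most r (1 + C') <= \<delta>/2, inside the ball where \<open>lip\<close>
    holds; r <= 1 is for |t|^2 <= |t|.\<close>
  define C' where "C' = C / (1 - \<theta>)"
  have C': "C' \<ge> 0" using C \<theta> by (simp add: C'_def)
  define r where "r = min (\<delta> / 2) (min 1 (\<delta> / (2 * (1 + C'))))"
  have "r \<le> \<delta> / (2 * (1 + C'))" by (simp add: r_def)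
  then have "r * (1 + C') \<le> \<delta> / 2" using C' by (simp add: field_simps)
  moreover have "r > 0" using \<delta> C' by (simp add: r_def)
  moreover have "r \<le> \<delta> / 2" unfolding r_def by (rule min.cobounded1)
  moreover have "r \<le> 1" unfolding r_def by (rule min.coboundedI2[OF min.cobounded1])
  ultimately have r: "r > 0" "r \<le> \<delta> / 2" "r \<le> 1" "r * (1 + C') \<le> \<delta> / 2"
    by auto
  define \<gamma> where "\<gamma> = rec_nat (\<lambda>t. (0, t)) (\<lambda>n g t. G (g (\<mu> * t)))"
  have \<gamma>_0: "\<gamma> 0 t = (0, t)" and \<gamma>_Suc: "\<gamma> (Suc n) t = G (\<gamma> n (\<mu> * t))" for n t
    by (simp_all add: \<gamma>_def)
  have mu_ball: "\<mu> * t \<in> ball 0 r" if "t \<in> ball 0 r" for t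
    using that \<mu> mult_right_mono[of "cmod \<mu>" 1 "cmod t"] by (auto simp: norm_mult)
  have geo: "(\<Sum>i<n. \<theta> ^ i) \<le> 1 / (1 - \<theta>)" for n
    using \<theta> by (simp add: sum_gp_strict divide_right_mono)
  have in_\<delta>: "z \<in> ball 0 \<delta>" if "norm (z - (0, t)) \<le> C' * (cmod t)\<^sup>2" "t \<in> ball 0 r" for z t
  proof -
    have "(cmod t)\<^sup>2 \<le> cmod t"
      using that(2) r(3) by (simp add: power2_eq_square mult_left_le)
    from order_trans[OF that(1) mult_left_mono[OF this C']]
    have t: "norm (z - (0, t)) \<le> C' * cmod t" .
    have "norm z \<le> norm (0::complex, t) + norm (z - (0, t))"
      using norm_triangle_ineq[of "(0, t)" "z - (0, t)"] by simp
    also have "\<dots> \<le> cmod t + C' * cmod t"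
      using t by (simp add: norm_Pair)
    also have "\<dots> = cmod t * (1 + C')" by (simp add: algebra_simps)
    also have "\<dots> \<le> r * (1 + C')" using that C' by (intro mult_right_mono) auto
    also have "\<dots> < \<delta>" using r \<delta> by simp
    finally show ?thesis by simp
  qed
  \<comment> \<open>Both bounds go through the induction together: the first keeps the iterates
    where \<open>lip\<close> applies, the second is the contraction by \<theta>, whose partial sums
    give the first.\<close>
  have est: "(\<forall>t \<in> ball 0 r. norm (\<gamma> n t - (0, t)) \<le> C * (\<Sum>i<n. \<theta> ^ i) * (cmod t)\<^sup>2) \<and>
      (\<forall>t \<in> ball 0 r. norm (\<gamma> (Suc n) t - \<gamma> n t) \<le> C * \<theta> ^ n * (cmod t)\<^sup>2)" for n
  proof (induction n)
    case 0
    show ?case using init r by (auto simp: \<gamma>_0 \<gamma>_Suc)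
  next
    case (Suc n)
    have 1: "norm (\<gamma> (Suc n) t - (0, t)) \<le> C * (\<Sum>i<Suc n. \<theta> ^ i) * (cmod t)\<^sup>2" if t: "t \<in> ball 0 r" for t
    proof -
      have "norm (\<gamma> (Suc n) t - (0, t)) \<le> norm (\<gamma> (Suc n) t - \<gamma> n t) + norm (\<gamma> n t - (0, t))"
        using dist_triangle[of "\<gamma> (Suc n) t" "(0, t)" "\<gamma> n t"] by (simp only: dist_norm)
      also have "\<dots> \<le> C * \<theta> ^ n * (cmod t)\<^sup>2 + C * (\<Sum>i<n. \<theta> ^ i) * (cmod t)\<^sup>2"
        using Suc t by (intro add_mono) auto
      finally show ?thesis by (simp add: algebra_simps)
    qed
    have le: "C * (\<Sum>i<k. \<theta> ^ i) * (cmod t)\<^sup>2 \<le> C' * (cmod t)\<^sup>2" for k t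
      using mult_left_mono[OF geo[of k] C] by (intro mult_right_mono) (auto simp: C'_def)
    have "norm (\<gamma> (Suc (Suc n)) t - \<gamma> (Suc n) t) \<le> C * \<theta> ^ Suc n * (cmod t)\<^sup>2" if t: "t \<in> ball 0 r" for t
    proof -
      let ?s = "\<mu> * t"
      have s: "?s \<in> ball 0 r" by (rule mu_ball[OF t])
      have "norm (\<gamma> (Suc (Suc n)) t - \<gamma> (Suc n) t) = norm (G (\<gamma> (Suc n) ?s) - G (\<gamma> n ?s))"
        by (simp only: \<gamma>_Suc)
      also have "\<dots> \<le> l * norm (\<gamma> (Suc n) ?s - \<gamma> n ?s)"
        using order_trans[OF 1[OF s] le] order_trans[OF bspec[OF conjunct1[OF Suc] s] le] s
        by (intro lip in_\<delta>[of _ ?s])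
      also have "\<dots> \<le> l * (C * \<theta> ^ n * (cmod ?s)\<^sup>2)"
        using Suc s l1 by (intro mult_left_mono) auto
      also have "\<dots> = C * \<theta> ^ Suc n * (cmod t)\<^sup>2"
        by (simp add: \<theta>_def m_def norm_mult power_mult_distrib)
      finally show ?thesis .
    qed
    with 1 show ?case by blast
  qed
  have bound: "norm (\<gamma> n t - (0, t)) \<le> C' * (cmod t)\<^sup>2" if "t \<in> ball 0 r" for n t
  proof -
    have "norm (\<gamma> n t - (0, t)) \<le> C * (\<Sum>i<n. \<theta> ^ i) * (cmod t)\<^sup>2" using est that by blast
    also have "\<dots> \<le> C' * (cmod t)\<^sup>2"
      using mult_left_mono[OF geo[of n] C] by (intro mult_right_mono) (auto simp: C'_def)
    finally show ?thesis .
  qed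
  have \<gamma>_\<delta>: "\<gamma> n t \<in> ball 0 \<delta>" if "t \<in> ball 0 r" for n t
    using in_\<delta>[OF bound that] that by blast
  have hol_\<gamma>: "(\<lambda>t. fst (\<gamma> n t)) holomorphic_on ball 0 r \<and> (\<lambda>t. snd (\<gamma> n t)) holomorphic_on ball 0 r" for n
  proof (induction n)
    case 0
    show ?case by (auto simp: \<gamma>_0 intro!: holomorphic_intros)
  next
    case (Suc n)
    have sub: "(\<lambda>t. \<mu> * t) ` ball 0 r \<subseteq> ball 0 r" using mu_ball by blast
    have "(\<lambda>t. fst (\<gamma> n (\<mu> * t))) holomorphic_on ball 0 r" "(\<lambda>t. snd (\<gamma> n (\<mu> * t))) holomorphic_on ball 0 r"
      using holomorphic_on_compose_gen[OF _ conjunct1[OF Suc] sub] holomorphic_on_compose_gen[OF _ conjunct2[OF Suc] sub]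
      by (auto simp: o_def intro: holomorphic_intros)
    from holomorphic2_on_compose_curve[OF open_ball open_ball hol(1) this]
      holomorphic2_on_compose_curve[OF open_ball open_ball hol(2) this]
    show ?case using \<gamma>_\<delta>[OF mu_ball] by (simp add: \<gamma>_Suc f1_def f2_def)
  qed
  \<comment> \<open>Written as a telescoping series, the sequence converges uniformly by the M-test,
    so the limit is holomorphic.\<close>
  define S where "S = (\<lambda>t. \<Sum>n. \<gamma> (Suc n) t - \<gamma> n t)"
  define \<Gamma> where "\<Gamma> = (\<lambda>t. (0, t) + S t)"
  have "uniform_limit (ball 0 r) (\<lambda>n t. \<Sum>i<n. \<gamma> (Suc i) t - \<gamma> i t) S sequentially"
    unfolding S_def
  proof (rule Weierstrass_m_test)
    show "summable (\<lambda>n. C * \<theta> ^ n)" using \<theta> by (intro summable_mult summable_geometric) simp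
    fix n t assume t: "t \<in> ball (0::complex) r"
    then have "(cmod t)\<^sup>2 \<le> 1" using r by (auto simp: power_le_one)
    then show "norm (\<gamma> (Suc n) t - \<gamma> n t) \<le> C * \<theta> ^ n"
      using est[of n] t mult_left_mono[of "(cmod t)\<^sup>2" 1 "C * \<theta> ^ n"] C \<theta> by (auto intro: order_trans)
  qed
  then have "uniform_limit (ball 0 r) (\<lambda>n t. (0, t) + (\<Sum>i<n. \<gamma> (Suc i) t - \<gamma> i t)) \<Gamma> sequentially"
    unfolding \<Gamma>_def by (intro uniform_limit_add uniform_limit_const)
  moreover have "(0, t) + (\<Sum>i<n. \<gamma> (Suc i) t - \<gamma> i t) = \<gamma> n t" for n t
    using sum_lessThan_telescope[of "\<lambda>i. \<gamma> i t" n] by (simp add: \<gamma>_0)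
  ultimately have lim: "uniform_limit (ball 0 r) \<gamma> \<Gamma> sequentially" by simp
  have hol_\<Gamma>: "(\<lambda>t. \<pi> (\<Gamma> t)) holomorphic_on ball 0 r"
    if \<pi>: "bounded_linear \<pi>" "\<And>n. (\<lambda>t. \<pi> (\<gamma> n t)) holomorphic_on ball 0 r" for \<pi> :: "complex \<times> complex \<Rightarrow> complex"
  proof (rule holomorphic_uniform_sequence[OF open_ball \<pi>(2)])
    fix x assume "x \<in> ball (0::complex) r"
    then obtain d where "d > 0" "cball x d \<subseteq> ball 0 r" using open_contains_cball open_ball by blast
    then show "\<exists>d>0. cball x d \<subseteq> ball 0 r \<and> uniform_limit (cball x d) (\<lambda>n t. \<pi> (\<gamma> n t)) (\<lambda>t. \<pi> (\<Gamma> t)) sequentially"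
      using uniform_limit_on_subset[OF bounded_linear.uniform_limit[OF \<pi>(1) lim]] by blast
  qed
  have ptw: "(\<lambda>n. \<gamma> n t) \<longlonglongrightarrow> \<Gamma> t" if "t \<in> ball 0 r" for t
    by (rule tendsto_uniform_limitI[OF lim that])
  have \<Gamma>_bound: "norm (\<Gamma> t - (0, t)) \<le> C' * (cmod t)\<^sup>2" if t: "t \<in> ball 0 r" for t
    by (rule Lim_norm_ubound[OF sequentially_bot tendsto_diff[OF ptw[OF t] tendsto_const]])
      (simp add: bound[OF t])
  have "\<Gamma> t = G (\<Gamma> (\<mu> * t))" if t: "t \<in> ball 0 r" for t
  proof (rule LIMSEQ_unique)
    show "(\<lambda>n. \<gamma> (Suc n) t) \<longlonglongrightarrow> \<Gamma> t" using ptw[OF t] by (rule LIMSEQ_Suc)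
    let ?s = "\<mu> * t"
    have s: "?s \<in> ball 0 r" by (rule mu_ball[OF t])
    have "(\<lambda>n. G (\<gamma> n ?s) - G (\<Gamma> ?s)) \<longlonglongrightarrow> 0"
    proof (rule Lim_null_comparison)
      show "\<forall>\<^sub>F n in sequentially. norm (G (\<gamma> n ?s) - G (\<Gamma> ?s)) \<le> l * norm (\<gamma> n ?s - \<Gamma> ?s)"
        by (intro always_eventually allI lip \<gamma>_\<delta>[OF s] in_\<delta>[OF \<Gamma>_bound[OF s] s])
      have "(\<lambda>n. \<gamma> n ?s - \<Gamma> ?s) \<longlonglongrightarrow> 0" using ptw[OF s] by (simp add: LIM_zero_iff)
      then show "(\<lambda>n. l * norm (\<gamma> n ?s - \<Gamma> ?s)) \<longlonglongrightarrow> 0"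
        by (intro tendsto_mult_right_zero tendsto_norm_zero)
    qed
    then show "(\<lambda>n. \<gamma> (Suc n) t) \<longlonglongrightarrow> G (\<Gamma> ?s)" by (simp add: \<gamma>_Suc LIM_zero_iff)
  qed
  with that[OF r(1) C' hol_\<Gamma>[OF bounded_linear_fst] hol_\<Gamma>[OF bounded_linear_snd]] \<Gamma>_bound hol_\<gamma>
  show ?thesis by blast
qed


lemma has_field_derivative_quadratic:
  fixes f :: "complex \<Rightarrow> complex"
  assumes "r > 0" "\<And>t. t \<in> ball 0 r \<Longrightarrow> cmod (f t - a * t) \<le> C * (cmod t)\<^sup>2"
  shows "(f has_field_derivative a) (at 0)"
proof -
  have f0: "f 0 = 0" using assms(2)[of 0] assms(1) by simp
  have "((\<lambda>h. (f (0 + h) - f 0) / h - a) \<longlongrightarrow> 0) (at 0)"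
  proof (rule Lim_null_comparison)
    have "\<forall>\<^sub>F h in at 0. h \<in> ball 0 r \<and> h \<noteq> (0::complex)"
      using assms(1) eventually_at_ball[of r 0 UNIV] eventually_neq_at_within[of 0 0 UNIV]
      by (auto elim: eventually_elim2 simp: eventually_conj_iff)
    then show "\<forall>\<^sub>F h in at 0. norm ((f (0 + h) - f 0) / h - a) \<le> C * cmod h"
    proof eventually_elim
      case (elim h)
      then have "cmod (f h - a * h) / cmod h \<le> C * (cmod h)\<^sup>2 / cmod h"
        by (intro divide_right_mono assms(2)) auto
      moreover have "(f (0 + h) - f 0) / h - a = (f h - a * h) / h"
        using elim by (simp add: f0 field_simps)
      ultimately show ?case using elim by (simp add: norm_divide power2_eq_square)
    qed
    show "((\<lambda>h. C * cmod h) \<longlongrightarrow> 0) (at 0)"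
      by (auto intro!: tendsto_eq_intros)
  qed
  then show ?thesis by (simp add: DERIV_def LIM_zero_iff)
qed

text \<open>The map \<Psi> carries the axis x = 0 onto the invariant curve with its linearizing
  parameter, and its derivative at the origin is the identity. In these coordinates (0, y) goes to
  (0, \<mu> y), so x divides both x_1 and y_1 - \<mu> y.\<close>

lemma stable_curve_coordinates:
  assumes K: "holomorphic_map_germ K"
    and off: "dy (\<lambda>p. fst (K p)) 0 = 0" "dx (\<lambda>p. snd (K p)) 0 = 0"
    and diag: "dx (\<lambda>p. fst (K p)) 0 = lam" "dy (\<lambda>p. snd (K p)) 0 = \<mu>"
    and lam: "cmod lam = 1" and \<mu>: "cmod \<mu> < 1" "\<mu> \<noteq> 0"
  obtains K' g where "germ_conj K K'" "holomorphic_germ g" "g 0 = lam"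
    "\<forall>\<^sub>F p in nhds 0. fst (K' p) = fst p * g p" "xcong 1 (\<lambda>p. snd (K' p)) (\<lambda>p. \<mu> * snd p)"
proof -
  have "lam \<noteq> 0" using lam by auto
  \<comment> \<open>The curve is constructed for the inverse germ; \<gamma>(t) = G(\<gamma>(\<mu>
    t)) then reads K(\<gamma>(t)) = \<gamma>(\<mu> t).\<close>
  obtain G where lcG: "local_coordinates K G"
    using inverse_germ[OF K] off diag \<mu> \<open>lam \<noteq> 0\<close> by auto
  then have G: "holomorphic_map_germ G" and KG: "\<forall>\<^sub>F p in nhds 0. K (G p) = p"
    by (auto simp: local_coordinates_def)
  note D = dx_compose_left_inverse[OF G K KG]
  have offG: "dy (\<lambda>p. fst (G p)) 0 = 0" "dx (\<lambda>p. snd (G p)) 0 = 0"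
    and diagG: "dx (\<lambda>p. fst (G p)) 0 = 1 / lam" "dy (\<lambda>p. snd (G p)) 0 = 1 / \<mu>"
    using D \<open>lam \<noteq> 0\<close> \<mu>(2) by (simp_all add: off diag field_simps)
  have normG: "cmod (dx (\<lambda>p. fst (G p)) 0) = 1" by (simp add: diagG norm_divide lam)
  obtain \<gamma> r C where \<gamma>: "r > 0" "C \<ge> 0" "(\<lambda>t. fst (\<gamma> t)) holomorphic_on ball 0 r" "(\<lambda>t. snd (\<gamma> t)) holomorphic_on ball 0 r"
    "\<And>t. t \<in> ball 0 r \<Longrightarrow> norm (\<gamma> t - (0, t)) \<le> C * (cmod t)\<^sup>2"
    "\<And>t. t \<in> ball 0 r \<Longrightarrow> \<gamma> t = G (\<gamma> (\<mu> * t))"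
    by (rule invariant_curve[OF G offG normG diagG(2) \<mu>], rule that)
  have \<gamma>0: "\<gamma> 0 = 0" using \<gamma>(5)[of 0] \<gamma>(1) by (simp flip: zero_prod_def)
  have 1: "cmod (fst (\<gamma> t) - 0 * t) \<le> C * (cmod t)\<^sup>2" and 2: "cmod (snd (\<gamma> t) - 1 * t) \<le> C * (cmod t)\<^sup>2"
    if "t \<in> ball 0 r" for t
    using order_trans[OF norm_fst_le[of "fst (\<gamma> t - (0, t))" "snd (\<gamma> t - (0, t))", unfolded prod.collapse] \<gamma>(5)[OF that]]
      order_trans[OF norm_snd_le[of "snd (\<gamma> t - (0, t))" "fst (\<gamma> t - (0, t))", unfolded prod.collapse] \<gamma>(5)[OF that]]
    by simp_all
  have d\<gamma>: "deriv (\<lambda>t. fst (\<gamma> t)) 0 = 0" "deriv (\<lambda>t. snd (\<gamma> t)) 0 = 1"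
    by (rule DERIV_imp_deriv[OF has_field_derivative_quadratic[OF \<gamma>(1) 1]], assumption)
      (rule DERIV_imp_deriv[OF has_field_derivative_quadratic[OF \<gamma>(1) 2]], assumption)
  define \<Psi> where "\<Psi> = (\<lambda>p. (fst p + fst (\<gamma> (snd p)), snd (\<gamma> (snd p))))"
  have \<Psi>: "holomorphic_map_germ \<Psi>"
    unfolding \<Psi>_def using \<gamma>0 \<gamma>(1)
    by (intro holomorphic_map_germ_Pair holomorphic_germ_add holomorphic_germ_fst
        holomorphic_germ_compose_holomorphic[OF holomorphic_germ_snd \<gamma>(3)]
        holomorphic_germ_compose_holomorphic[OF holomorphic_germ_snd \<gamma>(4)]) auto
  have d\<Psi>: "dx (\<lambda>p. fst (\<Psi> p)) 0 = 1" "dy (\<lambda>p. fst (\<Psi> p)) 0 = 0"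
    "dx (\<lambda>p. snd (\<Psi> p)) 0 = 0" "dy (\<lambda>p. snd (\<Psi> p)) 0 = 1"
    using \<gamma>0 d\<gamma> by (simp_all add: \<Psi>_def dx_def dy_def)
  obtain \<Phi> where lc: "local_coordinates \<Psi> \<Phi>"
    using inverse_germ[OF \<Psi>] d\<Psi> by auto
  then have \<Phi>: "holomorphic_map_germ \<Phi>" and inv: "\<forall>\<^sub>F p in nhds 0. \<Phi> (\<Psi> p) = p" "\<forall>\<^sub>F p in nhds 0. \<Psi> (\<Phi> p) = p"
    by (auto simp: local_coordinates_def)
  have d\<Phi>: "dx (\<lambda>p. fst (\<Phi> p)) 0 = 1" "dy (\<lambda>p. fst (\<Phi> p)) 0 = 0"
    using dx_compose_left_inverse[OF \<Phi> \<Psi> inv(2)] by (simp_all add: d\<Psi>)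
  define K' where "K' = (\<lambda>p. \<Phi> (K (\<Psi> p)))"
  have conj: "germ_conj K K'"
    unfolding germ_conj_def K'_def using local_coordinates_sym[OF lc] by blast
  have K\<Psi>: "holomorphic_map_germ (\<lambda>p. K (\<Psi> p))" by (rule holomorphic_map_germ_compose[OF K \<Psi>])
  have K': "holomorphic_map_germ K'" unfolding K'_def by (rule holomorphic_map_germ_compose[OF \<Phi> K\<Psi>])
  have axis: "holomorphic_map_germ (\<lambda>p::complex \<times> complex. (0, c * snd p))" for c
    by (intro germ_intros) auto
  have curve: "\<gamma> t = \<Psi> (0, t)" for t by (simp add: \<Psi>_def)
  have "\<forall>\<^sub>F p :: complex \<times> complex in nhds 0. K (G (\<Psi> (0, \<mu> * snd p))) = \<Psi> (0, \<mu> * snd p)"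
    by (rule eventually_map_germ[OF holomorphic_map_germ_compose[OF \<Psi> axis] KG])
  moreover have "\<forall>\<^sub>F p :: complex \<times> complex in nhds 0. \<Phi> (\<Psi> (0, \<mu> * snd p)) = (0, \<mu> * snd p)"
    by (rule eventually_map_germ[OF axis inv(1)])
  ultimately have inv_axis: "\<forall>\<^sub>F p :: complex \<times> complex in nhds 0. K' (0, snd p) = (0, \<mu> * snd p)"
    using eventually_snd_ball[OF \<gamma>(1)]
  proof eventually_elim
    case (elim p)
    then have "\<Psi> (0, snd p) = G (\<Psi> (0, \<mu> * snd p))" using \<gamma>(6)[of "snd p"] by (simp add: curve)
    then show ?case using elim by (simp add: K'_def)
  qed
  have fK': "holomorphic_germ (\<lambda>p. fst (K' p))" and sK': "holomorphic_germ (\<lambda>p. snd (K' p))"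
    using K' by (auto simp: holomorphic_map_germ_def)
  have "xcong 1 (\<lambda>p. fst (K' p)) (\<lambda>p. 0)"
    by (rule xcong_1_zeroI[OF fK']) (use inv_axis in eventually_elim, simp)
  then obtain g where g: "holomorphic_germ g" "\<forall>\<^sub>F p in nhds 0. fst (K' p) = 0 + fst p ^ 1 * g p"
    by (rule xcongE)
  then have g2: "\<forall>\<^sub>F p in nhds 0. fst (K' p) = fst p * g p" by simp
  \<comment> \<open>g(0) is the x-derivative of x_1 at the origin, which the coordinate change
    preserves since its derivative there is the identity.\<close>
  have "g 0 = dx (\<lambda>p. fst (K' p)) 0"
    using dx_dy_eventually_cong(1)[OF g2 holomorphic_germ_mult[OF holomorphic_germ_fst g(1)]]
      dx_mult_germ[OF holomorphic_germ_fst g(1)] by simp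
  also have "\<dots> = dx (\<lambda>p. fst (K (\<Psi> p))) 0"
    using dx_compose_germ(1)[OF holomorphic_map_germ_fst[OF \<Phi>] K\<Psi>] by (simp add: K'_def d\<Phi>)
  also have "\<dots> = lam"
    using dx_compose_germ(1)[OF holomorphic_map_germ_fst[OF K] \<Psi>] by (simp add: d\<Psi> diag)
  finally have g0: "g 0 = lam" .
  have "xcong 1 (\<lambda>p. snd (K' p)) (\<lambda>p. snd (K' (0, snd p)))"
    by (rule xcong_1_snd[OF sK'])
  also have "xcong 1 (\<lambda>p. snd (K' (0, snd p))) (\<lambda>p. \<mu> * snd p)"
    by (rule xcong_eventually_eq) (use inv_axis in eventually_elim, simp)
  finally show ?thesis using that[OF conj g(1) g0 g2] by blast
qed

text \<open>The eigenvectors are the columns of a linear change \<Psi>. The derivative of the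
  conjugate is read off from \<Psi> K = H \<Psi>, so that the inverse of \<Psi> need not be
  differentiated.\<close>

lemma diagonalizing_coordinates:
  assumes H: "holomorphic_map_germ H"
    and lam: "has_eigenvalue (frechet_derivative H (at 0)) lam"
    and \<mu>: "has_eigenvalue (frechet_derivative H (at 0)) \<mu>" and ne: "lam \<noteq> \<mu>"
  obtains K where "germ_conj H K" "dx (\<lambda>p. fst (K p)) 0 = lam" "dy (\<lambda>p. fst (K p)) 0 = 0"
    "dx (\<lambda>p. snd (K p)) 0 = 0" "dy (\<lambda>p. snd (K p)) 0 = \<mu>"
proof -
  define a b c d where abcd: "a = dx (\<lambda>p. fst (H p)) 0" "b = dy (\<lambda>p. fst (H p)) 0"
    "c = dx (\<lambda>p. snd (H p)) 0" "d = dy (\<lambda>p. snd (H p)) 0"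
  have FD: "frechet_derivative H (at 0) = (\<lambda>(u, v). (a * u + b * v, c * u + d * v))"
    using frechet_derivative_at[OF holomorphic_map_germ_has_derivative[OF H]] by (simp add: abcd)
  obtain \<alpha> \<beta> where ab: "(\<alpha>, \<beta>) \<noteq> 0" "a * \<alpha> + b * \<beta> = lam * \<alpha>" "c * \<alpha> + d * \<beta> = lam * \<beta>"
    using lam unfolding has_eigenvalue_def FD cscale_def by auto
  obtain \<gamma> \<delta> where gd: "(\<gamma>, \<delta>) \<noteq> 0" "a * \<gamma> + b * \<delta> = \<mu> * \<gamma>" "c * \<gamma> + d * \<delta> = \<mu> * \<delta>"
    using \<mu> unfolding has_eigenvalue_def FD cscale_def by auto
  \<comment> \<open>For proportional eigenvectors the eigenvalue equations would give
    (\<open>lam\<close> - \<mu>) \<alpha> \<gamma> = 0 and (\<open>lam\<close> - \<mu>) \<beta>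
    \<delta> = 0, and one of the vectors would vanish.\<close>
  have det: "\<alpha> * \<delta> \<noteq> \<gamma> * \<beta>"
  proof
    assume eq: "\<alpha> * \<delta> = \<gamma> * \<beta>"
    have "(lam - \<mu>) * (\<alpha> * \<gamma>) = (lam * \<alpha>) * \<gamma> - (\<mu> * \<gamma>) * \<alpha>" by (simp add: algebra_simps)
    also have "\<dots> = b * (\<gamma> * \<beta> - \<alpha> * \<delta>)" by (simp only: ab(2)[symmetric] gd(2)[symmetric]) (simp add: algebra_simps)
    finally have 1: "\<alpha> * \<gamma> = 0" using ne eq by simp
    have "(lam - \<mu>) * (\<beta> * \<delta>) = (lam * \<beta>) * \<delta> - (\<mu> * \<delta>) * \<beta>" by (simp add: algebra_simps)
    also have "\<dots> = c * (\<alpha> * \<delta> - \<gamma> * \<beta>)" by (simp only: ab(3)[symmetric] gd(3)[symmetric]) (simp add: algebra_simps)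
    finally have 2: "\<beta> * \<delta> = 0" using ne eq by simp
    show False using 1 2 eq ab(1) gd(1) by (auto simp: zero_prod_def)
  qed
  define \<Psi> where "\<Psi> = (\<lambda>p::complex \<times> complex. (\<alpha> * fst p + \<gamma> * snd p, \<beta> * fst p + \<delta> * snd p))"
  have \<Psi>: "holomorphic_map_germ \<Psi>"
    unfolding \<Psi>_def by (intro germ_intros) auto
  have lin: "deriv (\<lambda>x. k * x + l) z = k" "deriv (\<lambda>x. l + k * x) z = k" for k l z :: complex
    by (auto intro!: DERIV_imp_deriv derivative_eq_intros)
  have d\<Psi>: "dx (\<lambda>p. fst (\<Psi> p)) 0 = \<alpha>" "dy (\<lambda>p. fst (\<Psi> p)) 0 = \<gamma>"
    "dx (\<lambda>p. snd (\<Psi> p)) 0 = \<beta>" "dy (\<lambda>p. snd (\<Psi> p)) 0 = \<delta>"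
    unfolding \<Psi>_def dx_def dy_def fst_conv snd_conv by (simp_all only: lin)
  obtain \<Phi> where lc: "local_coordinates \<Psi> \<Phi>"
    using inverse_germ[OF \<Psi>] d\<Psi> det by auto
  then have \<Phi>: "holomorphic_map_germ \<Phi>" and inv: "\<forall>\<^sub>F p in nhds 0. \<Psi> (\<Phi> p) = p"
    by (auto simp: local_coordinates_def)
  define K where "K = (\<lambda>p. \<Phi> (H (\<Psi> p)))"
  have conj: "germ_conj H K"
    unfolding germ_conj_def K_def using local_coordinates_sym[OF lc] by blast
  have K: "holomorphic_map_germ K" by (rule germ_conj_map_germ[OF conj H])
  have H\<Psi>: "holomorphic_map_germ (\<lambda>p. H (\<Psi> p))" by (rule holomorphic_map_germ_compose[OF H \<Psi>])
  have ev: "\<forall>\<^sub>F p in nhds 0. \<Psi> (K p) = H (\<Psi> p)"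
    unfolding K_def by (rule eventually_map_germ[OF H\<Psi> inv])
  then have ev1: "\<forall>\<^sub>F p in nhds 0. fst (\<Psi> (K p)) = fst (H (\<Psi> p))" and ev2: "\<forall>\<^sub>F p in nhds 0. snd (\<Psi> (K p)) = snd (H (\<Psi> p))"
    by (auto elim: eventually_mono)
  have eqs: "\<alpha> * dx (\<lambda>p. fst (K p)) 0 + \<gamma> * dx (\<lambda>p. snd (K p)) 0 = lam * \<alpha>"
    "\<beta> * dx (\<lambda>p. fst (K p)) 0 + \<delta> * dx (\<lambda>p. snd (K p)) 0 = lam * \<beta>"
    "\<alpha> * dy (\<lambda>p. fst (K p)) 0 + \<gamma> * dy (\<lambda>p. snd (K p)) 0 = \<mu> * \<gamma>"
    "\<beta> * dy (\<lambda>p. fst (K p)) 0 + \<delta> * dy (\<lambda>p. snd (K p)) 0 = \<mu> * \<delta>"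
    using dx_dy_eventually_cong[OF ev1 holomorphic_map_germ_fst[OF H\<Psi>]] dx_dy_eventually_cong[OF ev2 holomorphic_map_germ_snd[OF H\<Psi>]]
      dx_compose_germ[OF holomorphic_map_germ_fst[OF \<Psi>] K] dx_compose_germ[OF holomorphic_map_germ_snd[OF \<Psi>] K]
      dx_compose_germ[OF holomorphic_map_germ_fst[OF H] \<Psi>] dx_compose_germ[OF holomorphic_map_germ_snd[OF H] \<Psi>]
      ab(2,3) gd(2,3)
    by (simp_all add: d\<Psi> abcd)
  have cramer: "u = u' \<and> v = v'" if "\<alpha> * u + \<gamma> * v = \<alpha> * u' + \<gamma> * v'" "\<beta> * u + \<delta> * v = \<beta> * u' + \<delta> * v'" for u v u' v'
  proof -
    have "(\<alpha> * \<delta> - \<gamma> * \<beta>) * (u - u') = \<delta> * ((\<alpha> * u + \<gamma> * v) - (\<alpha> * u' + \<gamma> * v')) - \<gamma> * ((\<beta> * u + \<delta> * v) - (\<beta> * u' + \<delta> * v'))"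
      "(\<alpha> * \<delta> - \<gamma> * \<beta>) * (v - v') = \<alpha> * ((\<beta> * u + \<delta> * v) - (\<beta> * u' + \<delta> * v')) - \<beta> * ((\<alpha> * u + \<gamma> * v) - (\<alpha> * u' + \<gamma> * v'))"
      by (simp_all add: algebra_simps)
    moreover have "(\<alpha> * u + \<gamma> * v) - (\<alpha> * u' + \<gamma> * v') = 0" "(\<beta> * u + \<delta> * v) - (\<beta> * u' + \<delta> * v') = 0"
      using that by simp_all
    ultimately have "(\<alpha> * \<delta> - \<gamma> * \<beta>) * (u - u') = 0" "(\<alpha> * \<delta> - \<gamma> * \<beta>) * (v - v') = 0"
      by (simp_all only: mult_zero_right diff_self)
    then show ?thesis using det by simp
  qed
  have "dx (\<lambda>p. fst (K p)) 0 = lam \<and> dx (\<lambda>p. snd (K p)) 0 = 0"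
    by (rule cramer) (use eqs in \<open>simp_all add: mult.commute\<close>)
  moreover have "dy (\<lambda>p. fst (K p)) 0 = 0 \<and> dy (\<lambda>p. snd (K p)) 0 = \<mu>"
    by (rule cramer) (use eqs in \<open>simp_all add: mult.commute\<close>)
  ultimately show ?thesis using that conj by blast
qed

section \<open>The normal form\<close>

text \<open>\<open>lam\<close>^k = 1 means that q divides k p, hence k, since p is prime to q. This
  is why resonant degrees have the form \<nu>q + 1.\<close>

lemma root_of_unity:
  assumes q: "q \<ge> 1" and cop: "coprime p (int q)"
    and lam: "lam = exp (2 * of_real pi * \<i> * of_int p / of_nat q)"
  shows "cmod lam = 1" "lam ^ q = 1" "lam ^ k = 1 \<Longrightarrow> q dvd k"
proof -
  have q0: "real q \<noteq> 0" using q by simp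
  have "lam = exp (\<i> * of_real (2 * pi * of_int p / of_nat q))"
    unfolding lam by (simp add: mult_ac)
  then show "cmod lam = 1" by (simp only: norm_exp_i_times)
  have pow: "lam ^ j = exp (of_nat j * (2 * of_real pi * \<i> * of_int p / of_nat q))" for j
    unfolding lam by (rule exp_of_nat_mult[symmetric])
  have "lam ^ q = exp (2 * of_real pi * \<i> * of_int p)"
    unfolding pow using q by simp
  also have "\<dots> = 1"
    by (simp add: exp_eq_1)
  finally show "lam ^ q = 1" .
  assume "lam ^ k = 1"
  then obtain n :: int where n: "Im (of_nat k * (2 * of_real pi * \<i> * of_int p / of_nat q)) = of_int (2 * n) * pi"
    unfolding pow exp_eq_1 by blast
  then have "real k * (2 * pi * of_int p / real q) = of_int (2 * n) * pi"
    by (simp add: Im_divide_of_nat)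
  then have "real k * of_int p = of_int n * real q"
    using q0 by (simp add: field_simps)
  then have "of_int (int k * p) = (of_int (n * int q) :: real)" by simp
  then have "int k * p = n * int q" by (simp only: of_int_eq_iff)
  then have "int q dvd int k * p" by simp
  then have "int q dvd int k"
    using cop by (simp add: coprime_dvd_mult_left_iff coprime_commute)
  then show "q dvd k" by simp
qed

lemma isolated_fixed_point_conjugate:
  assumes conj: "germ_conj H K" and H: "holomorphic_map_germ H"
    and isolated: "\<forall>\<^sub>F z in at 0. (H ^^ q) z \<noteq> z"
  shows "\<forall>\<^sub>F z in at 0. (K ^^ q) z \<noteq> z"
proof -
  obtain \<phi> \<psi> where lc: "local_coordinates \<phi> \<psi>" and K: "K = (\<lambda>p. \<phi> (H (\<psi> p)))"
    using conj unfolding germ_conj_def by blast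
  then have maps: "holomorphic_map_germ \<phi>" "holomorphic_map_germ \<psi>"
    and inv: "\<forall>\<^sub>F p in nhds 0. \<psi> (\<phi> p) = p" "\<forall>\<^sub>F p in nhds 0. \<phi> (\<psi> p) = p"
    by (auto simp: local_coordinates_def)
  have Kq: "\<forall>\<^sub>F p in nhds 0. (K ^^ q) p = \<phi> ((H ^^ q) (\<psi> p))"
    by (rule funpow_conjugate[OF lc H]) (simp add: K)
  have "\<forall>\<^sub>F p in nhds 0. \<psi> (\<phi> ((H ^^ q) (\<psi> p))) = (H ^^ q) (\<psi> p)"
    by (rule eventually_map_germ[OF holomorphic_map_germ_compose[OF holomorphic_map_germ_funpow[OF H] maps(2)] inv(1)])
  moreover have "\<forall>\<^sub>F p in nhds 0. \<psi> p \<noteq> 0 \<longrightarrow> (H ^^ q) (\<psi> p) \<noteq> \<psi> p"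
    using isolated by (intro eventually_map_germ[OF maps(2)]) (simp add: eventually_at_filter)
  ultimately have "\<forall>\<^sub>F p in nhds 0. p \<noteq> 0 \<longrightarrow> (K ^^ q) p \<noteq> p"
    using Kq inv(2)
  proof eventually_elim
    case (elim p)
    show ?case
    proof (intro impI notI)
      assume "p \<noteq> 0" and fixed: "(K ^^ q) p = p"
      then have "(H ^^ q) (\<psi> p) = \<psi> p" using elim(1,3) by simp
      then have "\<psi> p = 0" using elim(2) by blast
      then show False using elim(4) holomorphic_map_germ_0[OF maps(1)] \<open>p \<noteq> 0\<close> by simp
    qed
  qed
  then show ?thesis by (simp add: eventually_at_filter)
qed

text \<open>As \<open>lam\<close>^q = 1, a germ linear in x to high order has an iterate of order q
  that is the identity in x to that order. Then a high power of x divides x_q - x, which the finite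
  multiplicity excludes.\<close>

lemma resonant_term_exists:
  assumes K: "holomorphic_map_germ K" and lam: "cmod lam = 1" "lam ^ q = 1" and \<mu>: "cmod \<mu> < 1" and q: "q \<ge> 1"
    and fst_K: "xcong 2 (\<lambda>p. fst (K p)) (\<lambda>p. lam * fst p)"
    and snd_K: "xcong 1 (\<lambda>p. snd (K p)) (\<lambda>p. \<mu> * snd p)"
    and isolated: "\<forall>\<^sub>F z in at 0. (K ^^ q) z \<noteq> z"
  obtains K' N A where "germ_conj K K'" "2 \<le> N" "A \<noteq> 0" "lam ^ (N - 1) = 1"
    "xcong (Suc N) (\<lambda>p. fst (K' p)) (\<lambda>p. lam * (fst p + A * fst p ^ N))"
    "xcong 1 (\<lambda>p. snd (K' p)) (\<lambda>p. \<mu> * snd p)"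
proof -
  have "cmod (\<mu> ^ q) < 1" using \<mu> q by (simp add: norm_power power_less_one_iff)
  then have \<alpha>: "\<mu> ^ q - 1 \<noteq> 0" by auto
  have snd_iterate: "xcong 1 (\<lambda>p. snd ((L ^^ q) p) - snd p) (\<lambda>p. (\<mu> ^ q - 1) * snd p)"
    if "holomorphic_map_germ L" "xcong 1 (\<lambda>p. fst (L p)) (\<lambda>p. 0)" "xcong 1 (\<lambda>p. snd (L p)) (\<lambda>p. \<mu> * snd p)" for L
    using xcong_diff[OF conjunct2[OF iterate_on_axis[OF that, of q]] xcong_refl[of 1 snd]]
    by (simp add: algebra_simps)
  have germs: "holomorphic_germ (\<lambda>p. fst ((L ^^ q) p) - fst p)" "holomorphic_germ (\<lambda>p. snd ((L ^^ q) p) - snd p)"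
    if "holomorphic_map_germ L" for L
    by (intro germ_intros that)+
  have lead: "xcong 1 (\<lambda>p. fst (K p)) (\<lambda>p. 0)"
    by (rule xcong_trans[OF xcong_mono[OF fst_K] xcong_fst_cmult_zero]) simp
  have "\<exists>m. fixed_point_multiplicity K q \<le> enat m"
    unfolding fixed_point_multiplicity_def
  proof (rule solution_multiplicity_finite[OF germs(1)[OF K] _ germs(2)[OF K] snd_iterate[OF K lead snd_K] \<alpha>])
    show "fst ((K ^^ q) 0) - fst 0 = 0"
      using holomorphic_map_germ_0[OF holomorphic_map_germ_funpow[OF K]] by simp
    show "\<forall>\<^sub>F p in at 0. fst ((K ^^ q) p) - fst p \<noteq> 0 \<or> snd ((K ^^ q) p) - snd p \<noteq> 0"
      using isolated by eventually_elim (auto simp: prod_eq_iff)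
  qed
  then obtain m where m: "fixed_point_multiplicity K q \<le> enat m" by blast
  \<comment> \<open>The order m + 3 exceeds the bound m, and it is \<open>Suc (m + 2)\<close> with m
    + 2 >= 2, the shape needed to apply \<open>iterate_normal_form\<close> with c = 0.\<close>
  have not_flat: "\<not> (\<exists>K'. germ_conj K K' \<and> xcong (m + 3) (\<lambda>p. fst (K' p)) (\<lambda>p. lam * fst p) \<and>
        xcong 1 (\<lambda>p. snd (K' p)) (\<lambda>p. \<mu> * snd p))"
  proof safe
    fix K' assume K': "germ_conj K K'" "xcong (m + 3) (\<lambda>p. fst (K' p)) (\<lambda>p. lam * fst p)"
      "xcong 1 (\<lambda>p. snd (K' p)) (\<lambda>p. \<mu> * snd p)"
    have hK': "holomorphic_map_germ K'" by (rule germ_conj_map_germ[OF K'(1) K])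
    have lead': "xcong 1 (\<lambda>p. fst (K' p)) (\<lambda>p. 0)"
      by (rule xcong_trans[OF xcong_mono[OF K'(2)] xcong_fst_cmult_zero]) simp
    have "xcong (Suc (m + 2)) (\<lambda>p. fst (K' p)) (\<lambda>p. lam * (fst p + 0 * fst p ^ (m + 2)))"
      using K'(2) by (simp add: eval_nat_numeral)
    from iterate_normal_form[OF hK' this, of q]
    have "xcong (m + 3) (\<lambda>p. fst ((K' ^^ q) p)) fst"
      by (simp add: lam(2) eval_nat_numeral)
    from xcong_diff[OF this xcong_refl[of _ fst]]
    have "xcong (m + 3) (\<lambda>p. fst ((K' ^^ q) p) - fst p) (\<lambda>p. 0)" by simp
    from solution_multiplicity_ge[OF germs(2)[OF hK'] snd_iterate[OF hK' lead' K'(3)] \<alpha> this]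
    have "enat (m + 3) \<le> fixed_point_multiplicity K' q" by (simp add: fixed_point_multiplicity_def)
    also have "\<dots> = fixed_point_multiplicity K q"
      using K'(1) fixed_point_multiplicity_conjugate[OF _ K] unfolding germ_conj_def by blast
    finally have "enat (m + 3) \<le> enat m" using m by (rule order_trans)
    then show False by simp
  qed
  have "2 \<le> m + 3" by simp
  from leading_term_dichotomy[OF K lam(1) \<mu> fst_K snd_K this]
  have "\<exists>K' N A. germ_conj K K' \<and> 2 \<le> N \<and> A \<noteq> 0 \<and> lam ^ (N - 1) = 1 \<and>
        xcong (Suc N) (\<lambda>p. fst (K' p)) (\<lambda>p. lam * (fst p + A * fst p ^ N)) \<and>
        xcong 1 (\<lambda>p. snd (K' p)) (\<lambda>p. \<mu> * snd p)"
    by (elim disjE) (assumption, erule notE[OF not_flat])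
  then show ?thesis
    by (elim exE conjE) (rule that)
qed

text \<open>A nonresonant coefficient of x^(N+d) is already zero after
  \<open>coefficient_normalization\<close>; a resonant one is removed by a further change. The bound
  \<open>d < N\<close> stops the induction just before the factor d + 1 - N vanishes.\<close>

lemma normalize_up_to_residue:
  assumes K: "holomorphic_map_germ K" and lam: "cmod lam = 1" and \<mu>: "cmod \<mu> < 1"
    and N: "2 \<le> N" "lam ^ (N - 1) = 1"
    and fst_K: "xcong (Suc N) (\<lambda>p. fst (K p)) (\<lambda>p. lam * (fst p + 1 * fst p ^ N))"
    and snd_K: "xcong 1 (\<lambda>p. snd (K p)) (\<lambda>p. \<mu> * snd p)" and d: "1 \<le> d" "d < N"
  shows "\<exists>K'. germ_conj K K' \<and> xcong (N + d) (\<lambda>p. fst (K' p)) (\<lambda>p. lam * (fst p + 1 * fst p ^ N)) \<and>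
    xcong 1 (\<lambda>p. snd (K' p)) (\<lambda>p. \<mu> * snd p)"
  using d
proof (induction d rule: nat_induct_at_least)
  case base
  show ?case using germ_conj_refl fst_K snd_K by auto
next
  case (Suc d)
  then obtain K1 where K1: "germ_conj K K1" "xcong (N + d) (\<lambda>p. fst (K1 p)) (\<lambda>p. lam * (fst p + 1 * fst p ^ N))"
      "xcong 1 (\<lambda>p. snd (K1 p)) (\<lambda>p. \<mu> * snd p)"
    by auto
  have Nd: "2 \<le> N + d" using N by simp
  obtain K2 A where K2: "germ_conj K1 K2"
    "xcong (Suc (N + d)) (\<lambda>p. fst (K2 p)) (\<lambda>p. lam * (fst p + 1 * fst p ^ N + A * fst p ^ (N + d)))"
    "xcong 1 (\<lambda>p. snd (K2 p)) (\<lambda>p. \<mu> * snd p)" "lam ^ (N + d - 1) = 1 \<or> A = 0"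
    by (rule coefficient_normalization[OF germ_conj_map_germ[OF K1(1) K] lam \<mu> K1(2,3) Nd N(1)],
        rule that)
  have conj: "germ_conj K K2" by (rule germ_conj_trans[OF K1(1) K2(1)])
  show ?case
  proof (cases "lam ^ d = 1")
    case True
    obtain K3 where "germ_conj K2 K3"
      "xcong (Suc (N + d)) (\<lambda>p. fst (K3 p)) (\<lambda>p. lam * (fst p + 1 * fst p ^ N))"
      "xcong 1 (\<lambda>p. snd (K3 p)) (\<lambda>p. \<mu> * snd p)"
      by (rule resonant_coefficient_removal[OF germ_conj_map_germ[OF conj K] True K2(2,3) Suc.hyps Suc.prems one_neq_zero],
          rule that)
    then show ?thesis using germ_conj_trans[OF conj] by auto
  next
    case False
    \<comment> \<open>Since \<open>lam\<close>^(N-1) = 1, the degree N + d is resonant only if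
      \<open>lam\<close>^d = 1.\<close>
    have "lam ^ (N + d - 1) = lam ^ (N - 1) * lam ^ d" using N(1) by (simp flip: power_add)
    then have "A = 0" using K2(4) N(2) False by simp
    then show ?thesis using K2 conj by auto
  qed
qed

section \<open>Expansion in powers of x with coefficients holomorphic in y\<close>

lemma higher_dx:
  assumes U: "open U" and g: "holomorphic2_on g U"
  shows "holomorphic2_on ((dx ^^ k) g) U"
    and "(x, y) \<in> U \<Longrightarrow> (deriv ^^ k) (\<lambda>x. g (x, y)) x = (dx ^^ k) g (x, y)"
proof -
  show "holomorphic2_on ((dx ^^ k) g) U"
    by (induction k) (simp_all add: g holomorphic2_on_dx[OF U])
  show "(deriv ^^ k) (\<lambda>x. g (x, y)) x = (dx ^^ k) g (x, y)" if "(x, y) \<in> U"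
    using that
  proof (induction k arbitrary: x)
    case (Suc k)
    have "filterlim (\<lambda>x'. (x', y)) (nhds (x, y)) (nhds x)"
      by (intro tendsto_Pair tendsto_const filterlim_ident)
    then have "\<forall>\<^sub>F x' in nhds x. (x', y) \<in> U"
      using topological_tendstoD[OF _ U Suc.prems] by blast
    then have "\<forall>\<^sub>F x' in nhds x. (deriv ^^ k) (\<lambda>x. g (x, y)) x' = (dx ^^ k) g (x', y)"
      by eventually_elim (rule Suc.IH)
    from deriv_cong_ev[OF this refl] show ?case
      by (simp add: dx_def[of "(dx ^^ k) g"])
  qed simp
qed

text \<open>The Taylor coefficients in x are iterated partial derivatives restricted to x = 0, hence
  holomorphic in y on the whole disc. The a_j arise in this way.\<close>

lemma partial_power_series:
  assumes g: "holomorphic2_on g (ball 0 r \<times> ball 0 r)" and x: "x \<in> ball 0 r" and y: "y \<in> ball 0 r"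
  shows "(\<lambda>k. (dx ^^ k) g (0, y) / fact k * x ^ k) sums g (x, y)"
    and "(\<lambda>y. (dx ^^ k) g (0, y) / fact k) holomorphic_on ball 0 r"
proof -
  have U: "open (ball (0::complex) r \<times> ball (0::complex) r)" by (auto intro: open_Times)
  have r: "r > 0" using x by (auto intro: le_less_trans[OF norm_ge_zero])
  have "(\<lambda>x. g (x, y)) holomorphic_on ball 0 r"
    by (intro holomorphic2_on_compose_curve[OF U open_ball g] holomorphic_intros) (use y in auto)
  from holomorphic_power_series[OF this x]
  show "(\<lambda>k. (dx ^^ k) g (0, y) / fact k * x ^ k) sums g (x, y)"
    using higher_dx(2)[OF U g, of 0 y] r y by simp
  show "(\<lambda>y. (dx ^^ k) g (0, y) / fact k) holomorphic_on ball 0 r"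
    by (intro holomorphic_intros holomorphic2_on_compose_curve[OF U open_ball higher_dx(1)[OF U g]]) (use r in auto)
qed

theorem proposition3p3:
  fixes H :: "complex \<times> complex \<Rightarrow> complex \<times> complex"
    and p :: int and q :: nat and lam \<mu> :: complex
  assumes "semi_parabolic_germ H p q lam \<mu>"
    and "\<mu> \<noteq> 0"
    and "\<forall>\<^sub>F z in at 0. (H ^^ q) z \<noteq> z"
  shows "\<exists>\<nu>::nat. \<nu> \<ge> 1 \<and>
    (\<exists>\<phi> \<psi>. local_coordinates \<phi> \<psi> \<and>
      (\<exists>(C :: complex) (a :: nat \<Rightarrow> complex \<Rightarrow> complex) (h :: complex \<times> complex \<Rightarrow> complex) (r :: real).
        r > 0 \<and>
        (\<forall>j \<ge> 2 * \<nu> * q + 2. a j holomorphic_on ball 0 r) \<and>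
        holomorphic2_on h (ball 0 r \<times> ball 0 r) \<and>
        (\<forall>x \<in> ball 0 r. \<forall>y \<in> ball 0 r.
          summable (\<lambda>k. a (2 * \<nu> * q + 2 + k) y * x ^ (2 * \<nu> * q + 2 + k)) \<and>
          \<phi> (H (\<psi> (x, y))) =
            (lam * (x + x ^ (\<nu> * q + 1) + C * x ^ (2 * \<nu> * q + 1)
                  + (\<Sum>k. a (2 * \<nu> * q + 2 + k) y * x ^ (2 * \<nu> * q + 2 + k))),
             \<mu> * y + x * h (x, y))))) \<and>
    fixed_point_multiplicity H q = enat (\<nu> * q + 1)"
proof -
  have H: "holomorphic_map_germ H" and q: "q \<ge> 1" and \<mu>: "cmod \<mu> < 1"
    and eig: "has_eigenvalue (frechet_derivative H (at 0)) lam" "has_eigenvalue (frechet_derivative H (at 0)) \<mu>"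
    and lam: "cmod lam = 1" "lam ^ q = 1" "\<And>k. lam ^ k = 1 \<Longrightarrow> q dvd k"
    using assms(1) root_of_unity[of q p lam] unfolding semi_parabolic_germ_def by blast+
  have ne: "lam \<noteq> \<mu>" "lam \<noteq> 0" using lam(1) \<mu> by auto
  obtain K1 where K1: "germ_conj H K1" "dx (\<lambda>p. fst (K1 p)) 0 = lam" "dy (\<lambda>p. fst (K1 p)) 0 = 0"
    "dx (\<lambda>p. snd (K1 p)) 0 = 0" "dy (\<lambda>p. snd (K1 p)) 0 = \<mu>"
    by (rule diagonalizing_coordinates[OF H eig ne(1)], rule that)
  note h1 = germ_conj_map_germ[OF K1(1) H]
  obtain K2 g where K2: "germ_conj K1 K2" "holomorphic_germ g" "g 0 = lam"
    "\<forall>\<^sub>F p in nhds 0. fst (K2 p) = fst p * g p" "xcong 1 (\<lambda>p. snd (K2 p)) (\<lambda>p. \<mu> * snd p)"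
    by (rule stable_curve_coordinates[OF h1 K1(3,4,2,5) lam(1) \<mu> assms(2)], rule that)
  note h2 = germ_conj_map_germ[OF K2(1) h1]
  obtain K3 where K3: "germ_conj K2 K3" "xcong 2 (\<lambda>p. fst (K3 p)) (\<lambda>p. lam * fst p)"
    "xcong 1 (\<lambda>p. snd (K3 p)) (\<lambda>p. \<mu> * snd p)"
    by (rule linear_part_normalization[OF h2 K2(2,3) ne(2) K2(4,5) \<mu>], rule that)
  note h3 = germ_conj_map_germ[OF K3(1) h2]
  have c3: "germ_conj H K3"
    by (rule germ_conj_trans[OF germ_conj_trans[OF K1(1) K2(1)] K3(1)])
  obtain K4 N A where K4: "germ_conj K3 K4" "2 \<le> N" "A \<noteq> 0" "lam ^ (N - 1) = 1"
    "xcong (Suc N) (\<lambda>p. fst (K4 p)) (\<lambda>p. lam * (fst p + A * fst p ^ N))"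
    "xcong 1 (\<lambda>p. snd (K4 p)) (\<lambda>p. \<mu> * snd p)"
    by (rule resonant_term_exists[OF h3 lam(1,2) \<mu> q K3(2,3) isolated_fixed_point_conjugate[OF c3 H assms(3)]], rule that)
  note h4 = germ_conj_map_germ[OF K4(1) h3]
  obtain K5 where K5: "germ_conj K4 K5" "xcong (Suc N) (\<lambda>p. fst (K5 p)) (\<lambda>p. lam * (fst p + 1 * fst p ^ N))"
    "xcong 1 (\<lambda>p. snd (K5 p)) (\<lambda>p. \<mu> * snd p)"
    by (rule leading_coefficient_scaling[OF h4 K4(2,3,5,6)], rule that)
  note h5 = germ_conj_map_germ[OF K5(1) h4]
  have c5: "germ_conj H K5" by (rule germ_conj_trans[OF germ_conj_trans[OF c3 K4(1)] K5(1)])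
  have "q dvd N - 1" by (rule lam(3)[OF K4(4)])
  then obtain \<nu> where "N - 1 = q * \<nu>" by (rule dvdE)
  then have N: "N = \<nu> * q + 1" using K4(2) by (simp add: mult.commute)
  have \<nu>: "\<nu> \<ge> 1" using N K4(2) by (cases \<nu>) auto
  \<comment> \<open>d = N - 1 is the last value that \<open>normalize_up_to_residue\<close> allows;
    it clears all degrees between N and 2N - 1.\<close>
  have "1 \<le> N - 1" "N - 1 < N" using K4(2) by auto
  from normalize_up_to_residue[OF h5 lam(1) \<mu> K4(2,4) K5(2,3) this]
  obtain K6 where K6: "germ_conj K5 K6" "xcong (N + (N - 1)) (\<lambda>p. fst (K6 p)) (\<lambda>p. lam * (fst p + 1 * fst p ^ N))"
    "xcong 1 (\<lambda>p. snd (K6 p)) (\<lambda>p. \<mu> * snd p)" by blast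
  note h6 = germ_conj_map_germ[OF K6(1) h5]
  have "2 \<le> N + (N - 1)" using K4(2) by simp
  \<comment> \<open>Degree 2N - 1 is resonant too, so its coefficient is only made constant; this
    constant is C.\<close>
  obtain K7 C where K7: "germ_conj K6 K7"
    "xcong (Suc (N + (N - 1))) (\<lambda>p. fst (K7 p)) (\<lambda>p. lam * (fst p + 1 * fst p ^ N + C * fst p ^ (N + (N - 1))))"
    "xcong 1 (\<lambda>p. snd (K7 p)) (\<lambda>p. \<mu> * snd p)"
    by (rule coefficient_normalization[OF h6 lam(1) \<mu> K6(2,3) \<open>2 \<le> N + (N - 1)\<close> K4(2)], rule that)
  have c7: "germ_conj H K7" by (rule germ_conj_trans[OF germ_conj_trans[OF c5 K6(1)] K7(1)])
  have Ns: "Suc (N + (N - 1)) = 2 * \<nu> * q + 2" "N + (N - 1) = 2 * \<nu> * q + 1"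
    by (simp_all add: N)
  obtain g1 where g1: "holomorphic_germ g1"
    "\<forall>\<^sub>F p in nhds 0. fst (K7 p) = lam * (fst p + 1 * fst p ^ N + C * fst p ^ (N + (N - 1))) + fst p ^ Suc (N + (N - 1)) * g1 p"
    by (rule xcongE[OF K7(2)], rule that)
  obtain h where h: "holomorphic_germ h" "\<forall>\<^sub>F p in nhds 0. snd (K7 p) = \<mu> * snd p + fst p ^ 1 * h p"
    by (rule xcongE[OF K7(3)], rule that)
  obtain r1 where r1: "r1 > 0" "holomorphic2_on g1 (ball 0 r1)" using holomorphic_germ_ball[OF g1(1)] .
  obtain r2 where r2: "r2 > 0" "holomorphic2_on h (ball 0 r2)" using holomorphic_germ_ball[OF h(1)] .
  from eventually_conj[OF g1(2) h(2)] obtain r3 where r3: "r3 > 0"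
    "\<And>p. p \<in> ball 0 r3 \<Longrightarrow> fst (K7 p) = lam * (fst p + 1 * fst p ^ N + C * fst p ^ (N + (N - 1))) + fst p ^ Suc (N + (N - 1)) * g1 p
      \<and> snd (K7 p) = \<mu> * snd p + fst p ^ 1 * h p"
    unfolding eventually_nhds_metric by (auto simp: dist_commute)
  define R where "R = min r1 (min r2 r3)"
  \<comment> \<open>The bidisc of radius R/2 lies in the Euclidean ball of radius R.\<close>
  define r where "r = R / 2"
  have r: "r > 0" using r1 r2 r3 by (simp add: r_def R_def)
  have "ball 0 r \<times> ball 0 r \<subseteq> cball (0::complex) r \<times> ball (0::complex) r" by auto
  also have "\<dots> \<subseteq> ball (0, 0) R" by (rule polydisc_subset_ball) (use r in \<open>auto simp: r_def\<close>)
  finally have sub: "ball 0 r \<times> ball 0 r \<subseteq> ball (0 :: complex \<times> complex) R" by (simp add: zero_prod_def)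
  \<comment> \<open>In the normal form \<open>lam\<close> multiplies the whole bracket, so the
    remainder is divided by it.\<close>
  define G where "G = (\<lambda>p. inverse lam * g1 p)"
  have G: "holomorphic2_on G (ball 0 r \<times> ball 0 r)"
    unfolding G_def by (intro holomorphic2_on_cmult holomorphic2_on_subset[OF r1(2)] order_trans[OF sub]) (auto simp: R_def)
  have hh: "holomorphic2_on h (ball 0 r \<times> ball 0 r)"
    by (intro holomorphic2_on_subset[OF r2(2)] order_trans[OF sub]) (auto simp: R_def)
  \<comment> \<open>The coefficient of x^k in \<open>G\<close> becomes the one with index 2\<nu>q +
    2 + k; the subtraction undoes this shift.\<close>
  define a where "a = (\<lambda>j y. (dx ^^ (j - (2 * \<nu> * q + 2))) G (0, y) / fact (j - (2 * \<nu> * q + 2)))"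
  have a: "a j holomorphic_on ball 0 r" for j
    unfolding a_def using r by (intro partial_power_series(2)[OF G, of 0 0]) auto
  obtain \<phi> \<psi> where lc: "local_coordinates \<phi> \<psi>" and K7_eq: "K7 = (\<lambda>p. \<phi> (H (\<psi> p)))"
    using c7 unfolding germ_conj_def by blast
  have series: "summable (\<lambda>k. a (2 * \<nu> * q + 2 + k) y * x ^ (2 * \<nu> * q + 2 + k)) \<and>
      \<phi> (H (\<psi> (x, y))) =
        (lam * (x + x ^ (\<nu> * q + 1) + C * x ^ (2 * \<nu> * q + 1)
              + (\<Sum>k. a (2 * \<nu> * q + 2 + k) y * x ^ (2 * \<nu> * q + 2 + k))),
         \<mu> * y + x * h (x, y))" if xy: "x \<in> ball 0 r" "y \<in> ball 0 r" for x y
  proof -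
    have "(\<lambda>k. x ^ (2 * \<nu> * q + 2) * ((dx ^^ k) G (0, y) / fact k * x ^ k)) sums (x ^ (2 * \<nu> * q + 2) * G (x, y))"
      by (intro sums_mult partial_power_series(1)[OF G xy])
    then have sums: "(\<lambda>k. a (2 * \<nu> * q + 2 + k) y * x ^ (2 * \<nu> * q + 2 + k)) sums (x ^ (2 * \<nu> * q + 2) * G (x, y))"
      by (simp add: a_def power_add mult_ac)
    have "(x, y) \<in> ball 0 r3" using subsetD[OF sub, of "(x, y)"] xy by (simp add: R_def)
    from r3(2)[OF this]
    have K7_xy: "K7 (x, y) = (lam * (x + x ^ N + C * x ^ (N + (N - 1))) + x ^ Suc (N + (N - 1)) * g1 (x, y), \<mu> * y + x * h (x, y))"
      by (simp add: prod_eq_iff)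
    have "lam * G (x, y) = g1 (x, y)" using ne(2) by (simp add: G_def)
    then have "K7 (x, y) = (lam * (x + x ^ (\<nu> * q + 1) + C * x ^ (2 * \<nu> * q + 1) + x ^ (2 * \<nu> * q + 2) * G (x, y)), \<mu> * y + x * h (x, y))"
      unfolding K7_xy Ns N[symmetric] by (simp add: distrib_left mult.left_commute[of lam])
    then show ?thesis
      using sums_summable[OF sums] sums_unique[OF sums] by (simp add: K7_eq)
  qed
  \<comment> \<open>The multiplicity can be read off from \<open>K5\<close> already: modulo x^(N+1),
    x_q - x is q x^N, and q is nonzero.\<close>
  have "fixed_point_multiplicity H q = fixed_point_multiplicity K5 q"
    using c5 fixed_point_multiplicity_conjugate[OF _ H] unfolding germ_conj_def by metis
  also have "\<dots> = enat N"
    unfolding fixed_point_multiplicity_def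
  proof (rule solution_multiplicity_eq)
    have "lam ^ N = lam" using K4(2,4) by (cases N) auto
    then have "xcong (Suc N) (\<lambda>p. fst ((K5 ^^ q) p)) (\<lambda>p. lam ^ q * (fst p + of_nat q * 1 * fst p ^ N))"
      by (intro iterate_normal_form[OF h5 K5(2) K4(2)]) simp
    from xcong_diff[OF this xcong_refl[of _ fst]]
    show "xcong (Suc N) (\<lambda>p. fst ((K5 ^^ q) p) - fst p) (\<lambda>p. of_nat q * fst p ^ N)"
      by (simp add: lam(2))
    show "holomorphic_germ (\<lambda>p. snd ((K5 ^^ q) p) - snd p)" by (intro germ_intros h5)
    have "xcong 1 (\<lambda>p. fst (K5 p)) (\<lambda>p. 0)"
      by (rule normal_form_leading(2)[OF K5(2) _ K4(2)]) (use K4(2) in simp)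
    from xcong_diff[OF conjunct2[OF iterate_on_axis[OF h5 this K5(3), of q]] xcong_refl[of 1 snd]]
    show "xcong 1 (\<lambda>p. snd ((K5 ^^ q) p) - snd p) (\<lambda>p. (\<mu> ^ q - 1) * snd p)"
      by (simp add: algebra_simps)
    have "cmod (\<mu> ^ q) < 1" using \<mu> q by (simp add: norm_power power_less_one_iff)
    then show "\<mu> ^ q - 1 \<noteq> 0" by auto
    show "(of_nat q :: complex) \<noteq> 0" using q by simp
  qed
  finally have mult: "fixed_point_multiplicity H q = enat (\<nu> * q + 1)" by (simp add: N)
  show ?thesis
    using \<nu> lc r a hh series mult
    by (intro exI[of _ \<nu>] conjI exI[of _ \<phi>] exI[of _ \<psi>] exI[of _ C] exI[of _ a] exI[of _ h] exI[of _ r] ballI allI impI) auto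
qed

end
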